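(* Let $\gamma>3$. Suppose that, for $n\ge1$, $G_n$ is a random simple graph with vertex set $\{1,\dots,n\}$ such that $G_n$ conditioned on its degree sequence $(d_i(G_n))_{i=1}^n$ is uniformly distributed over all graphs on $\{1,\dots,n\}$ with this degree sequence. Suppose further that for every $\varepsilon>0$ there exists $\delta>0$ such that, for all sufficiently large $n$, $$\mathbb{P}\Bigl(\sup_{k\ge1}k^{\gamma-1}\,\bigl|\{i: d_i(G_n)\ge k\}\bigr|/n>\delta^{-1}\Bigr)<\varepsilon,$$ $$\mathbb{P}\bigl(\mu(G_n)<\delta\bigr)<\varepsilon,$$ $$\mathbb{P}\bigl(\nu(G_n)>1-\delta\bigr)<\varepsilon,$$ where $\mu(G_n)$ and $\nu(G_n)$ are the random variables defined in the context. Then, as $n\to\infty$, $$|\mathcal{C}_1(G_n)|=\frac{\Delta(G_n)}{1-\nu(G_n)}+o_p\bigl(n^{1/(\gamma-1)}\bigr),$$ and, in particular, $|\mathcal{C}_1(G_n)|=O_p\bigl(n^{1/(\gamma-1)}\bigr)$.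
   Context: For a graph $G_n$ on $\{1,\dots,n\}$, $d_i(G_n)$ is the degree of vertex $i$, and $$\mu(G_n):=\frac1n\sum_{i=1}^n d_i(G_n),\quad \nu(G_n):=\frac{1}{n\mu(G_n)}\sum_{i=1}^n d_i(G_n)\bigl(d_i(G_n)-1\bigr),\quad \Delta(G_n):=\max_i d_i(G_n).$$ These are random variables depending only on the degree sequence of $G_n$. Convention: $\nu(G_n):=0$ when $\mu(G_n)=0$, and $\Delta(G_n)/(1-\nu(G_n))$ is given an arbitrary value when $\nu(G_n)=1$ (under the hypotheses these events have probability tending to $0$). $\mathcal{C}_1(G_n)$ is the largest component of $G_n$ (any choice among them if there is a tie), and $|\mathcal{C}_1(G_n)|$ its number of vertices. The uniformity condition is equivalent to: $\mathbb{P}(G_n=H_1)=\mathbb{P}(G_n=H_2)$ for any two graphs $H_1,H_2$ on $\{1,\dots,n\}$ with the same degree sequence. $X_n=o_p(a_n)$ means $\mathbb{P}(|X_n|>\varepsilon a_n)\to0$ for every $\varepsilon>0$; $X_n=O_p(a_n)$ means that for every $\varepsilon>0$ there is a constant $C$ with $\mathbb{P}(|X_n|>Ca_n)<\varepsilon$ for all sufficiently large $n$. *)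

theory Defs
  imports "HOL-Probability.Probability"
begin

(* A simple graph with vertex set {1..n} is identified with its edge set. *)
definition simple_graphs :: "nat \<Rightarrow> nat set set set" where
  "simple_graphs n = Pow {e. e \<subseteq> {1..n} \<and> card e = 2}"

definition vdeg :: "nat set set \<Rightarrow> nat \<Rightarrow> nat" where
  "vdeg E i = card {j. {i, j} \<in> E}"

definition deg_seq :: "nat \<Rightarrow> nat set set \<Rightarrow> nat list" where
  "deg_seq n E = map (vdeg E) [1..<Suc n]"

definition mean_deg :: "nat \<Rightarrow> nat set set \<Rightarrow> real" where
  "mean_deg n E = (\<Sum>i=1..n. real (vdeg E i)) / real n"

(* If the mean degree is 0, this is 0 because x / 0 = 0. *)
definition nu :: "nat \<Rightarrow> nat set set \<Rightarrow> real" where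
  "nu n E = (\<Sum>i=1..n. real (vdeg E i) * (real (vdeg E i) - 1)) / (real n * mean_deg n E)"

definition max_deg :: "nat \<Rightarrow> nat set set \<Rightarrow> nat" where
  "max_deg n E = Max (vdeg E ` {1..n})"

(* The supremum is over a bounded set of reals: for a simple graph on {1..n} all terms
   with k \<ge> n vanish. *)
definition tail_sup :: "real \<Rightarrow> nat \<Rightarrow> nat set set \<Rightarrow> real" where
  "tail_sup \<gamma> n E =
     (SUP k\<in>{1::nat..}. real k powr (\<gamma> - 1) * real (card {i\<in>{1..n}. k \<le> vdeg E i}) / real n)"

definition connectedness :: "nat \<Rightarrow> nat set set \<Rightarrow> nat rel" where
  "connectedness n E = {(u, v) \<in> {1..n} \<times> {1..n}. (u, v) \<in> {(x, y). {x, y} \<in> E}\<^sup>*}"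

definition graph_components :: "nat \<Rightarrow> nat set set \<Rightarrow> nat set set" where
  "graph_components n E = {1..n} // connectedness n E"

definition is_largest_component :: "nat \<Rightarrow> nat set set \<Rightarrow> nat set \<Rightarrow> bool" where
  "is_largest_component n E C \<longleftrightarrow>
     C \<in> graph_components n E \<and> (\<forall>D\<in>graph_components n E. card D \<le> card C)"

(* c is the arbitrary value given to the quotient when nu = 1. *)
definition deg_ratio :: "real \<Rightarrow> nat \<Rightarrow> nat set set \<Rightarrow> real" where
  "deg_ratio c n E = (if nu n E = 1 then c else real (max_deg n E) / (1 - nu n E))"

definition uniform_given_degrees :: "nat \<Rightarrow> 'a measure \<Rightarrow> ('a \<Rightarrow> nat set set) \<Rightarrow> bool" where
  "uniform_given_degrees n M G \<longleftrightarrow>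
     (\<forall>d. \<P>(\<omega> in M. deg_seq n (G \<omega>) = d) > 0 \<longrightarrow>
       (\<forall>H\<in>simple_graphs n. deg_seq n H = d \<longrightarrow>
          \<P>(\<omega> in M. G \<omega> = H \<bar> deg_seq n (G \<omega>) = d)
            = 1 / real (card {H'\<in>simple_graphs n. deg_seq n H' = d})))"

(* For each n, X n is a real random variable on its own probability space M n. *)
definition small_o_prob ::
    "(nat \<Rightarrow> 'a measure) \<Rightarrow> (nat \<Rightarrow> 'a \<Rightarrow> real) \<Rightarrow> (nat \<Rightarrow> real) \<Rightarrow> bool" where
  "small_o_prob M X a \<longleftrightarrow>
     (\<forall>\<epsilon>>0. (\<lambda>n. \<P>(\<omega> in M n. \<bar>X n \<omega>\<bar> > \<epsilon> * a n)) \<longlonglongrightarrow> 0)"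

definition big_O_prob ::
    "(nat \<Rightarrow> 'a measure) \<Rightarrow> (nat \<Rightarrow> 'a \<Rightarrow> real) \<Rightarrow> (nat \<Rightarrow> real) \<Rightarrow> bool" where
  "big_O_prob M X a \<longleftrightarrow>
     (\<forall>\<epsilon>>0. \<exists>C. \<forall>\<^sub>F n in sequentially. \<P>(\<omega> in M n. \<bar>X n \<omega>\<bar> > C * a n) < \<epsilon>)"

end

theory Submission
  imports Defs "HOL-Real_Asymp.Real_Asymp"
begin

text \<open>
  Fix a degree sequence and consider the uniform graph with these degrees. A switching argument
  shows that prescribed edges at a vertex \<open>v\<close> appear with probability at most about
  \<open>d\<^sub>v d\<^sub>u / (2m)\<close> each, and deleting \<open>v\<close> leaves a uniform graph with the residual degrees. So a
  component can be explored vertex by vertex without the configuration model.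

  Upper bound: with \<open>a = n\<^bsup>1/(\<gamma>-1)\<^esup>\<close>, call a vertex big if its degree is at least \<open>a\<^bsup>1-\<tau>\<^esup>\<close>. There are only
  \<open>O(n\<^sup>\<tau>)\<close> big vertices and no two of them are connected with high probability. In an
  exploration that does not enter further big vertices, \<open>exp (s \<cdot> found)\<close> with \<open>s = a\<^bsup>\<tau>-1\<^esup>\<close> is dominated by a
  product supermartingale, so the component of \<open>v\<close> has at most \<open>d\<^sub>v / (1 - \<nu>) + o(a)\<close> vertices with an error
  probability small enough for a union bound over all \<open>v\<close>.

  Lower bound: from a vertex of maximal degree, (number explored) + \<open>\<Sum>\<close> over the active vertices of
  \<open>1 + c min(d, K)\<close> is a submartingale for \<open>c\<close> slightly below \<open>1 / (1 - \<nu>)\<close>, because the upper bounds on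
  edge probabilities almost add up to the exact value \<open>d\<^sub>v\<close> and so are nearly attained. Hence the mean of
  the component size nearly matches its upper bound, and Markov's inequality gives concentration.
\<close>

section \<open>Switchings\<close>

text \<open>Since \<open>\<gamma> > 3\<close>, a^2 = o(n). Degrees and components are O(a), so the
  switching error O(a^2) and the degrees lost over O(a) deletions are negligible against a total
  degree of order n. The union over n vertices needs exponential moments at a rate s with s a
  tending to infinity, but then exp (s d) explodes for degrees d near a. Below the cut a^(1-\<tau>)
  the product s d stays bounded, and the quadratic error of exp costs s^2 times the sum of d^3,
  which is O(s n a^(\<tau>-\<sigma>)) by the moment of order 2+\<sigma>; hence \<tau> < \<sigma>. A
  component that meets the big vertices is explored from one of them, so hits must be excluded only
  for O(n^\<tau>) starts, each failing with probability O(n^\<tau> a^2 / n); hence n^(2\<tau>) a^2 =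
  o(n). The lower bound needs no second moment: a variable that rarely exceeds U and has mean nearly
  U is rarely far below U. The potential is truncated at a constant K because its errors are its
  maximum times a^2 / n; a maximum of order a would require a^3 = o(n), that is
  \<open>\<gamma> > 4\<close>.\<close>

definition nbrs :: "nat set set \<Rightarrow> nat \<Rightarrow> nat set" where
  "nbrs E v = {u. {v, u} \<in> E}"

text \<open>The degree function is total but constrains only vertices of \<open>V\<close>, so
  deleting a vertex shrinks \<open>V\<close> and may leave any value of \<open>d\<close>
  behind.\<close>

definition graphs :: "nat set \<Rightarrow> (nat \<Rightarrow> nat) \<Rightarrow> nat set set set" where
  "graphs V d = {E. E \<subseteq> {e. e \<subseteq> V \<and> card e = 2} \<and> (\<forall>i\<in>V. vdeg E i = d i)}"

definition delete_vertex :: "nat \<Rightarrow> nat set set \<Rightarrow> nat set set" where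
  "delete_vertex v E = {e \<in> E. v \<notin> e}"

lemma vdeg_eq_card_nbrs: "vdeg E v = card (nbrs E v)"
  by (simp add: vdeg_def nbrs_def)

lemma finite_graphs: "finite V \<Longrightarrow> finite (graphs V d)"
  by (rule finite_subset[of _ "Pow (Pow V)"]) (auto simp: graphs_def)

lemma graphs_edgeD:
  assumes "E \<in> graphs V d" "{x, y} \<in> E"
  shows "x \<in> V" "y \<in> V" "x \<noteq> y"
proof -
  have *: "{x, y} \<subseteq> V \<and> card {x, y} = 2"
    using assms by (auto simp: graphs_def)
  then show "x \<in> V" "y \<in> V" by auto
  show "x \<noteq> y" using * by auto
qed

lemma nbrs_subset: "E \<in> graphs V d \<Longrightarrow> nbrs E v \<subseteq> V - {v}"
  using graphs_edgeD[of E V d v] by (auto simp: nbrs_def)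

lemma finite_nbrs: "E \<in> graphs V d \<Longrightarrow> finite V \<Longrightarrow> finite (nbrs E v)"
  using nbrs_subset finite_subset by (metis finite_Diff)

lemma card_nbrs: "E \<in> graphs V d \<Longrightarrow> v \<in> V \<Longrightarrow> card (nbrs E v) = d v"
  by (simp add: graphs_def vdeg_eq_card_nbrs)

lemma nbrs_sym: "u \<in> nbrs E v \<longleftrightarrow> v \<in> nbrs E u"
  by (simp add: nbrs_def insert_commute)

lemma nbrs_delete_vertex: "nbrs (delete_vertex v E) w = (if w = v then {} else nbrs E w - {v})"
  by (auto simp: nbrs_def delete_vertex_def)

text \<open>The switching replaces the edges \<open>vu\<close>, \<open>xy\<close> by \<open>vx\<close>, \<open>uy\<close>; the star from \<open>v\<close> to \<open>S\<close> survives.\<close>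

lemma switching:
  fixes V :: "nat set" and d :: "nat \<Rightarrow> nat"
  assumes fin: "finite V" and v: "v \<in> V" and u: "u \<in> V" "u \<noteq> v" "u \<notin> S"
    and bound: "\<And>i. i \<in> V \<Longrightarrow> d i \<le> \<Delta>"
  shows "card {E \<in> graphs V d. insert u S \<subseteq> nbrs E v} * ((\<Sum>i\<in>V. d i) - (2 * \<Delta>^2 + 4 * \<Delta>))
       \<le> card {E \<in> graphs V d. S \<subseteq> nbrs E v} * ((d v - card S) * d u)"
proof -
  let ?G1 = "{E \<in> graphs V d. insert u S \<subseteq> nbrs E v}"
  let ?G0 = "{E \<in> graphs V d. S \<subseteq> nbrs E v}"
  \<comment> \<open>The oriented edges that can be switched: v, u, x, y are distinct and the new
    edges vx, uy are not yet present.\<close>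
  define R where "R E = {(x, y). {x, y} \<in> E \<and> x \<notin> {v, u} \<and> y \<notin> {v, u} \<and> x \<notin> nbrs E v \<and> y \<notin> nbrs E u}" for E
  define P where "P = (SIGMA E:?G1. R E)"
  define Q where "Q = (SIGMA E:?G0. (nbrs E v - S) \<times> nbrs E u)"
  define f where "f = (\<lambda>(E, x, y). ((E - {{v, u}, {x, y}}) \<union> {{v, x}, {u, y}}, x, y))"
  have fin1: "finite ?G1" and fin0: "finite ?G0" using finite_graphs[OF fin] by auto
  have card_R: "(\<Sum>i\<in>V. d i) - (2 * \<Delta>^2 + 4 * \<Delta>) \<le> card (R E) \<and> finite (R E)" if E: "E \<in> graphs V d" for E
  proof -
    define A where "A = Sigma V (nbrs E)"
    define B1 where "B1 = {v} \<times> nbrs E v"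
    define B2 where "B2 = {u} \<times> nbrs E u"
    define B3 where "B3 = nbrs E v \<times> {v}"
    define B4 where "B4 = nbrs E u \<times> {u}"
    define B5 where "B5 = Sigma (nbrs E v) (nbrs E)"
    define B6 where "B6 = (\<lambda>(x, y). (y, x)) ` Sigma (nbrs E u) (nbrs E)"
    have fn: "finite (nbrs E w)" for w using finite_nbrs[OF E fin] .
    have cn: "card (nbrs E w) \<le> \<Delta>" if "w \<in> V" for w
      using card_nbrs[OF E that] bound[OF that] by simp
    have cA: "card A = (\<Sum>i\<in>V. d i)"
      unfolding A_def using fin fn card_nbrs[OF E] by (simp add: card_SigmaI)
    \<comment> \<open>An unusable oriented edge starts or ends at v or u (\<open>B1\<close> to
      \<open>B4\<close>, at most \<open>\<Delta>\<close> each), or has x adjacent to v or y adjacent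
      to u (\<open>B5\<close>, \<open>B6\<close>, at most \<open>\<Delta>^2\<close> each). This is
      the origin of the correction in the statement.\<close>
    have sub: "A \<subseteq> R E \<union> (B1 \<union> B2 \<union> B3 \<union> B4 \<union> B5 \<union> B6)"
    proof
      fix p assume "p \<in> A"
      then obtain x y where p: "p = (x, y)" "x \<in> V" "y \<in> nbrs E x" by (auto simp: A_def)
      show "p \<in> R E \<union> (B1 \<union> B2 \<union> B3 \<union> B4 \<union> B5 \<union> B6)"
        using p nbrs_sym[of y E x]
        by (auto simp: R_def B1_def B2_def B3_def B4_def B5_def B6_def image_iff) (auto simp: nbrs_def)
    qed
    have c5: "card (Sigma (nbrs E w) (nbrs E)) \<le> \<Delta>^2" if "w \<in> V" for w
    proof -
      have "card (Sigma (nbrs E w) (nbrs E)) = (\<Sum>x\<in>nbrs E w. card (nbrs E x))"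
        using fn by (simp add: card_SigmaI)
      also have "\<dots> \<le> (\<Sum>x\<in>nbrs E w. \<Delta>)"
        using nbrs_subset[OF E, of w] by (intro sum_mono cn) auto
      also have "\<dots> \<le> \<Delta> * \<Delta>" using cn[OF that] by simp
      finally show ?thesis by (simp add: power2_eq_square)
    qed
    have finA: "finite A" unfolding A_def using fin fn by auto
    have RA: "R E \<subseteq> A" using graphs_edgeD[OF E] by (auto simp: R_def A_def nbrs_def)
    have finR: "finite (R E)" using finite_subset[OF RA finA] .
    have finB: "finite (B1 \<union> B2 \<union> B3 \<union> B4 \<union> B5 \<union> B6)"
      unfolding B1_def B2_def B3_def B4_def B5_def B6_def using fn by auto
    have "card A \<le> card (R E \<union> (B1 \<union> B2 \<union> B3 \<union> B4 \<union> B5 \<union> B6))"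
      using sub finR finB by (intro card_mono) auto
    also have "\<dots> \<le> card (R E) + (card B1 + card B2 + card B3 + card B4 + card B5 + card B6)"
      by (intro order.trans[OF card_Un_le] add_mono order.refl)
    also have "\<dots> \<le> card (R E) + (\<Delta> + \<Delta> + \<Delta> + \<Delta> + \<Delta>^2 + \<Delta>^2)"
    proof (intro add_mono order.refl)
      show "card B1 \<le> \<Delta>" "card B2 \<le> \<Delta>" "card B3 \<le> \<Delta>" "card B4 \<le> \<Delta>"
        unfolding B1_def B2_def B3_def B4_def using cn[OF v] cn[OF u(1)]
        by (simp_all add: card_cartesian_product)
      show "card B5 \<le> \<Delta>^2" unfolding B5_def using c5[OF v] .
      show "card B6 \<le> \<Delta>^2" unfolding B6_def
        using c5[OF u(1)] by (rule order.trans[OF card_image_le, rotated]) (use fn in auto)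
    qed
    finally show ?thesis using cA finR by simp
  qed
  have cardP: "card ?G1 * ((\<Sum>i\<in>V. d i) - (2 * \<Delta>^2 + 4 * \<Delta>)) \<le> card P"
  proof -
    have "card P = (\<Sum>E\<in>?G1. card (R E))"
      unfolding P_def using fin1 card_R by (intro card_SigmaI) auto
    also have "\<dots> \<ge> (\<Sum>E\<in>?G1. (\<Sum>i\<in>V. d i) - (2 * \<Delta>^2 + 4 * \<Delta>))"
      using card_R by (intro sum_mono) auto
    finally show ?thesis by simp
  qed
  have cardQ: "card Q = card ?G0 * ((d v - card S) * d u)"
  proof -
    have "card Q = (\<Sum>E\<in>?G0. card ((nbrs E v - S) \<times> nbrs E u))"
      unfolding Q_def using fin0 finite_nbrs fin by (intro card_SigmaI) auto
    also have "\<dots> = (\<Sum>E\<in>?G0. (d v - card S) * d u)"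
    proof (intro sum.cong refl)
      fix E assume E: "E \<in> ?G0"
      then have "finite S" using finite_nbrs fin finite_subset by blast
      then show "card ((nbrs E v - S) \<times> nbrs E u) = (d v - card S) * d u"
        using E v u card_nbrs[of E V d] by (simp add: card_cartesian_product card_Diff_subset)
    qed
    finally show ?thesis by simp
  qed
  have inj: "inj_on f P"
  proof (rule inj_onI)
    fix p q assume p: "p \<in> P" and q: "q \<in> P" and eq: "f p = f q"
    obtain E x y where p': "p = (E, x, y)" by (metis prod_cases3)
    obtain E' x' y' where q': "q = (E', x', y')" by (metis prod_cases3)
    have xy: "x' = x" "y' = y" using eq by (auto simp: p' q' f_def)
    \<comment> \<open>The image keeps x and y, so the two exchanged edges can be put back: the
      switching is invertible.\<close>
    have rec: "E0 = ((E0 - {{v, u}, {x, y}}) \<union> {{v, x}, {u, y}}) - {{v, x}, {u, y}} \<union> {{v, u}, {x, y}}"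
      if "(E0, x, y) \<in> P" for E0
    proof -
      have "{v, u} \<in> E0" "{x, y} \<in> E0" "{v, x} \<notin> E0" "{u, y} \<notin> E0"
        using that by (auto simp: P_def R_def nbrs_def)
      then show ?thesis by auto
    qed
    have "(E - {{v, u}, {x, y}}) \<union> {{v, x}, {u, y}} = (E' - {{v, u}, {x, y}}) \<union> {{v, x}, {u, y}}"
      using eq by (simp add: p' q' xy f_def)
    then have "E = E'" using rec[of E] rec[of E'] p q unfolding p' q' xy by metis
    then show "p = q" by (simp add: p' q' xy)
  qed
  have img: "f ` P \<subseteq> Q"
  proof
    fix r assume "r \<in> f ` P"
    then obtain E x y where Exy: "(E, x, y) \<in> P" "r = f (E, x, y)" by auto
    define E' where "E' = (E - {{v, u}, {x, y}}) \<union> {{v, x}, {u, y}}"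
    have E: "E \<in> graphs V d" and S: "S \<subseteq> nbrs E v" and uv: "{v, u} \<in> E" and xy: "{x, y} \<in> E"
      and ne: "x \<noteq> v" "x \<noteq> u" "y \<noteq> v" "y \<noteq> u" and nvx: "{v, x} \<notin> E" and nuy: "{u, y} \<notin> E"
      using Exy by (auto simp: P_def R_def nbrs_def)
    have xyV: "x \<in> V" "y \<in> V" "x \<noteq> y" using graphs_edgeD[OF E xy] .
    have fn: "finite (nbrs E w)" for w using finite_nbrs[OF E fin] .
    have nv: "nbrs E' v = insert x (nbrs E v - {u})"
      using ne u xyV by (auto simp: nbrs_def E'_def doubleton_eq_iff)
    have nu: "nbrs E' u = insert y (nbrs E u - {v})"
      using ne u xyV by (auto simp: nbrs_def E'_def doubleton_eq_iff)
    have nx: "nbrs E' x = insert v (nbrs E x - {y})"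
      using ne u xyV by (auto simp: nbrs_def E'_def doubleton_eq_iff)
    have ny: "nbrs E' y = insert u (nbrs E y - {x})"
      using ne u xyV by (auto simp: nbrs_def E'_def doubleton_eq_iff)
    have no: "nbrs E' w = nbrs E w" if "w \<noteq> v" "w \<noteq> u" "w \<noteq> x" "w \<noteq> y" for w
      using that by (auto simp: nbrs_def E'_def doubleton_eq_iff)
    have swap: "card (insert b (nbrs E w - {c})) = card (nbrs E w)" if "c \<in> nbrs E w" "b \<notin> nbrs E w" for b c w
      using that fn[of w] card_Suc_Diff1[OF fn that(1)] by simp
    have "card (nbrs E' w) = card (nbrs E w)" for w
    proof -
      consider "w = v" | "w = u" | "w = x" | "w = y" | "w \<noteq> v" "w \<noteq> u" "w \<noteq> x" "w \<noteq> y" by blast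
      then show ?thesis
      proof cases
        case 1 then show ?thesis unfolding 1 nv using uv nvx by (intro swap) (auto simp: nbrs_def)
      next
        case 2 then show ?thesis unfolding 2 nu using uv nuy by (intro swap) (auto simp: nbrs_def insert_commute)
      next
        case 3 then show ?thesis unfolding 3 nx using xy nvx by (intro swap) (auto simp: nbrs_def insert_commute)
      next
        case 4 then show ?thesis unfolding 4 ny using xy nuy by (intro swap) (auto simp: nbrs_def insert_commute)
      next
        case 5 then show ?thesis by (simp add: no)
      qed
    qed
    moreover have "E' \<subseteq> {e. e \<subseteq> V \<and> card e = 2}"
      using E v u xyV ne by (auto simp: graphs_def E'_def)
    ultimately have "E' \<in> graphs V d" using E by (auto simp: graphs_def vdeg_eq_card_nbrs)
    moreover have "S \<subseteq> nbrs E' v" using S u(3) by (auto simp: nv)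
    \<comment> \<open>The new neighbour x was not adjacent to v before, hence lies outside
      \<open>S\<close>; this leaves only \<open>d v - card S\<close> choices for it.\<close>
    moreover have "x \<in> nbrs E' v - S" using S nvx by (auto simp: nv nbrs_def[of E])
    moreover have "y \<in> nbrs E' u" by (simp add: nu)
    ultimately show "r \<in> Q" using Exy(2) by (auto simp: Q_def f_def E'_def)
  qed
  have "finite Q" unfolding Q_def using fin0 finite_nbrs fin by (intro finite_SigmaI finite_cartesian_product) auto
  then have "card P \<le> card Q" using card_inj_on_le[OF inj img] by simp
  then show ?thesis using cardP cardQ by simp
qed

lemma of_nat_diff_ge: "real a - real b \<le> real (a - b)"
  by simp

text \<open>The edges at \<open>v\<close> are dominated by independent choices: each of the
  \<open>d v - card S\<close> free edges picks its endpoint u with probability d u / M. Prescribing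
  a set \<open>S\<close> of neighbours makes the induction on \<open>U\<close> close, because
  expanding the factor of one vertex yields the same kind of sum with that vertex added to
  \<open>S\<close>.\<close>

lemma star_weight_bound:
  fixes V :: "nat set" and d :: "nat \<Rightarrow> nat" and M :: real and f :: "nat \<Rightarrow> real"
  assumes fin: "finite V" and v: "v \<in> V" and bound: "\<And>i. i \<in> V \<Longrightarrow> d i \<le> \<Delta>"
    and M: "M > 0" "M + (2 * real \<Delta>^2 + 4 * real \<Delta>) \<le> (\<Sum>i\<in>V. real (d i))"
    and f: "\<And>u. f u \<ge> 0" and U: "U \<subseteq> V - {v}" "U \<inter> S = {}" and S: "S \<subseteq> V"
  shows "(\<Sum>E | E \<in> graphs V d \<and> S \<subseteq> nbrs E v. \<Prod>u\<in>nbrs E v \<inter> U. 1 + f u)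
     \<le> card {E \<in> graphs V d. S \<subseteq> nbrs E v} * (1 + (\<Sum>u\<in>U. d u * f u) / M) ^ (d v - card S)"
proof -
  have sw: "real (card {E \<in> graphs V d. insert u S \<subseteq> nbrs E v})
     \<le> card {E \<in> graphs V d. S \<subseteq> nbrs E v} * (real (d v - card S) * d u / M)"
    if "u \<in> V" "u \<noteq> v" "u \<notin> S" for u S
  proof -
    have "M \<le> real ((\<Sum>i\<in>V. d i) - (2 * \<Delta>^2 + 4 * \<Delta>))"
      using M(2) by (intro order.trans[OF _ of_nat_diff_ge]) simp
    then have "real (card {E \<in> graphs V d. insert u S \<subseteq> nbrs E v}) * M
      \<le> real (card {E \<in> graphs V d. insert u S \<subseteq> nbrs E v}) * real ((\<Sum>i\<in>V. d i) - (2 * \<Delta>^2 + 4 * \<Delta>))"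
      by (intro mult_left_mono) auto
    also have "\<dots> \<le> card {E \<in> graphs V d. S \<subseteq> nbrs E v} * (real (d v - card S) * d u)"
      unfolding of_nat_mult[symmetric] of_nat_le_iff by (rule switching[OF fin v that bound])
    finally show ?thesis using M(1) by (simp add: field_simps)
  qed
  have finU: "finite U" using U fin finite_subset by blast
  then show ?thesis using U S
  proof (induction U arbitrary: S rule: finite_induct)
    case empty
    then show ?case by simp
  next
    case (insert w U)
    define k where "k = d v - card S"
    define x where "x = 1 + (\<Sum>u\<in>U. d u * f u) / M"
    define N where "N = real (card {E \<in> graphs V d. S \<subseteq> nbrs E v})"
    have x: "x \<ge> 1" unfolding x_def using M f by (simp add: sum_nonneg)
    have finS: "finite S" using insert.prems fin finite_subset by blast
    have fing: "finite (graphs V d)" using finite_graphs[OF fin] .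
    have split: "(\<Prod>u\<in>nbrs E v \<inter> insert w U. 1 + f u) =
       (\<Prod>u\<in>nbrs E v \<inter> U. 1 + f u) + (if w \<in> nbrs E v then f w * (\<Prod>u\<in>nbrs E v \<inter> U. 1 + f u) else 0)" for E
      using insert.hyps by (auto simp: Int_insert_right algebra_simps)
    have "(\<Sum>E | E \<in> graphs V d \<and> S \<subseteq> nbrs E v. \<Prod>u\<in>nbrs E v \<inter> insert w U. 1 + f u)
       = (\<Sum>E | E \<in> graphs V d \<and> S \<subseteq> nbrs E v. \<Prod>u\<in>nbrs E v \<inter> U. 1 + f u)
         + f w * (\<Sum>E | E \<in> graphs V d \<and> insert w S \<subseteq> nbrs E v. \<Prod>u\<in>nbrs E v \<inter> U. 1 + f u)"
    proof -
      have "(\<Sum>E | E \<in> graphs V d \<and> S \<subseteq> nbrs E v. if w \<in> nbrs E v then f w * (\<Prod>u\<in>nbrs E v \<inter> U. 1 + f u) else 0)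
         = (\<Sum>E | E \<in> graphs V d \<and> insert w S \<subseteq> nbrs E v. f w * (\<Prod>u\<in>nbrs E v \<inter> U. 1 + f u))"
        using fing by (subst sum.inter_filter[symmetric]) (auto intro!: sum.cong)
      then show ?thesis by (simp add: split sum.distrib sum_distrib_left)
    qed
    \<comment> \<open>Switching bounds the number of graphs that contain the edge to
      \<open>w\<close>; one free edge fewer remains there, hence the exponent
      \<open>k - 1\<close>.\<close>
    also have "\<dots> \<le> N * x ^ k + f w * (N * (real k * d w / M) * x ^ (k - 1))"
    proof (intro add_mono mult_left_mono f)
      show "(\<Sum>E | E \<in> graphs V d \<and> S \<subseteq> nbrs E v. \<Prod>u\<in>nbrs E v \<inter> U. 1 + f u) \<le> N * x ^ k"
        unfolding N_def x_def k_def using insert.prems by (intro insert.IH) auto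
      have "(\<Sum>E | E \<in> graphs V d \<and> insert w S \<subseteq> nbrs E v. \<Prod>u\<in>nbrs E v \<inter> U. 1 + f u)
        \<le> card {E \<in> graphs V d. insert w S \<subseteq> nbrs E v} * x ^ (d v - card (insert w S))"
        unfolding x_def using insert.prems insert.hyps by (intro insert.IH) auto
      also have "d v - card (insert w S) = k - 1"
        using insert.prems finS by (simp add: k_def)
      also have "card {E \<in> graphs V d. insert w S \<subseteq> nbrs E v} * x ^ (k - 1) \<le> N * (real k * d w / M) * x ^ (k - 1)"
        unfolding N_def k_def using x insert.prems by (intro mult_right_mono sw) auto
      finally show "(\<Sum>E | E \<in> graphs V d \<and> insert w S \<subseteq> nbrs E v. \<Prod>u\<in>nbrs E v \<inter> U. 1 + f u)
         \<le> N * (real k * d w / M) * x ^ (k - 1)" .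
    qed
    also have "\<dots> = N * (x ^ k + real k * (d w * f w / M) * x ^ (k - 1))"
      by (simp add: algebra_simps)
    also have "\<dots> \<le> N * (x + d w * f w / M) ^ k"
    proof (intro mult_left_mono)
      define t where "t = d w * f w / M"
      have t: "t \<ge> 0" unfolding t_def using f M by auto
      \<comment> \<open>The left side is the start of the binomial expansion; dividing by
        \<open>x ^ k\<close> reduces it to Bernoulli's inequality.\<close>
      have "x ^ k + real k * t * x ^ (k - 1) \<le> (x + t) ^ k"
      proof (cases k)
        case 0 then show ?thesis by simp
      next
        case (Suc j)
        have "(1 + t / x) ^ k \<ge> 1 + real k * (t / x)"
          using x t by (intro Bernoulli_inequality) (simp add: order.trans[of "-1" 0])
        then have "x ^ k * (1 + real k * (t / x)) \<le> x ^ k * (1 + t / x) ^ k"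
          using x by (intro mult_left_mono) auto
        also have "\<dots> = (x + t) ^ k" using x by (simp add: power_mult_distrib[symmetric] field_simps)
        also have "x ^ k * (1 + real k * (t / x)) = x ^ k + real k * t * x ^ (k - 1)"
          using x Suc by (simp add: field_simps)
        finally show ?thesis .
      qed
      then show "x ^ k + real k * (d w * f w / M) * x ^ (k - 1) \<le> (x + d w * f w / M) ^ k"
        by (simp add: t_def)
    qed (simp add: N_def)
    also have "x + d w * f w / M = 1 + (\<Sum>u\<in>insert w U. d u * f u) / M"
      using insert.hyps by (simp add: x_def add_divide_distrib)
    finally show ?case by (simp add: N_def k_def)
  qed
qed

section \<open>Exploration by vertex deletion\<close>

definition residual :: "(nat \<Rightarrow> nat) \<Rightarrow> nat set \<Rightarrow> nat \<Rightarrow> nat" where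
  "residual d S u = (if u \<in> S then d u - 1 else d u)"

text \<open>Candidates for the neighbourhood of \<open>v\<close>; a candidate may be realised by no
  graph. Positive degrees on \<open>S\<close> guarantee that the subtraction in
  \<open>residual\<close> does not truncate there.\<close>

definition star_sets :: "nat set \<Rightarrow> (nat \<Rightarrow> nat) \<Rightarrow> nat \<Rightarrow> nat set set" where
  "star_sets V d v = {S. S \<subseteq> V - {v} \<and> card S = d v \<and> (\<forall>u\<in>S. d u \<ge> 1)}"

lemma finite_star_sets: "finite V \<Longrightarrow> finite (star_sets V d v)"
  by (rule finite_subset[of _ "Pow V"]) (auto simp: star_sets_def)

lemma nbrs_in_star_sets:
  assumes "finite V" "v \<in> V" "E \<in> graphs V d"
  shows "nbrs E v \<in> star_sets V d v"
proof -
  have "d u \<ge> 1" if "u \<in> nbrs E v" for u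
  proof -
    have "u \<in> V" using that nbrs_subset[OF assms(3)] by auto
    then show ?thesis using that card_nbrs[OF assms(3)] finite_nbrs[OF assms(3,1)] nbrs_sym[of u E v]
      by (metis Suc_leI One_nat_def card_gt_0_iff emptyE)
  qed
  then show ?thesis using nbrs_subset[OF assms(3)] card_nbrs[OF assms(3,2)] by (auto simp: star_sets_def)
qed

text \<open>A star at \<open>v\<close> can be removed and glued back in exactly one way. So, given
  the neighbourhood of \<open>v\<close>, the remaining graph is again uniform with the residual
  degrees.\<close>

lemma bij_betw_delete_vertex:
  assumes fin: "finite V" and v: "v \<in> V" and S: "S \<in> star_sets V d v"
  shows "bij_betw (delete_vertex v) {E \<in> graphs V d. nbrs E v = S} (graphs (V - {v}) (residual d S))"
proof (rule bij_betwI[where g = "\<lambda>E. E \<union> (\<lambda>u. {v, u}) ` S"])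
  show "delete_vertex v \<in> {E \<in> graphs V d. nbrs E v = S} \<rightarrow> graphs (V - {v}) (residual d S)"
  proof
    fix E assume E: "E \<in> {E \<in> graphs V d. nbrs E v = S}"
    have "vdeg (delete_vertex v E) i = residual d S i" if "i \<in> V - {v}" for i
      using that E card_nbrs[of E V d i] finite_nbrs[of E V d i] fin nbrs_sym[of i E v]
      by (auto simp: vdeg_eq_card_nbrs nbrs_delete_vertex residual_def)
    moreover have "delete_vertex v E \<subseteq> {e. e \<subseteq> V - {v} \<and> card e = 2}"
      using E by (auto simp: graphs_def delete_vertex_def)
    ultimately show "delete_vertex v E \<in> graphs (V - {v}) (residual d S)" by (simp add: graphs_def)
  qed
  show "(\<lambda>E. E \<union> (\<lambda>u. {v, u}) ` S) \<in> graphs (V - {v}) (residual d S) \<rightarrow> {E \<in> graphs V d. nbrs E v = S}"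
  proof
    fix E assume E: "E \<in> graphs (V - {v}) (residual d S)"
    let ?E = "E \<union> (\<lambda>u. {v, u}) ` S"
    have SV: "S \<subseteq> V - {v}" and cS: "card S = d v" and S1: "\<And>u. u \<in> S \<Longrightarrow> d u \<ge> 1"
      using S by (auto simp: star_sets_def)
    have nE: "{v, u} \<notin> E" "{u, v} \<notin> E" for u
      using graphs_edgeD(1)[OF E, of v u] graphs_edgeD(2)[OF E, of u v] by blast+
    have nv: "nbrs ?E v = S"
      using nE SV by (auto simp: nbrs_def doubleton_eq_iff)
    have nw: "nbrs ?E w = (if w \<in> S then insert v (nbrs E w) else nbrs E w)" if "w \<noteq> v" for w
      using that SV by (auto simp: nbrs_def doubleton_eq_iff)
    have "vdeg ?E i = d i" if "i \<in> V" for i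
    proof (cases "i = v")
      case True
      then show ?thesis by (simp add: vdeg_eq_card_nbrs nv cS)
    next
      case False
      have "v \<notin> nbrs E i" using nE by (auto simp: nbrs_def)
      then show ?thesis
        using False that card_nbrs[OF E, of i] finite_nbrs[OF E, of i] fin S1[of i]
        by (auto simp: vdeg_eq_card_nbrs nw residual_def)
    qed
    moreover have "?E \<subseteq> {e. e \<subseteq> V \<and> card e = 2}"
      using E SV v by (auto simp: graphs_def card_insert_if)
    ultimately show "?E \<in> {E \<in> graphs V d. nbrs E v = S}" using nv by (simp add: graphs_def)
  qed
  show "delete_vertex v E \<union> (\<lambda>u. {v, u}) ` S = E" if E: "E \<in> {E \<in> graphs V d. nbrs E v = S}" for E
  proof -
    have "e \<in> (\<lambda>u. {v, u}) ` S" if e: "e \<in> E" "v \<in> e" for e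
    proof -
      have "card e = 2" using e E by (auto simp: graphs_def)
      then obtain u where "e = {v, u}" using e(2) by (auto simp: card_2_iff)
      then show ?thesis using e E by (auto simp: nbrs_def)
    qed
    then show ?thesis using E by (auto simp: delete_vertex_def nbrs_def)
  qed
  show "delete_vertex v (E \<union> (\<lambda>u. {v, u}) ` S) = E" if "E \<in> graphs (V - {v}) (residual d S)" for E
    using that by (auto simp: delete_vertex_def graphs_def)
qed

lemma sum_graphs_by_star:
  assumes "finite V" "v \<in> V"
  shows "(\<Sum>E\<in>graphs V d. h (nbrs E v) (delete_vertex v E))
       = (\<Sum>S\<in>star_sets V d v. \<Sum>E\<in>graphs (V - {v}) (residual d S). h S E)"
proof -
  have "(\<Sum>E\<in>graphs V d. h (nbrs E v) (delete_vertex v E))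
     = (\<Sum>S\<in>star_sets V d v. \<Sum>E | E \<in> graphs V d \<and> nbrs E v = S. h (nbrs E v) (delete_vertex v E))"
    using nbrs_in_star_sets[OF assms]
    by (intro sum.group[symmetric] finite_graphs finite_star_sets assms) auto
  also have "\<dots> = (\<Sum>S\<in>star_sets V d v. \<Sum>E\<in>graphs (V - {v}) (residual d S). h S E)"
  proof (rule sum.cong[OF refl])
    fix S assume S: "S \<in> star_sets V d v"
    show "(\<Sum>E | E \<in> graphs V d \<and> nbrs E v = S. h (nbrs E v) (delete_vertex v E))
        = (\<Sum>E\<in>graphs (V - {v}) (residual d S). h S E)"
      using sum.reindex_bij_betw[OF bij_betw_delete_vertex[OF assms S], of "h S"] by simp
  qed
  finally show ?thesis .
qed

text \<open>The tower property in counting form: \<open>b S\<close> bounds the conditional mean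
  given that the neighbourhood of \<open>v\<close> is \<open>S\<close>, and the conditional law is
  uniform on the residual graphs.\<close>

lemma sum_graphs_by_star_mono:
  fixes h :: "nat set \<Rightarrow> nat set set \<Rightarrow> real" and b :: "nat set \<Rightarrow> real"
  assumes "finite V" "v \<in> V"
    and "\<And>S. S \<in> star_sets V d v \<Longrightarrow>
      (\<Sum>E\<in>graphs (V - {v}) (residual d S). h S E) \<le> card (graphs (V - {v}) (residual d S)) * b S"
  shows "(\<Sum>E\<in>graphs V d. h (nbrs E v) (delete_vertex v E)) \<le> (\<Sum>E\<in>graphs V d. b (nbrs E v))"
  unfolding sum_graphs_by_star[OF assms(1,2)] sum_graphs_by_star[OF assms(1,2), where h = "\<lambda>S E. b S"]
  by (rule sum_mono) (use assms(3) in simp)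

text \<open>Each edge at \<open>v\<close> is lost at both ends. Hence \<open>N\<close> deletions
  cost at most \<open>2 * \<Delta> * N\<close>, the allowance that recurs in the hypotheses of the
  exploration bounds.\<close>

lemma sum_residual:
  assumes "finite V" "v \<in> V" "S \<in> star_sets V d v"
  shows "(\<Sum>u\<in>V - {v}. real (residual d S u)) = (\<Sum>u\<in>V. real (d u)) - 2 * real (d v)"
proof -
  have "(\<Sum>u\<in>V - {v}. real (residual d S u)) = (\<Sum>u\<in>V - {v}. real (d u) - (if u \<in> S then 1 else 0))"
    using assms(3) by (intro sum.cong) (auto simp: residual_def star_sets_def of_nat_diff)
  also have "\<dots> = (\<Sum>u\<in>V - {v}. real (d u)) - (\<Sum>u\<in>V - {v}. if u \<in> S then 1 else 0)"
    by (rule sum_subtractf)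
  also have "(\<Sum>u\<in>V - {v}. if u \<in> S then 1 else 0 :: real) = real (card S)"
  proof -
    have "(V - {v}) \<inter> S = S" using assms(3) by (auto simp: star_sets_def)
    then show ?thesis using assms(1) by (simp add: sum.If_cases)
  qed
  also have "card S = d v" using assms(3) by (simp add: star_sets_def)
  also have "(\<Sum>u\<in>V - {v}. real (d u)) = (\<Sum>u\<in>V. real (d u)) - real (d v)"
    using assms by (simp add: sum_diff1)
  finally show ?thesis by simp
qed

text \<open>\<open>A\<close> is the set of active vertices. A vertex of \<open>F\<close> may be found (and
  weighted) several times, but it is never explored unless it is active at the start.\<close>

fun explore_weight :: "(nat \<Rightarrow> real) \<Rightarrow> nat set \<Rightarrow> nat \<Rightarrow> nat set set \<Rightarrow> nat set \<Rightarrow> real" where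
  "explore_weight \<alpha> F 0 E A = 1"
| "explore_weight \<alpha> F (Suc N) E A =
     (if A = {} then 1 else (\<Prod>u\<in>nbrs E (Min A) - A. \<alpha> u) *
        explore_weight \<alpha> F N (delete_vertex (Min A) E) (A \<union> (nbrs E (Min A) - F) - {Min A}))"

text \<open>A supermartingale in which every edge end at an active vertex is worth a factor
  \<open>y\<close>. An edge leads to u with chance about D u / M, which yields
  \<open>\<alpha> u\<close> and a factor \<open>y\<close> for each of the D u - 1 other edge ends,
  or none if u is in \<open>F\<close> and hence not explored. So \<open>fp\<close> says that
  \<open>y\<close> is a supersolution of the generating function equation for the total progeny of a
  branching process. It is stated for the initial degrees \<open>D\<close>, since degrees only
  decrease. The allowance \<open>2 * \<Delta> * N\<close> keeps switchings available through all
  \<open>N\<close> deletions.\<close>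

lemma explore_weight_bound:
  fixes \<alpha> :: "nat \<Rightarrow> real" and y M :: real and D :: "nat \<Rightarrow> nat"
  assumes y: "y \<ge> 1" and \<alpha>: "\<And>u. \<alpha> u \<ge> 1" and M: "M > 0"
    and fin: "finite V\<^sub>0" and D: "\<And>u. u \<in> V\<^sub>0 \<Longrightarrow> D u \<le> \<Delta>"
    and fp: "1 + (\<Sum>u\<in>V\<^sub>0. D u * (\<alpha> u * (if u \<in> F then 1 else y ^ (D u - 1)) - 1)) / M \<le> y"
    and "V \<subseteq> V\<^sub>0" "A \<subseteq> V" "\<And>u. u \<in> V \<Longrightarrow> d u \<le> D u"
    and "M + (2 * real \<Delta>^2 + 4 * real \<Delta>) + 2 * real \<Delta> * real N \<le> (\<Sum>u\<in>V. real (d u))"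
  shows "(\<Sum>E\<in>graphs V d. explore_weight \<alpha> F N E A) \<le> card (graphs V d) * (\<Prod>u\<in>A. y ^ d u)"
  using assms(7-)
proof (induction N arbitrary: V A d)
  case 0
  have "(\<Prod>u\<in>A. y ^ d u) \<ge> 1" using y by (intro prod_ge_1) simp
  then have "real (card (graphs V d)) * 1 \<le> card (graphs V d) * (\<Prod>u\<in>A. y ^ d u)"
    by (intro mult_left_mono) auto
  then show ?case by simp
next
  case (Suc N)
  show ?case
  proof (cases "A = {}")
    case True
    then show ?thesis by simp
  next
    case False
    define f where "f u = \<alpha> u * (if u \<in> F then 1 else y ^ (D u - 1)) - 1" for u
    define v where "v = Min A"
    have finV: "finite V" using Suc.prems(1) fin finite_subset by blast
    have finA: "finite A" using Suc.prems(2) finV finite_subset by blast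
    have vA: "v \<in> A" unfolding v_def using False finA by simp
    have vV: "v \<in> V" using vA Suc.prems by auto
    have d\<Delta>: "d u \<le> \<Delta>" if "u \<in> V" for u using that Suc.prems(1,3) D by (meson order.trans subsetD)
    have f0: "f u \<ge> 0" for u
    proof -
      have "1 * 1 \<le> \<alpha> u * (if u \<in> F then 1 else y ^ (D u - 1))"
        using y \<alpha>[of u] by (intro mult_mono) auto
      then show ?thesis by (simp add: f_def)
    qed
    define A' where "A' S = A \<union> (S - F) - {v}" for S
    define b where "b S = (\<Prod>u\<in>S - A. \<alpha> u) * (\<Prod>u\<in>A' S. y ^ residual d S u)" for S
    have "(\<Sum>E\<in>graphs V d. explore_weight \<alpha> F (Suc N) E A)
       = (\<Sum>E\<in>graphs V d. (\<lambda>S E'. (\<Prod>u\<in>S - A. \<alpha> u) * explore_weight \<alpha> F N E' (A' S)) (nbrs E v) (delete_vertex v E))"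
      using False by (simp add: v_def A'_def)
    also have "\<dots> \<le> (\<Sum>E\<in>graphs V d. b (nbrs E v))"
    proof (rule sum_graphs_by_star_mono[OF finV vV, where b = b])
      fix S assume S: "S \<in> star_sets V d v"
      have "(\<Sum>E\<in>graphs (V - {v}) (residual d S). explore_weight \<alpha> F N E (A' S))
         \<le> card (graphs (V - {v}) (residual d S)) * (\<Prod>u\<in>A' S. y ^ residual d S u)"
      proof (rule Suc.IH)
        show "A' S \<subseteq> V - {v}" using S Suc.prems(2) by (auto simp: A'_def star_sets_def)
        show "residual d S u \<le> D u" if "u \<in> V - {v}" for u
          using Suc.prems(3)[of u] that by (auto simp: residual_def)
        show "M + (2 * (real \<Delta>)\<^sup>2 + 4 * real \<Delta>) + 2 * real \<Delta> * real N \<le> (\<Sum>u\<in>V - {v}. real (residual d S u))"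
          using sum_residual[OF finV vV S] Suc.prems(4) d\<Delta>[OF vV] by (simp add: algebra_simps)
      qed (use Suc.prems in auto)
      then have "(\<Prod>u\<in>S - A. \<alpha> u) * (\<Sum>E\<in>graphs (V - {v}) (residual d S). explore_weight \<alpha> F N E (A' S))
         \<le> (\<Prod>u\<in>S - A. \<alpha> u) * (card (graphs (V - {v}) (residual d S)) * (\<Prod>u\<in>A' S. y ^ residual d S u))"
        using \<alpha> by (intro mult_left_mono prod_nonneg) (auto intro: order.trans[OF zero_le_one])
      then show "(\<Sum>E\<in>graphs (V - {v}) (residual d S). (\<Prod>u\<in>S - A. \<alpha> u) * explore_weight \<alpha> F N E (A' S))
         \<le> card (graphs (V - {v}) (residual d S)) * b S"
        by (simp add: b_def sum_distrib_left mult.left_commute)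
    qed
    also have "\<dots> \<le> (\<Sum>E\<in>graphs V d. (\<Prod>u\<in>A - {v}. y ^ d u) * (\<Prod>u\<in>nbrs E v \<inter> (V - {v}). 1 + f u))"
    proof (rule sum_mono)
      fix E assume E: "E \<in> graphs V d"
      define S where "S = nbrs E v"
      have S: "S \<subseteq> V - {v}" and finS: "finite S" using nbrs_subset[OF E] finite_nbrs[OF E finV] by (auto simp: S_def)
      have A': "A' S = (A - {v}) \<union> (S - A - F)" using S vA by (auto simp: A'_def)
      have "(\<Prod>u\<in>A' S. y ^ residual d S u) =
         (\<Prod>u\<in>A - {v}. y ^ residual d S u) * (\<Prod>u\<in>S - A - F. y ^ residual d S u)"
        unfolding A' using finA finS by (intro prod.union_disjoint) auto
      \<comment> \<open>An active vertex met again only loses an edge end, which cannot raise the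
        product because \<open>y \<ge> 1\<close>. A new vertex has spent one edge end on the edge to
        \<open>v\<close>.\<close>
      also have "\<dots> \<le> (\<Prod>u\<in>A - {v}. y ^ d u) * (\<Prod>u\<in>S - A - F. y ^ (D u - 1))"
      proof (intro mult_mono prod_mono conjI)
        fix u assume "u \<in> S - A - F"
        then show "y ^ residual d S u \<le> y ^ (D u - 1)"
          using S Suc.prems(3)[of u] y by (intro power_increasing) (auto simp: residual_def)
      next
        fix u assume "u \<in> A - {v}"
        then show "y ^ residual d S u \<le> y ^ d u"
          using y by (intro power_increasing) (auto simp: residual_def)
      qed (use y in \<open>auto intro!: prod_nonneg\<close>)
      finally have 1: "b S \<le> (\<Prod>u\<in>S - A. \<alpha> u) * ((\<Prod>u\<in>A - {v}. y ^ d u) * (\<Prod>u\<in>S - A - F. y ^ (D u - 1)))"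
        unfolding b_def using \<alpha> by (intro mult_left_mono prod_nonneg) (auto intro: order.trans[OF zero_le_one])
      have 2: "(\<Prod>u\<in>S - A - F. y ^ (D u - 1)) = (\<Prod>u\<in>S - A. if u \<in> F then 1 else y ^ (D u - 1))"
        using finS by (intro prod.mono_neutral_cong_left) auto
      have 3: "(\<Prod>u\<in>S - A. \<alpha> u) * (\<Prod>u\<in>S - A - F. y ^ (D u - 1)) = (\<Prod>u\<in>S - A. 1 + f u)"
        unfolding 2 by (simp add: prod.distrib[symmetric] f_def)
      \<comment> \<open>Counting edges into the active set as if they led to new vertices only
        increases the bound, and the star bound can then be applied to all of
        \<open>V - {v}\<close>.\<close>
      have 4: "(\<Prod>u\<in>S - A. 1 + f u) \<le> (\<Prod>u\<in>S. 1 + f u)"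
        using f0 finS by (intro prod_mono2) (auto simp: add_nonneg_nonneg)
      have 5: "nbrs E v \<inter> (V - {v}) = S" using S S_def by auto
      have "b S \<le> (\<Prod>u\<in>A - {v}. y ^ d u) * (\<Prod>u\<in>S - A. 1 + f u)"
        using 1 unfolding 3[symmetric] by (simp add: ac_simps)
      also have "\<dots> \<le> (\<Prod>u\<in>A - {v}. y ^ d u) * (\<Prod>u\<in>S. 1 + f u)"
        using 4 y by (intro mult_left_mono prod_nonneg) auto
      finally show "b (nbrs E v) \<le> (\<Prod>u\<in>A - {v}. y ^ d u) * (\<Prod>u\<in>nbrs E v \<inter> (V - {v}). 1 + f u)"
        unfolding 5 by (simp only: S_def)
    qed
    also have "\<dots> = (\<Prod>u\<in>A - {v}. y ^ d u) * (\<Sum>E | E \<in> graphs V d \<and> {} \<subseteq> nbrs E v. \<Prod>u\<in>nbrs E v \<inter> (V - {v}). 1 + f u)"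
      by (simp add: sum_distrib_left)
    also have "\<dots> \<le> (\<Prod>u\<in>A - {v}. y ^ d u) * (card {E \<in> graphs V d. {} \<subseteq> nbrs E v} *
        (1 + (\<Sum>u\<in>V - {v}. d u * f u) / M) ^ (d v - card ({} :: nat set)))"
    proof (intro mult_left_mono star_weight_bound[where \<Delta>=\<Delta>] finV vV d\<Delta> M f0)
      show "M + (2 * (real \<Delta>)\<^sup>2 + 4 * real \<Delta>) \<le> (\<Sum>i\<in>V. real (d i))"
        using Suc.prems(4) mult_nonneg_nonneg[of "2 * real \<Delta>" "real (Suc N)"] by linarith
    qed (use y in \<open>auto intro!: prod_nonneg\<close>)
    also have "\<dots> \<le> (\<Prod>u\<in>A - {v}. y ^ d u) * (card (graphs V d) * y ^ d v)"
    proof -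
      have "(\<Sum>u\<in>V - {v}. d u * f u) \<le> (\<Sum>u\<in>V - {v}. D u * f u)"
        using Suc.prems(3) f0 by (intro sum_mono mult_right_mono) auto
      also have "\<dots> \<le> (\<Sum>u\<in>V\<^sub>0. D u * f u)"
        using Suc.prems(1) f0 by (intro sum_mono2 fin) auto
      finally have "(\<Sum>u\<in>V - {v}. d u * f u) / M \<le> (\<Sum>u\<in>V\<^sub>0. D u * f u) / M"
        using M by (intro divide_right_mono) auto
      then have "1 + (\<Sum>u\<in>V - {v}. d u * f u) / M \<le> y"
        using fp unfolding f_def by linarith
      moreover have "0 \<le> 1 + (\<Sum>u\<in>V - {v}. d u * f u) / M"
        using M f0 by (intro add_nonneg_nonneg divide_nonneg_pos sum_nonneg) auto
      ultimately show ?thesis using y by (auto intro!: mult_left_mono prod_nonneg power_mono)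
    qed
    also have "\<dots> = card (graphs V d) * (\<Prod>u\<in>A. y ^ d u)"
      using prod.remove[OF finA vA, of "\<lambda>u. y ^ d u"] by simp
    finally show ?thesis .
  qed
qed

section \<open>Exploration and components\<close>

definition reach :: "nat set set \<Rightarrow> nat set \<Rightarrow> nat set" where
  "reach E A = {(x, y). {x, y} \<in> E}\<^sup>* `` A"

lemma reach_empty [simp]: "reach E {} = {}"
  by (simp add: reach_def)

lemma subset_reach: "A \<subseteq> reach E A"
  by (auto simp: reach_def)

lemma reach_edge:
  assumes "w \<in> reach E A" "{w, w'} \<in> E"
  shows "w' \<in> reach E A"
proof -
  obtain a where a: "a \<in> A" "(a, w) \<in> {(x, y). {x, y} \<in> E}\<^sup>*"
    using assms(1) by (auto simp: reach_def)
  have "(w, w') \<in> {(x, y). {x, y} \<in> E}" using assms(2) by simp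
  with a(2) have "(a, w') \<in> {(x, y). {x, y} \<in> E}\<^sup>*" by (rule rtrancl_into_rtrancl)
  then show ?thesis using a(1) by (auto simp: reach_def)
qed

lemma reach_least:
  assumes "A \<subseteq> B" and "\<And>w w'. w \<in> B \<Longrightarrow> {w, w'} \<in> E \<Longrightarrow> w' \<in> B"
  shows "reach E A \<subseteq> B"
proof
  fix w assume "w \<in> reach E A"
  then obtain a where "a \<in> A" "(a, w) \<in> {(x, y). {x, y} \<in> E}\<^sup>*" by (auto simp: reach_def)
  from this(2,1) show "w \<in> B"
    by (induction rule: rtrancl_induct) (use assms in auto)
qed

lemma nbrs_subset_reach: "v \<in> A \<Longrightarrow> nbrs E v \<subseteq> reach E A"
  using reach_edge[of v E A] subset_reach by (auto simp: nbrs_def)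

lemma reach_subset:
  assumes "E \<subseteq> {e. e \<subseteq> V \<and> card e = 2}" "A \<subseteq> V"
  shows "reach E A \<subseteq> V"
  using assms by (intro reach_least) auto

text \<open>A walk that leaves \<open>v\<close> continues at a neighbour of \<open>v\<close>, and
  all these neighbours become active. So each exploration step accounts for exactly one vertex of
  the component.\<close>

lemma reach_step:
  assumes E: "E \<subseteq> {e. e \<subseteq> V \<and> card e = 2}" and v: "v \<in> A"
  shows "reach E A = insert v (reach (delete_vertex v E) (A \<union> nbrs E v - {v}))"
    and "v \<notin> reach (delete_vertex v E) (A \<union> nbrs E v - {v})"
proof -
  let ?A = "A \<union> nbrs E v - {v}"
  let ?R = "reach (delete_vertex v E) ?A"
  have "reach E A \<subseteq> insert v ?R"
  proof (rule reach_least)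
    show "A \<subseteq> insert v ?R" using subset_reach[of ?A] by blast
    fix w w' assume w: "w \<in> insert v ?R" and e: "{w, w'} \<in> E"
    show "w' \<in> insert v ?R"
    proof (cases "w = v \<or> w' = v")
      case True
      then show ?thesis using e subset_reach[of ?A "delete_vertex v E"] by (auto simp: nbrs_def)
    next
      case False
      then have "{w, w'} \<in> delete_vertex v E" using e by (simp add: delete_vertex_def)
      then show ?thesis using w False reach_edge by blast
    qed
  qed
  moreover have "?R \<subseteq> reach E A"
  proof (rule reach_least)
    show "?A \<subseteq> reach E A" using nbrs_subset_reach[OF v] subset_reach by blast
    show "w' \<in> reach E A" if "w \<in> reach E A" "{w, w'} \<in> delete_vertex v E" for w w'
      using that by (auto simp: delete_vertex_def intro: reach_edge)
  qed
  ultimately show "reach E A = insert v ?R" using v subset_reach by blast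
  have "?R \<subseteq> - {v}"
    by (rule reach_least) (auto simp: delete_vertex_def)
  then show "v \<notin> ?R" by blast
qed

section \<open>Component sizes read off the exploration weights\<close>

lemma explore_weight_ge_1:
  assumes "\<And>u. \<alpha> u \<ge> 1"
  shows "explore_weight \<alpha> F N E A \<ge> 1"
proof (induction N arbitrary: E A)
  case (Suc N)
  have "1 * 1 \<le> (\<Prod>u\<in>nbrs E (Min A) - A. \<alpha> u) *
      explore_weight \<alpha> F N (delete_vertex (Min A) E) (A \<union> (nbrs E (Min A) - F) - {Min A})"
    using prod_ge_1[of "nbrs E (Min A) - A" \<alpha>] assms by (intro mult_mono Suc.IH) auto
  then show ?case by simp
qed simp

text \<open>Every vertex found lies in the component and therefore outside \<open>F\<close>, so no
  factor differs from 1. This disposes of starts whose component contains no big vertex.\<close>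

lemma explore_weight_eq_1:
  assumes "finite V" "E \<subseteq> {e. e \<subseteq> V \<and> card e = 2}" "A \<subseteq> V" "reach E A \<inter> F = {}"
    and "\<And>u. u \<notin> F \<Longrightarrow> \<alpha> u = 1"
  shows "explore_weight \<alpha> F N E A = 1"
  using assms(2-4)
proof (induction N arbitrary: E A)
  case (Suc N)
  show ?case
  proof (cases "A = {}")
    case False
    define v where "v = Min A"
    have "finite A" using Suc.prems(2) assms(1) finite_subset by blast
    then have v: "v \<in> A" using False by (simp add: v_def)
    have SF: "nbrs E v \<inter> F = {}" using Suc.prems(3) nbrs_subset_reach[OF v, of E] by blast
    then have eq: "A \<union> (nbrs E v - F) - {v} = A \<union> nbrs E v - {v}" by blast
    have "explore_weight \<alpha> F N (delete_vertex v E) (A \<union> nbrs E v - {v}) = 1"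
    proof (rule Suc.IH)
      show "delete_vertex v E \<subseteq> {e. e \<subseteq> V \<and> card e = 2}" using Suc.prems by (auto simp: delete_vertex_def)
      show "A \<union> nbrs E v - {v} \<subseteq> V"
        using Suc.prems reach_subset[OF Suc.prems(1,2)] nbrs_subset_reach[OF v, of E] by blast
      show "reach (delete_vertex v E) (A \<union> nbrs E v - {v}) \<inter> F = {}"
        using reach_step[OF Suc.prems(1) v] Suc.prems(3) by blast
    qed
    moreover have "(\<Prod>u\<in>nbrs E v - A. \<alpha> u) = 1" using SF assms(5) by (intro prod.neutral) blast
    ultimately show ?thesis using eq by (simp add: v_def[symmetric] False)
  qed simp
qed simp

text \<open>The bound \<open>< 2\<close> encodes that no vertex of \<open>F\<close> is hit: all
  factors are 1 or 2, so a single hit makes the product at least 2. Without a hit nothing is left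
  out, so the exploration runs for \<open>N\<close> steps or exhausts the component; each explored
  vertex that was not active at the start has been found and has contributed
  \<open>exp s\<close>.\<close>

lemma explore_weight_lower:
  assumes "finite V" "E \<subseteq> {e. e \<subseteq> V \<and> card e = 2}" "A \<subseteq> V" and s: "s \<ge> 0"
    and "explore_weight (\<lambda>u. if u \<in> F then 2 else 1) F N E A < 2"
  shows "explore_weight (\<lambda>u. if u \<in> F then 1 else exp s) F N E A
       \<ge> exp (s * (min (real N) (card (reach E A)) - real (card A)))"
  using assms(2,3,5)
proof (induction N arbitrary: E A)
  case 0
  have "s * (min (real 0) (card (reach E A)) - real (card A)) \<le> 0"
    using s by (intro mult_nonneg_nonpos) auto
  then show ?case by simp
next
  case (Suc N)
  show ?case
  proof (cases "A = {}")
    case True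
    then show ?thesis by simp
  next
    case False
    define v where "v = Min A"
    define S where "S = nbrs E v"
    define A' where "A' = A \<union> S - {v}"
    let ?w2 = "\<lambda>A'. explore_weight (\<lambda>u. if u \<in> F then 2 else 1) F N (delete_vertex v E) A'"
    have finA: "finite A" using Suc.prems(2) assms(1) finite_subset by blast
    then have v: "v \<in> A" using False by (simp add: v_def)
    have SV: "S \<subseteq> V" unfolding S_def
      using reach_subset[OF Suc.prems(1,2)] nbrs_subset_reach[OF v, of E] by blast
    have finS: "finite S" using SV assms(1) finite_subset by blast
    have lt: "(\<Prod>u\<in>S - A. if u \<in> F then 2 else 1) * ?w2 (A \<union> (S - F) - {v}) < 2"
      using Suc.prems(3) False by (simp add: S_def v_def)
    have w1: "?w2 X \<ge> 1" for X by (rule explore_weight_ge_1) auto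
    have p1: "(\<Prod>u\<in>S - A. if u \<in> F then 2 else 1 :: real) \<ge> 1" by (intro prod_ge_1) auto
    have "(\<Prod>u\<in>S - A. if u \<in> F then 2 else 1 :: real) < 2"
      using mult_left_mono[OF w1[of "A \<union> (S - F) - {v}"] order.trans[OF zero_le_one p1]] lt by linarith
    have SF: "(S - A) \<inter> F = {}"
    proof (rule ccontr)
      assume "(S - A) \<inter> F \<noteq> {}"
      then obtain w where w: "w \<in> S - A" "w \<in> F" by blast
      have "(\<Prod>u\<in>{w}. if u \<in> F then 2 else 1 :: real) \<le> (\<Prod>u\<in>S - A. if u \<in> F then 2 else 1 :: real)"
        using w finS by (intro prod_mono2) auto
      then show False using w \<open>(\<Prod>u\<in>S - A. if u \<in> F then 2 else 1 :: real) < 2\<close> by simp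
    qed
    then have eq: "A \<union> (S - F) - {v} = A'" by (auto simp: A'_def)
    have "?w2 A' < 2"
      using lt mult_right_mono[OF p1, of "?w2 A'"] w1[of A'] unfolding eq by linarith
    have E': "delete_vertex v E \<subseteq> {e. e \<subseteq> V \<and> card e = 2}" using Suc.prems by (auto simp: delete_vertex_def)
    have A'V: "A' \<subseteq> V" using Suc.prems(2) SV by (auto simp: A'_def)
    have finA': "finite A'" using A'V assms(1) finite_subset by blast
    have IH: "exp (s * (min (real N) (card (reach (delete_vertex v E) A')) - real (card A')))
      \<le> explore_weight (\<lambda>u. if u \<in> F then 1 else exp s) F N (delete_vertex v E) A'"
      using E' A'V \<open>?w2 A' < 2\<close> by (rule Suc.IH)
    have "finite (reach (delete_vertex v E) A')"
      using reach_subset[OF E' A'V] assms(1) finite_subset by blast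
    then have cr: "card (reach E A) = Suc (card (reach (delete_vertex v E) A'))"
      using reach_step[OF Suc.prems(1) v] by (simp add: A'_def S_def)
    have "{v, v} \<notin> E" using Suc.prems(1) by auto
    then have "v \<notin> S" by (simp add: S_def nbrs_def)
    then have "A' = (A - {v}) \<union> (S - A)" by (auto simp: A'_def)
    then have "card A' = card (A - {v}) + card (S - A)"
      using finA finS by (subst card_Un_disjoint[symmetric]) auto
    moreover have "card A = Suc (card (A - {v}))" by (rule card.remove[OF finA v])
    ultimately have ca: "real (card A') = real (card A) - 1 + card (S - A)" by simp
    have pr: "(\<Prod>u\<in>S - A. if u \<in> F then 1 else exp s) = exp (s * card (S - A))"
    proof -
      have "(\<Prod>u\<in>S - A. if u \<in> F then 1 else exp s) = (\<Prod>u\<in>S - A. exp s)"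
        using SF by (intro prod.cong) auto
      then show ?thesis by (simp add: exp_of_nat_mult[symmetric] mult.commute)
    qed
    have "min (real (Suc N)) (card (reach E A)) = min (real N) (card (reach (delete_vertex v E) A')) + 1"
      by (simp add: cr min_def)
    then have "s * (min (real (Suc N)) (card (reach E A)) - real (card A)) =
      s * card (S - A) + s * (min (real N) (card (reach (delete_vertex v E) A')) - real (card A'))"
      by (simp only: ca) (simp add: algebra_simps)
    then have "exp (s * (min (real (Suc N)) (card (reach E A)) - real (card A)))
       = exp (s * card (S - A)) * exp (s * (min (real N) (card (reach (delete_vertex v E) A')) - real (card A')))"
      by (simp only: exp_add)
    also have "\<dots> \<le> (\<Prod>u\<in>S - A. if u \<in> F then 1 else exp s) *
        explore_weight (\<lambda>u. if u \<in> F then 1 else exp s) F N (delete_vertex v E) A'"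
      unfolding pr using IH by (intro mult_left_mono) auto
    also have "\<dots> = explore_weight (\<lambda>u. if u \<in> F then 1 else exp s) F (Suc N) E A"
      using False eq by (simp add: S_def v_def)
    finally show ?thesis .
  qed
qed

section \<open>The submartingale for the lower bound\<close>

text \<open>The exploration stops once more than \<open>m\<close> vertices are active, since otherwise edges between
  active vertices could be frequent.\<close>

fun explore_potential :: "(nat \<Rightarrow> real) \<Rightarrow> nat \<Rightarrow> nat \<Rightarrow> nat set set \<Rightarrow> nat set \<Rightarrow> real" where
  "explore_potential \<psi> m 0 E A = (\<Sum>u\<in>A. \<psi> (vdeg E u))"
| "explore_potential \<psi> m (Suc N) E A =
     (if A = {} \<or> card A > m then (\<Sum>u\<in>A. \<psi> (vdeg E u))
      else 1 + explore_potential \<psi> m N (delete_vertex (Min A) E) (A \<union> nbrs E (Min A) - {Min A}))"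

text \<open>Active vertices always belong to the component, so neither the step limit nor the cap
  \<open>m\<close> interrupts the exploration. It ends with no active vertices, and the potential
  has turned into a pure count.\<close>

lemma explore_potential_eq_card_reach:
  assumes "finite V" "E \<subseteq> {e. e \<subseteq> V \<and> card e = 2}" "A \<subseteq> V"
    and "card (reach E A) \<le> N" "card (reach E A) \<le> m"
  shows "explore_potential \<psi> m N E A = card (reach E A)"
  using assms(2-)
proof (induction N arbitrary: E A)
  case 0
  have "finite (reach E A)" using reach_subset[OF 0(1,2)] assms(1) finite_subset by blast
  then have "reach E A = {}" using 0 by simp
  then have "A = {}" using subset_reach by blast
  then show ?case by simp
next
  case (Suc N)
  have finR: "finite (reach E A)" using reach_subset[OF Suc.prems(1,2)] assms(1) finite_subset by blast
  have cA: "card A \<le> m" using card_mono[OF finR subset_reach] Suc.prems(4) by simp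
  show ?case
  proof (cases "A = {}")
    case True
    then show ?thesis by simp
  next
    case False
    define v where "v = Min A"
    define A' where "A' = A \<union> nbrs E v - {v}"
    have "finite A" using Suc.prems(2) assms(1) finite_subset by blast
    then have v: "v \<in> A" using False by (simp add: v_def)
    have E': "delete_vertex v E \<subseteq> {e. e \<subseteq> V \<and> card e = 2}" using Suc.prems by (auto simp: delete_vertex_def)
    have A'V: "A' \<subseteq> V"
      using Suc.prems(2) reach_subset[OF Suc.prems(1,2)] nbrs_subset_reach[OF v, of E] by (auto simp: A'_def)
    have "finite (reach (delete_vertex v E) A')"
      using reach_subset[OF E' A'V] assms(1) finite_subset by blast
    then have cr: "card (reach E A) = Suc (card (reach (delete_vertex v E) A'))"
      using reach_step[OF Suc.prems(1) v] by (simp add: A'_def)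
    have "explore_potential \<psi> m N (delete_vertex v E) A' = card (reach (delete_vertex v E) A')"
      using E' A'V Suc.prems(3,4) cr by (intro Suc.IH) auto
    then show ?thesis using False cA cr by (simp add: A'_def v_def)
  qed
qed

text \<open>A crude bound, used on exceptional graphs only. The extra \<open>\<Delta>\<close> is the
  overshoot: the last step before the cap takes effect can add that many active vertices.\<close>

lemma explore_potential_le:
  assumes "finite V" "E \<subseteq> {e. e \<subseteq> V \<and> card e = 2}" "A \<subseteq> V"
    and "card A \<le> m + \<Delta>" and "\<And>w. card (nbrs E w) \<le> \<Delta>" and \<psi>: "\<And>k. \<psi> k \<le> P" and P: "P \<ge> 0"
  shows "explore_potential \<psi> m N E A \<le> real N + real (m + \<Delta>) * P"
proof -
  have base: "(\<Sum>u\<in>A. \<psi> (vdeg E u)) \<le> real (m + \<Delta>) * P" if "card A \<le> m + \<Delta>" for E A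
  proof -
    have "(\<Sum>u\<in>A. \<psi> (vdeg E u)) \<le> (\<Sum>u\<in>A. P)" using \<psi> by (rule sum_mono)
    also have "\<dots> \<le> real (m + \<Delta>) * P" using that P by (simp add: mult_right_mono flip: of_nat_add)
    finally show ?thesis .
  qed
  show ?thesis
    using assms(2-5)
  proof (induction N arbitrary: E A)
    case 0
    then show ?case using base[of A E] by simp
  next
    case (Suc N)
    show ?case
    proof (cases "A = {} \<or> card A > m")
      case True
      then have "explore_potential \<psi> m (Suc N) E A = (\<Sum>u\<in>A. \<psi> (vdeg E u))" by simp
      then show ?thesis using base[OF Suc.prems(3), of E] by linarith
    next
      case False
      define v where "v = Min A"
      define A' where "A' = A \<union> nbrs E v - {v}"
      have "finite A" using Suc.prems(2) assms(1) finite_subset by blast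
      then have v: "v \<in> A" using False by (simp add: v_def)
      have E': "delete_vertex v E \<subseteq> {e. e \<subseteq> V \<and> card e = 2}" using Suc.prems by (auto simp: delete_vertex_def)
      have A'V: "A' \<subseteq> V"
        using Suc.prems(2) reach_subset[OF Suc.prems(1,2)] nbrs_subset_reach[OF v, of E] by (auto simp: A'_def)
      have SV: "nbrs E w \<subseteq> V" for w
        using Suc.prems(1) by (auto simp: nbrs_def)
      have "card A' \<le> card (A \<union> nbrs E v)"
        unfolding A'_def using \<open>finite A\<close> SV assms(1) by (intro card_mono) (auto intro: finite_subset)
      also have "\<dots> \<le> m + \<Delta>" using card_Un_le[of A "nbrs E v"] False Suc.prems(4)[of v] by linarith
      finally have "explore_potential \<psi> m N (delete_vertex v E) A' \<le> real N + real (m + \<Delta>) * P"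
      proof (intro Suc.IH E' A'V)
        fix w
        have "card (nbrs (delete_vertex v E) w) \<le> card (nbrs E w)"
          using SV assms(1) by (intro card_mono) (auto simp: nbrs_delete_vertex intro: finite_subset)
        then show "card (nbrs (delete_vertex v E) w) \<le> \<Delta>" using Suc.prems(4)[of w] by simp
      qed
      then show ?thesis using False by (simp add: A'_def v_def)
    qed
  qed
qed

text \<open>The probabilities of the edges from \<open>v\<close> sum to \<open>d v\<close> exactly, so the upper bound on each of them
  also yields a lower bound on the expectation of a bounded weight \<open>\<psi>\<close>.\<close>

lemma star_gain:
  fixes V :: "nat set" and d :: "nat \<Rightarrow> nat" and \<psi> :: "nat \<Rightarrow> real"
    and M P W Q \<zeta> c g :: real
  assumes fin: "finite V" and v: "v \<in> A" and A: "A \<subseteq> V" and bound: "\<And>i. i \<in> V \<Longrightarrow> d i \<le> \<Delta>"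
    and M: "M > 0" "M + (2 * real \<Delta>^2 + 4 * real \<Delta>) \<le> (\<Sum>i\<in>V. real (d i))"
    and \<psi>: "\<And>k. \<psi> k \<le> P" "P \<ge> 0" and c: "c \<ge> 0"
    and W: "(\<Sum>u\<in>V - A. real (d u)) \<le> W" and Q: "Q \<le> (\<Sum>u\<in>V - A. d u * \<psi> (d u - 1))"
    and \<zeta>: "real (card A) * \<Delta> \<le> \<zeta> * M"
    and g: "g \<le> (1 - \<zeta> - W / M) * P + Q / M - c * \<zeta>"
  shows "card (graphs V d) * (g * d v)
    \<le> (\<Sum>E\<in>graphs V d. (\<Sum>u\<in>nbrs E v - A. \<psi> (d u - 1)) - c * card (nbrs E v \<inter> A))"
proof -
  let ?G = "graphs V d"
  define n where "n = real (card ?G)"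
  define p where "p u = real (card {E \<in> ?G. u \<in> nbrs E v})" for u
  have fing: "finite ?G" using finite_graphs[OF fin] .
  have vV: "v \<in> V" using v A by auto
  have p_le: "p u \<le> n * (d v * (d u / M))" if "u \<in> V" for u
  proof (cases "u = v")
    case True
    have "{E \<in> ?G. u \<in> nbrs E v} = {}" using nbrs_subset[of _ V d v] True by auto
    then have "p u = 0" by (simp only: p_def card.empty of_nat_0)
    then show ?thesis using M by (simp add: n_def)
  next
    case False
    have "p u * M \<le> p u * real ((\<Sum>i\<in>V. d i) - (2 * \<Delta>^2 + 4 * \<Delta>))"
      unfolding p_def using M(2) by (intro mult_left_mono order.trans[OF _ of_nat_diff_ge]) auto
    also have "\<dots> \<le> n * (real (d v) * d u)"
      using switching[OF fin vV that False, of "{}" d \<Delta>] bound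
      unfolding p_def n_def of_nat_mult[symmetric] of_nat_le_iff by simp
    finally show ?thesis using M(1) by (simp add: field_simps)
  qed
  have exch: "(\<Sum>E\<in>?G. \<Sum>u\<in>nbrs E v \<inter> X. h u) = (\<Sum>u\<in>X. h u * p u)" if "finite X" for X and h :: "nat \<Rightarrow> real"
  proof -
    have "(\<Sum>E\<in>?G. \<Sum>u\<in>nbrs E v \<inter> X. h u) = (\<Sum>E\<in>?G. \<Sum>u\<in>X. if u \<in> nbrs E v then h u else 0)"
      using that by (simp add: Int_commute[of _ X] sum.inter_restrict)
    also have "\<dots> = (\<Sum>u\<in>X. \<Sum>E\<in>?G. if u \<in> nbrs E v then h u else 0)" by (rule sum.swap)
    also have "\<dots> = (\<Sum>u\<in>X. h u * p u)"
      using fing by (simp add: sum.If_cases p_def Int_def mult.commute)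
    finally show ?thesis .
  qed
  have finVA: "finite (V - A)" and finA: "finite A" using fin A finite_subset by auto
  have nVA: "nbrs E v - A = nbrs E v \<inter> (V - A)" if "E \<in> ?G" for E using nbrs_subset[OF that] by auto
  have tot: "(\<Sum>u\<in>V. p u) = n * d v"
  proof -
    have "(\<Sum>u\<in>V. p u) = (\<Sum>E\<in>?G. \<Sum>u\<in>nbrs E v \<inter> V. 1)" using exch[OF fin, of "\<lambda>_. 1"] by simp
    also have "\<dots> = (\<Sum>E\<in>?G. real (d v))"
    proof (intro sum.cong refl)
      fix E assume E: "E \<in> ?G"
      have "nbrs E v \<inter> V = nbrs E v" using nbrs_subset[OF E] by auto
      then show "(\<Sum>u\<in>nbrs E v \<inter> V. 1) = real (d v)" using card_nbrs[OF E vV] by simp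
    qed
    finally show ?thesis by (simp add: n_def)
  qed
  have nonneg: "n \<ge> 0" "real (d v) \<ge> 0" by (auto simp: n_def)
  have pA: "(\<Sum>u\<in>A. p u) \<le> n * d v * \<zeta>"
  proof -
    have "(\<Sum>u\<in>A. p u) \<le> (\<Sum>u\<in>A. n * (d v * (\<Delta> / M)))"
      using A bound M(1) nonneg
      by (intro sum_mono order.trans[OF p_le] mult_left_mono divide_right_mono) auto
    also have "\<dots> = n * d v * (card A * \<Delta> / M)" by simp
    also have "\<dots> \<le> n * d v * \<zeta>"
      using \<zeta> M(1) nonneg by (intro mult_left_mono) (auto simp: field_simps)
    finally show ?thesis .
  qed
  have pVA: "(\<Sum>u\<in>V - A. p u) \<ge> n * d v * (1 - \<zeta>)"
    using tot pA sum.subset_diff[OF A fin, of p] by (simp add: algebra_simps)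
  \<comment> \<open>Write \<open>\<psi>\<close> as P - (P - \<open>\<psi>\<close>). The first part
    needs only a lower bound on the sum of all \<open>p u\<close>; in the second the deficit is
    nonnegative, so the upper bounds on the single \<open>p u\<close> can be inserted.\<close>
  have main: "(\<Sum>u\<in>V - A. \<psi> (d u - 1) * p u) \<ge> n * d v * ((1 - \<zeta> - W / M) * P + Q / M)"
  proof -
    have "(\<Sum>u\<in>V - A. (P - \<psi> (d u - 1)) * p u) \<le> (\<Sum>u\<in>V - A. (P - \<psi> (d u - 1)) * (n * (d v * (d u / M))))"
      using \<psi>(1) by (intro sum_mono mult_left_mono p_le) auto
    also have "\<dots> = n * d v / M * (P * (\<Sum>u\<in>V - A. real (d u)) - (\<Sum>u\<in>V - A. d u * \<psi> (d u - 1)))"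
      by (simp add: sum_distrib_left sum_subtractf[symmetric] algebra_simps diff_divide_distrib)
    also have "\<dots> \<le> n * d v / M * (P * W - Q)"
      using W Q \<psi>(2) M(1) nonneg by (intro mult_left_mono diff_mono) auto
    finally have 1: "(\<Sum>u\<in>V - A. (P - \<psi> (d u - 1)) * p u) \<le> n * d v / M * (P * W - Q)" .
    have 2: "P * (\<Sum>u\<in>V - A. p u) \<ge> P * (n * d v * (1 - \<zeta>))"
      using pVA \<psi>(2) by (intro mult_left_mono) auto
    have 3: "(\<Sum>u\<in>V - A. \<psi> (d u - 1) * p u) = P * (\<Sum>u\<in>V - A. p u) - (\<Sum>u\<in>V - A. (P - \<psi> (d u - 1)) * p u)"
      by (simp add: sum_distrib_left sum_subtractf[symmetric] algebra_simps)
    have "n * d v * ((1 - \<zeta> - W / M) * P + Q / M) = P * (n * d v * (1 - \<zeta>)) - n * d v / M * (P * W - Q)"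
      using M(1) by (simp add: field_simps)
    also have "\<dots> \<le> P * (\<Sum>u\<in>V - A. p u) - (\<Sum>u\<in>V - A. (P - \<psi> (d u - 1)) * p u)"
      using 2 1 by (rule diff_mono)
    finally show ?thesis unfolding 3 .
  qed
  have "card ?G * (g * d v) = n * d v * g" by (simp add: n_def)
  also have "\<dots> \<le> n * d v * ((1 - \<zeta> - W / M) * P + Q / M - c * \<zeta>)"
    using g nonneg by (intro mult_left_mono) auto
  also have "\<dots> = n * d v * ((1 - \<zeta> - W / M) * P + Q / M) - c * (n * d v * \<zeta>)"
    by (simp add: algebra_simps)
  also have "\<dots> \<le> (\<Sum>u\<in>V - A. \<psi> (d u - 1) * p u) - c * (\<Sum>u\<in>A. p u)"
    using main pA c by (intro diff_mono mult_left_mono) auto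
  also have "\<dots> = (\<Sum>E\<in>?G. (\<Sum>u\<in>nbrs E v - A. \<psi> (d u - 1)) - c * card (nbrs E v \<inter> A))"
    using exch[OF finVA, of "\<lambda>u. \<psi> (d u - 1)"] exch[OF finA, of "\<lambda>_. 1"] nVA
    by (simp add: sum_subtractf sum_distrib_left[symmetric])
  finally show ?thesis .
qed

text \<open>The second conjunct keeps the degree of the first explored vertex untruncated. It is applied to
  the vertex of maximal degree.\<close>

lemma explore_potential_bound:
  fixes D d :: "nat \<Rightarrow> nat" and M P c \<zeta> :: real and \<psi> :: "nat \<Rightarrow> real"
  assumes fin: "finite V\<^sub>0" and D: "\<And>u. u \<in> V\<^sub>0 \<Longrightarrow> D u \<le> \<Delta>" and M: "M > 0"
    and \<psi>: "\<And>k. 0 \<le> \<psi> k" "\<And>k. \<psi> k \<le> P" "\<And>k. \<psi> k \<le> \<psi> (k - 1) + c" "\<And>k. \<psi> k \<le> 1 + c * k"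
    and c: "c \<ge> 0" and \<zeta>: "real m * \<Delta> \<le> \<zeta> * M"
    and cc: "c \<le> (1 - \<zeta> - (\<Sum>u\<in>V\<^sub>0. real (D u)) / M) * P
        + ((\<Sum>u\<in>V\<^sub>0. D u * \<psi> (D u - 1)) - real (n + m) * \<Delta> * P) / M - c * \<zeta>"
    and "V \<subseteq> V\<^sub>0" "A \<subseteq> V" "\<And>u. u \<in> V \<Longrightarrow> d u \<le> \<Delta>" "\<And>u. u \<in> V - A \<Longrightarrow> d u = D u"
    and "card (V\<^sub>0 - V) + N \<le> n"
    and "M + (2 * real \<Delta>^2 + 4 * real \<Delta>) + 2 * real \<Delta> * real N \<le> (\<Sum>u\<in>V. real (d u))"
  shows "card (graphs V d) * (\<Sum>u\<in>A. \<psi> (d u)) \<le> (\<Sum>E\<in>graphs V d. explore_potential \<psi> m N E A) \<and>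
    (N > 0 \<and> A \<noteq> {} \<and> card A \<le> m \<longrightarrow>
      card (graphs V d) * (1 + (\<Sum>u\<in>A - {Min A}. \<psi> (d u)) + c * d (Min A))
       \<le> (\<Sum>E\<in>graphs V d. explore_potential \<psi> m N E A))"
  using assms(11-)
proof (induction N arbitrary: V A d)
  case 0
  have "(\<Sum>E\<in>graphs V d. explore_potential \<psi> m 0 E A) = (\<Sum>E\<in>graphs V d. \<Sum>u\<in>A. \<psi> (d u))"
    using 0(2) by (intro sum.cong refl) (auto simp: graphs_def subset_iff intro!: sum.cong)
  then show ?case by simp
next
  case (Suc N)
  have finV: "finite V" using Suc.prems(1) fin finite_subset by blast
  have finA: "finite A" using Suc.prems(2) finV finite_subset by blast
  show ?case
  proof (cases "A = {} \<or> card A > m")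
    case True
    have "(\<Sum>E\<in>graphs V d. explore_potential \<psi> m (Suc N) E A) = (\<Sum>E\<in>graphs V d. \<Sum>u\<in>A. \<psi> (d u))"
      using Suc.prems(2) True by (intro sum.cong refl) (auto simp: graphs_def subset_iff intro!: sum.cong)
    then show ?thesis using True by auto
  next
    case False
    define v where "v = Min A"
    have vA: "v \<in> A" unfolding v_def using False finA by simp
    have vV: "v \<in> V" using vA Suc.prems by auto
    define A' where "A' S = A \<union> S - {v}" for S
    define b where "b S = 1 + (\<Sum>u\<in>A' S. \<psi> (residual d S u))" for S
    \<comment> \<open>The tower inequality bounds from above; negating both sides turns it into the
      lower bound wanted here.\<close>
    have "(\<Sum>E\<in>graphs V d. - b (nbrs E v)) \<ge>
      (\<Sum>E\<in>graphs V d. (\<lambda>S E'. - (1 + explore_potential \<psi> m N E' (A' S))) (nbrs E v) (delete_vertex v E))"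
    proof (rule sum_graphs_by_star_mono[OF finV vV])
      fix S assume S: "S \<in> star_sets V d v"
      let ?G = "graphs (V - {v}) (residual d S)"
      have "card ?G * (\<Sum>u\<in>A' S. \<psi> (residual d S u)) \<le> (\<Sum>E\<in>?G. explore_potential \<psi> m N E (A' S))"
      proof (rule conjunct1[OF Suc.IH])
        show "V - {v} \<subseteq> V\<^sub>0" using Suc.prems(1) by auto
        show "A' S \<subseteq> V - {v}" using S Suc.prems(2) by (auto simp: A'_def star_sets_def)
        show "residual d S u \<le> \<Delta>" if "u \<in> V - {v}" for u
          using Suc.prems(3)[of u] that by (auto simp: residual_def)
        show "residual d S u = D u" if "u \<in> V - {v} - A' S" for u
          using that Suc.prems(4)[of u] by (auto simp: residual_def A'_def)
        have "card (V\<^sub>0 - (V - {v})) = card (insert v (V\<^sub>0 - V))"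
          using vV Suc.prems(1) by (intro arg_cong[of _ _ card]) auto
        also have "\<dots> = Suc (card (V\<^sub>0 - V))" using vV fin by simp
        finally show "card (V\<^sub>0 - (V - {v})) + N \<le> n" using Suc.prems(5) by simp
        show "M + (2 * (real \<Delta>)\<^sup>2 + 4 * real \<Delta>) + 2 * real \<Delta> * real N \<le> (\<Sum>u\<in>V - {v}. real (residual d S u))"
          using sum_residual[OF finV vV S] Suc.prems(6) Suc.prems(3)[OF vV] by (simp add: algebra_simps)
      qed
      then show "(\<Sum>E\<in>?G. - (1 + explore_potential \<psi> m N E (A' S))) \<le> card ?G * - b S"
        unfolding b_def by (simp add: sum_negf sum.distrib sum_subtractf algebra_simps)
    qed
    then have "(\<Sum>E\<in>graphs V d. b (nbrs E v)) \<le>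
      (\<Sum>E\<in>graphs V d. 1 + explore_potential \<psi> m N (delete_vertex v E) (A' (nbrs E v)))"
      by (simp only: sum_negf neg_le_iff_le)
    then have step: "(\<Sum>E\<in>graphs V d. b (nbrs E v)) \<le> (\<Sum>E\<in>graphs V d. explore_potential \<psi> m (Suc N) E A)"
      using False by (simp add: v_def A'_def)
    have gain: "card (graphs V d) * (c * d v)
      \<le> (\<Sum>E\<in>graphs V d. (\<Sum>u\<in>nbrs E v - A. \<psi> (d u - 1)) - c * card (nbrs E v \<inter> A))"
    proof (rule star_gain[OF finV vA Suc.prems(2,3) M _ \<psi>(2) _ c])
      show "M + (2 * (real \<Delta>)\<^sup>2 + 4 * real \<Delta>) \<le> (\<Sum>i\<in>V. real (d i))"
        using Suc.prems(6) mult_nonneg_nonneg[of "2 * real \<Delta>" "real (Suc N)"] by linarith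
      show "P \<ge> 0" using \<psi>(1,2) order.trans by blast
      have VA: "V - A \<subseteq> V\<^sub>0" using Suc.prems(1) by auto
      have "(\<Sum>u\<in>V - A. real (d u)) = (\<Sum>u\<in>V - A. real (D u))" using Suc.prems(4) by simp
      also have "\<dots> \<le> (\<Sum>u\<in>V\<^sub>0. real (D u))" using VA fin by (intro sum_mono2) auto
      finally show "(\<Sum>u\<in>V - A. real (d u)) \<le> (\<Sum>u\<in>V\<^sub>0. real (D u))" .
      show "real (card A) * \<Delta> \<le> \<zeta> * M"
        using False \<zeta> by (intro order.trans[OF mult_right_mono \<zeta>]) auto
      show "c \<le> (1 - \<zeta> - (\<Sum>u\<in>V\<^sub>0. real (D u)) / M) * P
        + ((\<Sum>u\<in>V\<^sub>0. D u * \<psi> (D u - 1)) - real (n + m) * \<Delta> * P) / M - c * \<zeta>" by (rule cc)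
      \<comment> \<open>Vertices missing from \<open>V - A\<close> are deleted (at most
        \<open>n\<close>) or active (at most \<open>m\<close>), each worth at most
        \<open>\<Delta> * P\<close>. This is the correction subtracted in hypothesis
        \<open>cc\<close>.\<close>
      have "(\<Sum>u\<in>V\<^sub>0 - (V - A). D u * \<psi> (D u - 1)) \<le> (\<Sum>u\<in>V\<^sub>0 - (V - A). real \<Delta> * P)"
        using D \<psi> by (intro sum_mono mult_mono) auto
      also have "\<dots> = real (card (V\<^sub>0 - (V - A))) * (real \<Delta> * P)" by simp
      also have "\<dots> \<le> real (n + m) * (real \<Delta> * P)"
      proof (intro mult_right_mono)
        have "V\<^sub>0 - (V - A) \<subseteq> (V\<^sub>0 - V) \<union> A" by auto
        then have "card (V\<^sub>0 - (V - A)) \<le> card ((V\<^sub>0 - V) \<union> A)" using fin finA by (intro card_mono) auto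
        also have "\<dots> \<le> card (V\<^sub>0 - V) + card A" by (rule card_Un_le)
        also have "\<dots> \<le> n + m" using False Suc.prems(5) by simp
        finally show "real (card (V\<^sub>0 - (V - A))) \<le> real (n + m)" by simp
      qed (use \<open>P \<ge> 0\<close> in auto)
      finally have "(\<Sum>u\<in>V\<^sub>0 - (V - A). D u * \<psi> (D u - 1)) \<le> real (n + m) * \<Delta> * P" by simp
      moreover have "(\<Sum>u\<in>V\<^sub>0. D u * \<psi> (D u - 1)) =
          (\<Sum>u\<in>V\<^sub>0 - (V - A). D u * \<psi> (D u - 1)) + (\<Sum>u\<in>V - A. D u * \<psi> (D u - 1))"
        by (rule sum.subset_diff[OF VA fin])
      moreover have "(\<Sum>u\<in>V - A. D u * \<psi> (D u - 1)) = (\<Sum>u\<in>V - A. d u * \<psi> (d u - 1))"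
        using Suc.prems(4) by simp
      ultimately show "(\<Sum>u\<in>V\<^sub>0. D u * \<psi> (D u - 1)) - real (n + m) * \<Delta> * P \<le> (\<Sum>u\<in>V - A. d u * \<psi> (d u - 1))"
        by linarith
    qed
    \<comment> \<open>An edge from \<open>v\<close> back into the active set lowers a degree there,
      at a cost of at most \<open>c\<close> by the increment bound on \<open>\<psi>\<close>.\<close>
    have b_ge: "1 + (\<Sum>u\<in>A - {v}. \<psi> (d u)) + ((\<Sum>u\<in>S - A. \<psi> (d u - 1)) - c * card (S \<inter> A)) \<le> b S"
      if S: "S \<in> star_sets V d v" for S
    proof -
      have SV: "S \<subseteq> V - {v}" using S by (auto simp: star_sets_def)
      then have finS: "finite S" using finV finite_subset by blast
      have "A' S = (A - {v}) \<union> (S - A)" using SV vA by (auto simp: A'_def)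
      then have "(\<Sum>u\<in>A' S. \<psi> (residual d S u)) =
         (\<Sum>u\<in>A - {v}. \<psi> (residual d S u)) + (\<Sum>u\<in>S - A. \<psi> (residual d S u))"
        using finA finS by (simp only:) (intro sum.union_disjoint; auto)
      moreover have "(\<Sum>u\<in>S - A. \<psi> (residual d S u)) = (\<Sum>u\<in>S - A. \<psi> (d u - 1))"
        by (intro sum.cong) (auto simp: residual_def)
      moreover have "(\<Sum>u\<in>A - {v}. \<psi> (residual d S u)) \<ge> (\<Sum>u\<in>A - {v}. \<psi> (d u) - (if u \<in> S then c else 0))"
        using \<psi>(3) by (intro sum_mono) (auto simp: residual_def diff_le_eq)
      moreover have "(\<Sum>u\<in>A - {v}. \<psi> (d u) - (if u \<in> S then c else 0)) = (\<Sum>u\<in>A - {v}. \<psi> (d u)) - c * card (S \<inter> A)"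
      proof -
        have "(A - {v}) \<inter> S = S \<inter> A" using SV by auto
        then show ?thesis using finA by (simp add: sum_subtractf sum.If_cases mult.commute)
      qed
      ultimately show ?thesis unfolding b_def by linarith
    qed
    have "card (graphs V d) * (1 + (\<Sum>u\<in>A - {v}. \<psi> (d u)) + c * d v)
      = card (graphs V d) * (1 + (\<Sum>u\<in>A - {v}. \<psi> (d u))) + card (graphs V d) * (c * d v)"
      by (simp add: algebra_simps)
    also have "\<dots> \<le> card (graphs V d) * (1 + (\<Sum>u\<in>A - {v}. \<psi> (d u))) +
        (\<Sum>E\<in>graphs V d. (\<Sum>u\<in>nbrs E v - A. \<psi> (d u - 1)) - c * card (nbrs E v \<inter> A))"
      using gain by (intro add_mono order.refl)
    also have "\<dots> = (\<Sum>E\<in>graphs V d. 1 + (\<Sum>u\<in>A - {v}. \<psi> (d u)) +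
        ((\<Sum>u\<in>nbrs E v - A. \<psi> (d u - 1)) - c * card (nbrs E v \<inter> A)))"
      by (simp only: sum.distrib[symmetric] sum_constant[symmetric])
    also have "\<dots> \<le> (\<Sum>E\<in>graphs V d. b (nbrs E v))"
      using b_ge nbrs_in_star_sets[OF finV vV] by (intro sum_mono) auto
    finally have strong: "card (graphs V d) * (1 + (\<Sum>u\<in>A - {v}. \<psi> (d u)) + c * d v)
       \<le> (\<Sum>E\<in>graphs V d. explore_potential \<psi> m (Suc N) E A)" using step by linarith
    \<comment> \<open>Exploring \<open>v\<close> exchanges \<open>\<psi> (d v)\<close> for 1 plus an
      expected gain of at least \<open>c * d v\<close>. Since
      \<open>\<psi> k \<le> 1 + c * k\<close>, this is no loss, and the stronger inequality implies
      the one that the induction carries.\<close>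
    have "card (graphs V d) * (\<Sum>u\<in>A. \<psi> (d u)) \<le> card (graphs V d) * (1 + (\<Sum>u\<in>A - {v}. \<psi> (d u)) + c * d v)"
      using \<psi>(4)[of "d v"] sum.remove[OF finA vA, of "\<lambda>u. \<psi> (d u)"] by (intro mult_left_mono) auto
    from order.trans[OF this strong] show ?thesis using strong unfolding v_def by blast
  qed
qed

section \<open>Concentration for a fixed degree sequence\<close>

lemma reach_eq_if_mem:
  assumes "w \<in> reach E {v}"
  shows "reach E {w} = reach E {v}"
proof -
  let ?r = "{(x, y). {x, y} \<in> E}"
  have "sym ?r" by (auto simp: sym_def insert_commute)
  then have "sym (?r\<^sup>*)" by (rule sym_rtrancl)
  moreover have vw: "(v, w) \<in> ?r\<^sup>*" using assms by (simp add: reach_def)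
  ultimately have wv: "(w, v) \<in> ?r\<^sup>*" by (rule symD)
  have "(w, x) \<in> ?r\<^sup>* \<longleftrightarrow> (v, x) \<in> ?r\<^sup>*" for x
    using rtrancl_trans[OF vw, of x] rtrancl_trans[OF wv, of x] by blast
  then show ?thesis by (auto simp: reach_def)
qed

lemma card_mult_le_sum:
  fixes h :: "'b \<Rightarrow> real" and t :: real
  assumes "finite S" "\<And>x. x \<in> S \<Longrightarrow> h x \<ge> 0"
  shows "card {x \<in> S. h x \<ge> t} * t \<le> sum h S"
proof -
  have "card {x \<in> S. h x \<ge> t} * t \<le> (\<Sum>x | x \<in> S \<and> h x \<ge> t. h x)"
    using sum_mono[of "{x \<in> S. h x \<ge> t}" "\<lambda>_. t" h] by simp
  also have "\<dots> \<le> sum h S" using assms by (intro sum_mono2) auto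
  finally show ?thesis .
qed

text \<open>Here \<open>c\<^sub>1\<close> lies slightly above and \<open>c\<close> slightly below 1
  / (1 - \<nu>). Outside a fraction \<open>b\<close> of bad graphs all components are smaller than U
  = \<open>c\<^sub>1 * D v\<^sub>0 + \<theta> + 1\<close>, while the potential started at
  \<open>v\<^sub>0\<close> has mean at least \<open>1 + c * D v\<^sub>0\<close> and equals the
  component size on the other graphs. Markov's inequality for the gap between U and the component
  size, nonnegative there, gives the lower bound. \<open>N\<close> serves both as number of steps
  and as cap on the active vertices, hence \<open>N + N\<close>.\<close>

lemma component_concentration:
  fixes D :: "nat \<Rightarrow> nat" and s y\<^sub>1 y\<^sub>2 M c\<^sub>1 c \<theta> \<kappa> b P :: real and N K :: nat
  defines "P \<equiv> 1 + c * real K"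
  assumes fin: "finite V" and FV: "F \<subseteq> V" and v0: "v\<^sub>0 \<in> V" and max: "\<And>u. u \<in> V \<Longrightarrow> D u \<le> D v\<^sub>0"
    and s: "s > 0" and c1: "c\<^sub>1 \<ge> 0" and y1: "1 \<le> y\<^sub>1" "y\<^sub>1 \<le> exp (s * c\<^sub>1)" and y2: "1 \<le> y\<^sub>2" and M: "M > 0"
    and fp1: "1 + (\<Sum>u\<in>V. D u * ((if u \<in> F then 1 else exp s) * (if u \<in> F then 1 else y\<^sub>1 ^ (D u - 1)) - 1)) / M \<le> y\<^sub>1"
    and fp2: "1 + (\<Sum>u\<in>V. D u * ((if u \<in> F then 2 else 1) * (if u \<in> F then 1 else y\<^sub>2 ^ (D u - 1)) - 1)) / M \<le> y\<^sub>2"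
    and edges: "M + (2 * real (D v\<^sub>0)^2 + 4 * real (D v\<^sub>0)) + 2 * real (D v\<^sub>0) * real N \<le> (\<Sum>u\<in>V. real (D u))"
    and \<theta>: "\<theta> \<ge> 0" and N: "c\<^sub>1 * D v\<^sub>0 + \<theta> + 1 \<le> N" and c: "c \<ge> 0"
    and cc: "c \<le> (1 - real N * D v\<^sub>0 / M - (\<Sum>u\<in>V. real (D u)) / M) * P
        + ((\<Sum>u\<in>V. D u * (1 + c * real (min (D u - 1) K))) - real (N + N) * D v\<^sub>0 * P) / M - c * (real N * D v\<^sub>0 / M)"
    and b: "card V * exp (- s * \<theta>) + (\<Sum>v\<in>F. y\<^sub>2 ^ D v - 1) \<le> b" and \<kappa>: "\<kappa> > 0"
  shows "card {E \<in> graphs V D. \<not> ((\<forall>v\<in>V. card (reach E {v}) < c\<^sub>1 * D v\<^sub>0 + \<theta> + 1) \<and>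
             c\<^sub>1 * D v\<^sub>0 + \<theta> + 1 - \<kappa> \<le> card (reach E {v\<^sub>0}))}
      \<le> card (graphs V D) * (b + ((c\<^sub>1 - c) * D v\<^sub>0 + \<theta> + b * (N + (N + D v\<^sub>0) * P)) / \<kappa>)"
proof -
  let ?G = "graphs V D" and ?\<Delta> = "D v\<^sub>0"
  define g where "g = real (card ?G)"
  define w1 where "w1 = explore_weight (\<lambda>u. if u \<in> F then 1 else exp s) F N"
  define w2 where "w2 = explore_weight (\<lambda>u. if u \<in> F then 2 else 1) F N"
  define U where "U = c\<^sub>1 * ?\<Delta> + \<theta> + 1"
  define \<psi> where "\<psi> k = 1 + c * real (min k K)" for k
  define Bad1 where "Bad1 v = {E \<in> ?G. w1 E {v} \<ge> exp (s * (c\<^sub>1 * D v + \<theta>))}" for v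
  \<comment> \<open>The event that an exploration from \<open>v\<close> hits \<open>F\<close>, as
    \<open>w2\<close> is a power of 2. Markov is applied to \<open>w2 - 1\<close>, because the mean
    of \<open>w2\<close> itself is close to 1.\<close>
  define Bad2 where "Bad2 v = {E \<in> ?G. w2 E {v} - 1 \<ge> 1}" for v
  define Bad where "Bad = (\<Union>v\<in>V. Bad1 v) \<union> (\<Union>v\<in>F. Bad2 v)"
  have fing: "finite ?G" using finite_graphs[OF fin] .
  have finF: "finite F" using FV fin finite_subset by blast
  have g0: "g \<ge> 0" by (simp add: g_def)
  have P1: "P \<ge> 1" using c by (simp add: P_def)
  have sumw1: "(\<Sum>E\<in>?G. w1 E {v}) \<le> g * y\<^sub>1 ^ D v" if "v \<in> V" for v
  proof -
    have "(\<Sum>E\<in>?G. w1 E {v}) \<le> card ?G * (\<Prod>u\<in>{v}. y\<^sub>1 ^ D u)"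
      unfolding w1_def using that s
      by (intro explore_weight_bound[OF y1(1) _ M fin max fp1] edges) auto
    then show ?thesis by (simp add: g_def)
  qed
  have sumw2: "(\<Sum>E\<in>?G. w2 E {v}) \<le> g * y\<^sub>2 ^ D v" if "v \<in> V" for v
  proof -
    have "(\<Sum>E\<in>?G. w2 E {v}) \<le> card ?G * (\<Prod>u\<in>{v}. y\<^sub>2 ^ D u)"
      unfolding w2_def using that
      by (intro explore_weight_bound[OF y2 _ M fin max fp2] edges) auto
    then show ?thesis by (simp add: g_def)
  qed
  have w1_ge: "w1 E A \<ge> 1" and w2_ge: "w2 E A \<ge> 1" for E A
    unfolding w1_def w2_def using s by (intro explore_weight_ge_1; simp)+
  have bad1: "card (Bad1 v) \<le> g * exp (- s * \<theta>)" if v: "v \<in> V" for v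
  proof -
    have "card (Bad1 v) * exp (s * (c\<^sub>1 * D v + \<theta>)) \<le> (\<Sum>E\<in>?G. w1 E {v})"
      unfolding Bad1_def using fing w1_ge by (intro card_mult_le_sum[where h = "\<lambda>E. w1 E {v}"]) (auto intro: order.trans[OF zero_le_one])
    also have "\<dots> \<le> g * y\<^sub>1 ^ D v" using sumw1[OF v] .
    also have "\<dots> \<le> g * exp (s * c\<^sub>1) ^ D v"
      using y1 g0 by (intro mult_left_mono power_mono) auto
    also have "\<dots> = g * exp (- s * \<theta>) * exp (s * (c\<^sub>1 * D v + \<theta>))"
      by (simp add: exp_of_nat_mult[symmetric] algebra_simps flip: exp_add)
    finally show ?thesis by simp
  qed
  have bad2: "card (Bad2 v) \<le> g * (y\<^sub>2 ^ D v - 1)" if v: "v \<in> F" for v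
  proof -
    have "real (card (Bad2 v)) * 1 \<le> (\<Sum>E\<in>?G. w2 E {v} - 1)"
      unfolding Bad2_def using fing w2_ge by (intro card_mult_le_sum[where h = "\<lambda>E. w2 E {v} - 1"]) auto
    also have "\<dots> = (\<Sum>E\<in>?G. w2 E {v}) - g" by (simp add: sum_subtractf g_def)
    also have "\<dots> \<le> g * (y\<^sub>2 ^ D v - 1)" using sumw2[of v] v FV by (auto simp: algebra_simps)
    finally show ?thesis by simp
  qed
  have BadG: "Bad \<subseteq> ?G" by (auto simp: Bad_def Bad1_def Bad2_def)
  then have finBad: "finite Bad" using fing finite_subset by blast
  have cardBad: "card Bad \<le> g * b"
  proof -
    have "card Bad \<le> (\<Sum>v\<in>V. card (Bad1 v)) + (\<Sum>v\<in>F. card (Bad2 v))"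
      unfolding Bad_def using fin finF
      by (intro order.trans[OF card_Un_le] add_mono card_UN_le)
    then have "real (card Bad) \<le> (\<Sum>v\<in>V. real (card (Bad1 v))) + (\<Sum>v\<in>F. real (card (Bad2 v)))"
      unfolding of_nat_sum[symmetric] of_nat_add[symmetric] of_nat_le_iff .
    also have "\<dots> \<le> (\<Sum>v\<in>V. g * exp (- s * \<theta>)) + (\<Sum>v\<in>F. g * (y\<^sub>2 ^ D v - 1))"
      using bad1 bad2 by (intro add_mono sum_mono) auto
    also have "\<dots> = g * (card V * exp (- s * \<theta>) + (\<Sum>v\<in>F. y\<^sub>2 ^ D v - 1))"
      by (simp add: sum_distrib_left algebra_simps)
    also have "\<dots> \<le> g * b" using b g0 by (intro mult_left_mono) auto
    finally show ?thesis .
  qed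
  have edgesE: "E \<subseteq> {e. e \<subseteq> V \<and> card e = 2}" if "E \<in> ?G" for E using that by (simp add: graphs_def)
  have upper0: "card (reach E {v}) < c\<^sub>1 * D v + \<theta> + 1"
    if E: "E \<in> ?G" "E \<notin> Bad" and v: "v \<in> V" and hit: "w2 E {v} < 2" for E v
  proof -
    have "exp (s * (min (real N) (card (reach E {v})) - real (card {v}))) \<le> w1 E {v}"
      unfolding w1_def using fin edgesE[OF E(1)] v s hit[unfolded w2_def]
      by (intro explore_weight_lower[of V]) auto
    also have "\<dots> < exp (s * (c\<^sub>1 * D v + \<theta>))" using E v by (force simp: Bad_def Bad1_def)
    finally have "min (real N) (card (reach E {v})) < c\<^sub>1 * D v + \<theta> + 1" using s by simp
    \<comment> \<open>This rules out that the minimum is \<open>N\<close>, so the bound concerns the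
      component size itself.\<close>
    moreover have "c\<^sub>1 * D v + \<theta> + 1 \<le> N"
      using N mult_left_mono[OF _ c1, of "D v" "?\<Delta>"] max[OF v] by simp
    ultimately show ?thesis by linarith
  qed
  have upper: "card (reach E {v}) < U" if E: "E \<in> ?G" "E \<notin> Bad" and v: "v \<in> V" for E v
  proof -
    \<comment> \<open>A component that avoids \<open>F\<close> is explored from \<open>v\<close>,
      any other from one of its vertices in \<open>F\<close>. So hits need to be excluded only for
      starts in \<open>F\<close>, which keeps the union bound short.\<close>
    obtain w where w: "w \<in> V" "reach E {w} = reach E {v}" "w2 E {w} < 2"
    proof (cases "reach E {v} \<inter> F = {}")
      case True
      have "w2 E {v} = 1"
        unfolding w2_def using True fin edgesE[OF E(1)] v by (intro explore_weight_eq_1[of V]) auto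
      then show ?thesis using v by (intro that) auto
    next
      case False
      then obtain w where w: "w \<in> reach E {v}" "w \<in> F" by auto
      then have "w2 E {w} < 2" using E by (force simp: Bad_def Bad2_def)
      then show ?thesis using w reach_eq_if_mem[OF w(1)] FV by (intro that) auto
    qed
    then have "card (reach E {v}) < c\<^sub>1 * D w + \<theta> + 1" using upper0[OF E w(1,3)] by simp
    also have "\<dots> \<le> U" unfolding U_def using max[OF w(1)] c1 by (intro add_mono mult_left_mono) auto
    finally show ?thesis .
  qed
  define B where "B = N + (N + ?\<Delta>) * P"
  define R where "R E = real (card (reach E {v\<^sub>0}))" for E
  define ep where "ep E = explore_potential \<psi> N N E {v\<^sub>0}" for E
  have B0: "B \<ge> 0" unfolding B_def using P1 by simp
  have U0: "U \<ge> 1" unfolding U_def using c1 \<theta> by simp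
  have UN: "U \<le> N" using N by (simp add: U_def)
  have sum_ep: "g * (1 + c * ?\<Delta>) \<le> (\<Sum>E\<in>?G. ep E)"
  proof -
    have N1: "N > 0" using UN U0 by linarith
    have "N > 0 \<and> {v\<^sub>0} \<noteq> {} \<and> card {v\<^sub>0} \<le> N \<longrightarrow>
      card ?G * (1 + (\<Sum>u\<in>{v\<^sub>0} - {Min {v\<^sub>0}}. \<psi> (D u)) + c * D (Min {v\<^sub>0}))
       \<le> (\<Sum>E\<in>?G. explore_potential \<psi> N N E {v\<^sub>0})"
    proof (rule conjunct2[OF explore_potential_bound[OF fin max M]])
      show "\<psi> k \<le> P" for k unfolding \<psi>_def P_def using c by (intro add_mono mult_left_mono) auto
      show "0 \<le> \<psi> k" for k unfolding \<psi>_def using c by simp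
      show "\<psi> k \<le> \<psi> (k - 1) + c" for k
      proof -
        have "c * real (min k K) \<le> c * (real (min (k - 1) K) + 1)"
          using c by (intro mult_left_mono) auto
        then show ?thesis by (simp add: \<psi>_def algebra_simps)
      qed
      show "\<psi> k \<le> 1 + c * k" for k unfolding \<psi>_def using c by (intro add_mono mult_left_mono) auto
      show "real N * ?\<Delta> \<le> (real N * ?\<Delta> / M) * M" using M by simp
      show "c \<le> (1 - real N * ?\<Delta> / M - (\<Sum>u\<in>V. real (D u)) / M) * P
        + ((\<Sum>u\<in>V. D u * \<psi> (D u - 1)) - real (N + N) * ?\<Delta> * P) / M - c * (real N * ?\<Delta> / M)"
        using cc unfolding \<psi>_def .
    qed (use c v0 max edges in auto)
    then show ?thesis using N1 by (simp add: g_def ep_def)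
  qed
  have ep_good: "ep E = R E" if "E \<in> ?G" "E \<notin> Bad" for E
    unfolding ep_def R_def using upper[OF that v0] UN fin edgesE[OF that(1)] v0
    by (intro explore_potential_eq_card_reach[of V]) auto
  have ep_bad: "ep E \<le> B" if "E \<in> ?G" for E
  proof -
    have "ep E \<le> real N + real (N + ?\<Delta>) * P"
      unfolding ep_def
    proof (rule explore_potential_le[OF fin edgesE[OF that]])
      show "card (nbrs E w) \<le> ?\<Delta>" for w
      proof (cases "w \<in> V")
        case True
        then show ?thesis using card_nbrs[OF that] max by simp
      next
        case False
        then have "nbrs E w = {}" using graphs_edgeD[OF that] by (auto simp: nbrs_def)
        then show ?thesis by simp
      qed
      show "\<psi> k \<le> P" for k unfolding \<psi>_def P_def using c by (intro add_mono mult_left_mono) auto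
    qed (use v0 P1 UN U0 in auto)
    then show ?thesis by (simp add: B_def)
  qed
  have good: "(\<Sum>E\<in>?G - Bad. U - R E) \<le> g * ((c\<^sub>1 - c) * ?\<Delta> + \<theta> + b * B)"
  proof -
    have "g * (1 + c * ?\<Delta>) \<le> (\<Sum>E\<in>?G - Bad. ep E) + (\<Sum>E\<in>Bad. ep E)"
      using sum_ep sum.subset_diff[OF BadG fing, of ep] by simp
    also have "(\<Sum>E\<in>Bad. ep E) \<le> (\<Sum>E\<in>Bad. B)" using ep_bad BadG by (intro sum_mono) auto
    also have "(\<Sum>E\<in>Bad. B) \<le> g * b * B" using cardBad B0 by (simp add: mult_right_mono)
    also have "(\<Sum>E\<in>?G - Bad. ep E) = (\<Sum>E\<in>?G - Bad. R E)" using ep_good by simp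
    finally have 1: "g * (1 + c * ?\<Delta>) \<le> (\<Sum>E\<in>?G - Bad. R E) + g * b * B" by simp
    have "(\<Sum>E\<in>?G - Bad. U) \<le> g * U"
      using U0 fing by (simp add: g_def card_mono mult_right_mono)
    then have "(\<Sum>E\<in>?G - Bad. U - R E) \<le> g * U - (\<Sum>E\<in>?G - Bad. R E)"
      by (simp only: sum_subtractf diff_right_mono)
    also have "\<dots> \<le> g * U + g * b * B - g * (1 + c * ?\<Delta>)" using 1 by linarith
    also have "\<dots> = g * ((c\<^sub>1 - c) * ?\<Delta> + \<theta> + b * B)" by (simp add: U_def algebra_simps)
    finally show ?thesis .
  qed
  define Low where "Low = {E \<in> ?G - Bad. U - R E \<ge> \<kappa>}"
  have "card Low * \<kappa> \<le> (\<Sum>E\<in>?G - Bad. U - R E)"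
    unfolding Low_def using fing upper[OF _ _ v0]
    by (intro card_mult_le_sum[where h = "\<lambda>E. U - R E"]) (auto simp: R_def intro: less_imp_le)
  with good have low: "card Low \<le> g * (((c\<^sub>1 - c) * ?\<Delta> + \<theta> + b * B) / \<kappa>)"
    using \<kappa> by (simp add: field_simps)
  have "{E \<in> ?G. \<not> ((\<forall>v\<in>V. card (reach E {v}) < U) \<and> U - \<kappa> \<le> card (reach E {v\<^sub>0}))} \<subseteq> Bad \<union> Low"
    using upper by (fastforce simp: Low_def R_def)
  then have "card {E \<in> ?G. \<not> ((\<forall>v\<in>V. card (reach E {v}) < U) \<and> U - \<kappa> \<le> card (reach E {v\<^sub>0}))} \<le> card (Bad \<union> Low)"
    using finBad fing by (intro card_mono) (auto simp: Low_def)
  also have "\<dots> \<le> card Bad + card Low" by (rule card_Un_le)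
  finally have "real (card {E \<in> ?G. \<not> ((\<forall>v\<in>V. card (reach E {v}) < U) \<and> U - \<kappa> \<le> card (reach E {v\<^sub>0}))})
     \<le> g * b + g * (((c\<^sub>1 - c) * ?\<Delta> + \<theta> + b * B) / \<kappa>)"
    using cardBad low by linarith
  then show ?thesis unfolding U_def g_def B_def by (simp add: distrib_left)
qed

section \<open>Parameters of the exploration\<close>

lemma exp_le_quadratic:
  fixes w :: real
  assumes "w \<ge> 0"
  shows "exp w - 1 \<le> w + w^2 * exp w"
proof -
  have "(1 - w) * exp w \<le> exp (- w) * exp w"
    using exp_ge_add_one_self[of "- w"] by (intro mult_right_mono) auto
  then have 1: "exp w - 1 \<le> w * exp w" by (simp add: exp_minus algebra_simps)
  have "w * (exp w - 1) \<le> w * (w * exp w)" using 1 assms by (rule mult_left_mono)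
  with 1 show ?thesis by (simp add: power2_eq_square algebra_simps)
qed

lemma one_plus_power_le_exp:
  fixes x :: real
  assumes "x \<ge> 0"
  shows "(1 + x) ^ k \<le> exp (x * k)"
proof -
  have "(1 + x) ^ k \<le> exp x ^ k"
    using assms by (intro power_mono exp_ge_add_one_self) auto
  then show ?thesis by (simp add: exp_of_nat_mult[symmetric] mult.commute)
qed

text \<open>To first order in \<open>s\<close>, the value \<open>1 + c\<^sub>1 * s\<close> works if
  1 + \<open>c\<^sub>1 * \<nu>\<close> is at most \<open>c\<^sub>1\<close>, that is, if
  \<open>c\<^sub>1 * (1 - \<nu>)\<close> is at least 1. The slack \<open>e\<close> pays for the
  quadratic error of exp, which produces the third moment \<open>T\<close>, and for dividing by
  \<open>M\<close> instead of \<open>m\<close>. Vertices of \<open>F\<close> have weight 1 and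
  contribute nothing to the sum.\<close>

lemma exp_supersolution:
  fixes V F :: "nat set" and D :: "nat \<Rightarrow> nat" and s c\<^sub>1 e \<nu> \<xi> L T M m :: real
  defines "m \<equiv> (\<Sum>u\<in>V. real (D u))"
  assumes fin: "finite V" and S2: "(\<Sum>u\<in>V. real (D u) * (real (D u) - 1)) = \<nu> * m" and "\<nu> \<ge> 0"
    and M: "M > 0" "m \<le> (1 + \<xi>) * M" "\<xi> \<ge> 0" and s: "s > 0" and c1: "c\<^sub>1 \<ge> 1" "c\<^sub>1 * (1 - \<nu>) = 1 + e" 
    and L: "\<And>u. u \<in> V - F \<Longrightarrow> c\<^sub>1 * s * D u \<le> L" and T: "(\<Sum>u\<in>V - F. real (D u) ^ 3) \<le> T"
    and small: "exp L * c\<^sub>1^2 * s^2 * T / M + s * \<xi> * c\<^sub>1 \<le> s * e" and "e \<ge> 0"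
  shows "1 + (\<Sum>u\<in>V. D u * ((if u \<in> F then 1 else exp s) * (if u \<in> F then 1 else (1 + c\<^sub>1 * s) ^ (D u - 1)) - 1)) / M \<le> 1 + c\<^sub>1 * s"
proof -
  define h where "h u = D u * ((if u \<in> F then 1 else exp s) * (if u \<in> F then 1 else (1 + c\<^sub>1 * s) ^ (D u - 1)) - 1)" for u
  define w where "w u = s + c\<^sub>1 * s * (real (D u) - 1)" for u
  define C where "C = exp L * c\<^sub>1^2 * s^2"
  have w0: "0 \<le> w u \<and> w u \<le> c\<^sub>1 * s * D u" if "D u > 0" for u
  proof
    have "0 \<le> c\<^sub>1 * s * (real (D u) - 1)" using that s c1(1) by (intro mult_nonneg_nonneg) auto
    then show "0 \<le> w u" using s by (simp add: w_def)
    have "s \<le> c\<^sub>1 * s" using s c1(1) mult_right_mono[OF c1(1), of s] by simp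
    then show "w u \<le> c\<^sub>1 * s * D u" by (simp add: w_def right_diff_distrib)
  qed
  have h_le: "h u \<le> D u * w u + (if u \<in> F then 0 else C * real (D u) ^ 3)" if u: "u \<in> V" for u
  proof (cases "D u = 0")
    case True
    then show ?thesis by (simp add: h_def)
  next
    case False
    then have Dp: "D u > 0" by simp
    show ?thesis
    proof (cases "u \<in> F")
      case True
      then show ?thesis using w0[OF Dp] by (simp add: h_def)
    next
      case uF: False
      have "exp s * (1 + c\<^sub>1 * s) ^ (D u - 1) \<le> exp s * exp (c\<^sub>1 * s * real (D u - 1))"
        using s c1 by (intro mult_left_mono one_plus_power_le_exp) auto
      also have "\<dots> = exp (w u)" using Dp by (simp add: w_def of_nat_diff flip: exp_add)
      finally have "exp s * (1 + c\<^sub>1 * s) ^ (D u - 1) - 1 \<le> w u + (w u)^2 * exp (w u)"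
        using exp_le_quadratic[of "w u"] w0[OF Dp] by linarith
      also have "(w u)^2 * exp (w u) \<le> (c\<^sub>1 * s * D u)^2 * exp L"
        using w0[OF Dp] L[of u] u uF by (intro mult_mono power_mono) auto
      finally have "h u \<le> D u * (w u + (c\<^sub>1 * s * D u)^2 * exp L)"
        using uF unfolding h_def by (auto intro!: mult_left_mono)
      also have "\<dots> = D u * w u + C * real (D u) ^ 3"
        by (simp add: C_def algebra_simps power2_eq_square power3_eq_cube)
      finally show ?thesis using uF by simp
    qed
  qed
  have "(\<Sum>u\<in>V. h u) \<le> (\<Sum>u\<in>V. D u * w u) + (\<Sum>u\<in>V. if u \<in> F then 0 else C * real (D u) ^ 3)"
    unfolding sum.distrib[symmetric] using h_le by (rule sum_mono)
  also have "(\<Sum>u\<in>V. D u * w u) = s * m + c\<^sub>1 * s * (\<Sum>u\<in>V. real (D u) * (real (D u) - 1))"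
    unfolding w_def m_def sum_distrib_left sum.distrib[symmetric] by (intro sum.cong refl) (simp add: algebra_simps)
  also have "\<dots> = s * m * (c\<^sub>1 - e)"
  proof -
    have "1 + c\<^sub>1 * \<nu> = c\<^sub>1 - e" using c1(2) by (simp add: algebra_simps)
    then show ?thesis unfolding S2 by (simp add: algebra_simps flip: \<open>1 + c\<^sub>1 * \<nu> = c\<^sub>1 - e\<close>)
  qed
  also have "(\<Sum>u\<in>V. if u \<in> F then 0 else C * real (D u) ^ 3) = C * (\<Sum>u\<in>V - F. real (D u) ^ 3)"
  proof -
    have "(\<Sum>u\<in>V. if u \<in> F then 0 else C * real (D u) ^ 3) = (\<Sum>u\<in>V - F. C * real (D u) ^ 3)"
      using fin by (intro sum.mono_neutral_cong_right) auto
    then show ?thesis by (simp add: sum_distrib_left)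
  qed
  also have "\<dots> \<le> C * T" using T by (intro mult_left_mono) (auto simp: C_def)
  finally have "(\<Sum>u\<in>V. h u) \<le> s * m * (c\<^sub>1 - e) + C * T" by simp
  also have "s * m * (c\<^sub>1 - e) \<le> s * ((1 + \<xi>) * M) * (c\<^sub>1 - e)"
  proof (intro mult_right_mono mult_left_mono M(2))
    have "c\<^sub>1 - e = 1 + c\<^sub>1 * \<nu>" using c1(2) by (simp add: algebra_simps)
    then show "0 \<le> c\<^sub>1 - e" using c1 \<open>\<nu> \<ge> 0\<close> by simp
  qed (use s in auto)
  also have "s * ((1 + \<xi>) * M) * (c\<^sub>1 - e) \<le> M * (s * (c\<^sub>1 - e) + s * \<xi> * c\<^sub>1)"
  proof -
    have "0 \<le> s * \<xi> * e * M" using s M \<open>e \<ge> 0\<close> by simp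
    then show ?thesis by (simp add: algebra_simps)
  qed
  finally have "(\<Sum>u\<in>V. h u) \<le> M * (s * (c\<^sub>1 - e) + s * \<xi> * c\<^sub>1) + C * T" by simp
  then have "(\<Sum>u\<in>V. h u) / M \<le> (M * (s * (c\<^sub>1 - e) + s * \<xi> * c\<^sub>1) + C * T) / M"
    using M by (intro divide_right_mono) auto
  also have "\<dots> = s * (c\<^sub>1 - e) + s * \<xi> * c\<^sub>1 + C * T / M"
    using M by (simp add: add_divide_distrib)
  also have "\<dots> \<le> c\<^sub>1 * s" using small unfolding C_def by (simp add: algebra_simps)
  finally show ?thesis unfolding h_def by simp
qed

text \<open>An edge leads into \<open>F\<close> with chance at most about B / M and otherwise to a
  subcritical offspring, so \<open>z\<close> has to absorb B / M plus (1 - \<delta>) z. Of the slack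
  \<open>\<delta>\<close>, one half pays for \<open>M\<close> in place of \<open>m\<close>, one
  quarter for the quadratic error and one quarter for \<open>B\<close>.\<close>

lemma hit_supersolution:
  fixes V F :: "nat set" and D :: "nat \<Rightarrow> nat" and z \<delta> \<xi> T B M m :: real
  defines "m \<equiv> (\<Sum>u\<in>V. real (D u))"
  assumes fin: "finite V" and FV: "F \<subseteq> V" and S2: "(\<Sum>u\<in>V. real (D u) * (real (D u) - 1)) \<le> (1 - \<delta>) * m"
    and M: "M > 0" "m \<le> (1 + \<xi>) * M" and \<xi>: "0 \<le> \<xi>" "\<xi> \<le> \<delta> / 2" and \<delta>: "0 < \<delta>" "\<delta> \<le> 1"
    and z: "z > 0" "\<And>u. u \<in> V \<Longrightarrow> z * D u \<le> 1"
    and T: "(\<Sum>u\<in>V. real (D u) ^ 3) \<le> T" "3 * z * T \<le> M * \<delta> / 4"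
    and B: "(\<Sum>u\<in>F. real (D u)) \<le> B" "B \<le> z * M * \<delta> / 4"
  shows "1 + (\<Sum>u\<in>V. D u * ((if u \<in> F then 2 else 1) * (if u \<in> F then 1 else (1 + z) ^ (D u - 1)) - 1)) / M \<le> 1 + z"
proof -
  define h where "h u = D u * ((if u \<in> F then 2 else 1) * (if u \<in> F then 1 else (1 + z) ^ (D u - 1)) - 1)" for u
  have h_le: "h u \<le> z * (real (D u) * (real (D u) - 1)) + 3 * z^2 * real (D u) ^ 3 + (if u \<in> F then real (D u) else 0)"
    if u: "u \<in> V" for u
  proof (cases "D u = 0")
    case True
    then show ?thesis by (simp add: h_def)
  next
    case False
    then have Dp: "real (D u) \<ge> 1" by simp
    show ?thesis
    proof (cases "u \<in> F")
      case True
      have "0 \<le> z * (real (D u) * (real (D u) - 1)) + 3 * z^2 * real (D u) ^ 3" using Dp z(1) by simp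
      then show ?thesis using True by (simp add: h_def)
    next
      case uF: False
      define w where "w = z * real (D u - 1)"
      have w: "0 \<le> w" "w \<le> z * D u"
        using z(1) mult_left_mono[of "real (D u - 1)" "real (D u)" z] by (auto simp: w_def)
      then have "w \<le> 1" using z(2)[OF u] by linarith
      have "(1 + z) ^ (D u - 1) - 1 \<le> exp w - 1"
        unfolding w_def using z by (intro diff_right_mono one_plus_power_le_exp) auto
      also have "\<dots> \<le> w + w^2 * exp w" using exp_le_quadratic[OF w(1)] .
      also have "w^2 * exp w \<le> (z * D u)^2 * 3"
      proof (intro mult_mono power_mono)
        have "exp w \<le> exp 1" using \<open>w \<le> 1\<close> by simp
        also have "\<dots> \<le> 3" by (rule exp_le)
        finally show "exp w \<le> 3" .
      qed (use w in auto)
      finally have "h u \<le> D u * (w + (z * D u)^2 * 3)"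
        using uF unfolding h_def by (auto intro!: mult_left_mono)
      also have "\<dots> = z * (real (D u) * (real (D u) - 1)) + 3 * z^2 * real (D u) ^ 3"
        using False by (simp add: w_def of_nat_diff algebra_simps power2_eq_square power3_eq_cube)
      finally show ?thesis using uF by simp
    qed
  qed
  have "(\<Sum>u\<in>V. h u) \<le> (\<Sum>u\<in>V. z * (real (D u) * (real (D u) - 1)) + 3 * z^2 * real (D u) ^ 3 + (if u \<in> F then real (D u) else 0))"
    using h_le by (rule sum_mono)
  also have "\<dots> = z * (\<Sum>u\<in>V. real (D u) * (real (D u) - 1)) + 3 * z^2 * (\<Sum>u\<in>V. real (D u) ^ 3) + (\<Sum>u\<in>F. real (D u))"
  proof -
    have "V \<inter> F = F" using FV by auto
    then have "(\<Sum>u\<in>V. if u \<in> F then real (D u) else 0) = (\<Sum>u\<in>F. real (D u))"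
      using fin by (simp add: sum.If_cases)
    then show ?thesis by (simp add: sum.distrib sum_distrib_left)
  qed
  also have "\<dots> \<le> z * ((1 - \<delta>) * ((1 + \<xi>) * M)) + 3 * z^2 * T + z * M * \<delta> / 4"
    using S2 M \<delta> z T B by (intro add_mono mult_left_mono order.trans[OF S2]) auto
  also have "3 * z^2 * T \<le> z * (M * \<delta> / 4)"
    using mult_left_mono[OF T(2), of z] z(1) by (simp add: power2_eq_square)
  also have "z * ((1 - \<delta>) * ((1 + \<xi>) * M)) \<le> z * ((1 - \<delta> / 2) * M)"
  proof (intro mult_left_mono)
    have "(1 - \<delta>) * (1 + \<xi>) \<le> 1 - \<delta> / 2"
    proof -
      have "0 \<le> \<delta> * \<xi>" using \<delta> \<xi> by simp
      moreover have "(1 - \<delta>) * (1 + \<xi>) = 1 - \<delta> + \<xi> - \<delta> * \<xi>" by (simp add: algebra_simps)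
      ultimately show ?thesis using \<xi>(2) by linarith
    qed
    then show "(1 - \<delta>) * ((1 + \<xi>) * M) \<le> (1 - \<delta> / 2) * M"
      using M(1) by (simp only: mult.assoc[symmetric] mult_right_mono less_imp_le)
  qed (use z in auto)
  finally have "(\<Sum>u\<in>V. h u) \<le> z * M" by (simp add: algebra_simps)
  then show ?thesis using M(1) unfolding h_def[symmetric] by (simp add: field_simps)
qed

text \<open>Without errors an edge gains 1 + c \<nu> = c + e, which exceeds by \<open>e\<close> the
  \<open>c\<close> charged for it. This excess pays for \<open>M\<close> in place of
  \<open>m\<close> (\<open>\<xi>\<close>), for the square sum lost by truncating at \<open>K\<close>
  (\<open>\<rho>\<close>), and for edges into the active set and missing vertices
  (\<open>\<zeta>\<close>).\<close>

lemma potential_drift: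
  fixes V :: "nat set" and D :: "nat \<Rightarrow> nat" and c e \<nu> \<xi> \<rho> M \<zeta> P q m :: real and K :: nat
  defines "m \<equiv> (\<Sum>u\<in>V. real (D u))" and "P \<equiv> 1 + c * real K"
  assumes fin: "finite V" and S2: "(\<Sum>u\<in>V. real (D u) * (real (D u) - 1)) = \<nu> * m"
    and M: "M > 0" "M \<le> m" "m \<le> (1 + \<xi>) * M" and \<xi>: "0 \<le> \<xi>" "\<xi> \<le> 1" and \<nu>: "\<nu> \<ge> 0"
    and c: "c \<ge> 0" "c * (1 - \<nu>) = 1 - e"
    and \<rho>: "(\<Sum>u\<in>{u\<in>V. D u > K}. real (D u)^2) \<le> \<rho> * m" "\<rho> \<ge> 0"
    and q: "q / M = 2 * \<zeta> * P"
    and small: "\<xi> * P + 2 * c * \<rho> + \<zeta> * (3 * P + c) \<le> e"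
  shows "c \<le> (1 - \<zeta> - m / M) * P + ((\<Sum>u\<in>V. D u * (1 + c * real (min (D u - 1) K))) - q) / M - c * \<zeta>"
proof -
  define Q where "Q = (\<Sum>u\<in>V. D u * (1 + c * real (min (D u - 1) K)))"
  have P1: "P \<ge> 1" using c by (simp add: P_def)
  have "(\<Sum>u\<in>V. real (D u) * (1 + c * (real (D u) - 1)) - c * (if D u > K then real (D u)^2 else 0)) \<le> Q"
    unfolding Q_def
  proof (rule sum_mono)
    fix u assume "u \<in> V"
    have "real (D u) * (real (D u) - 1) - (if D u > K then real (D u)^2 else 0) \<le> D u * real (min (D u - 1) K)"
    proof (cases "D u > K")
      case True
      have "real (D u) * (real (D u) - 1) - real (D u)^2 \<le> 0" by (simp add: power2_eq_square algebra_simps)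
      also have "0 \<le> D u * real (min (D u - 1) K)" by simp
      finally show ?thesis using True by simp
    next
      case False
      then have "min (D u - 1) K = D u - 1" by simp
      then show ?thesis using False by (cases "D u = 0") (auto simp: of_nat_diff)
    qed
    from mult_left_mono[OF this c(1)]
    show "real (D u) * (1 + c * (real (D u) - 1)) - c * (if D u > K then real (D u)^2 else 0)
      \<le> D u * (1 + c * real (min (D u - 1) K))" by (simp add: algebra_simps)
  qed
  also have "(\<Sum>u\<in>V. real (D u) * (1 + c * (real (D u) - 1)) - c * (if D u > K then real (D u)^2 else 0))
     = m + c * (\<Sum>u\<in>V. real (D u) * (real (D u) - 1)) - c * (\<Sum>u\<in>{u\<in>V. D u > K}. real (D u)^2)"
  proof -
    have "(\<Sum>u\<in>{u\<in>V. D u > K}. real (D u)^2) = (\<Sum>u\<in>V. if D u > K then real (D u)^2 else 0)"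
      using fin by (rule sum.inter_filter)
    then show ?thesis unfolding m_def
      by (simp add: sum_distrib_left sum.distrib[symmetric] sum_subtractf[symmetric] algebra_simps)
  qed
  finally have "m * (1 + c * \<nu>) - c * (\<rho> * m) \<le> Q"
    using mult_left_mono[OF \<rho>(1) c(1)] unfolding S2 by (simp add: algebra_simps)
  then have "(m * (1 + c * \<nu>) - c * (\<rho> * m)) / M \<le> Q / M"
    using M by (intro divide_right_mono) auto
  then have 1: "m / M * (1 + c * \<nu>) - m / M * (c * \<rho>) \<le> Q / M"
    by (simp add: diff_divide_distrib mult.commute mult.left_commute)
  have r: "1 \<le> m / M" "m / M \<le> 1 + \<xi>" using M by (auto simp: field_simps)
  have 2: "1 * (1 + c * \<nu>) \<le> m / M * (1 + c * \<nu>)"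
    using r c \<nu> by (intro mult_right_mono) auto
  have 3: "m / M * (c * \<rho>) \<le> 2 * (c * \<rho>)"
    using r \<xi> c \<rho> by (intro mult_right_mono) auto
  have 4: "(1 - \<zeta> - m / M) * P \<ge> (- \<zeta> - \<xi>) * P"
    using r P1 by (intro mult_right_mono) auto
  have 5: "1 + c * \<nu> = c + e" using c(2) by (simp add: algebra_simps)
  have "(Q - q) / M = Q / M - 2 * \<zeta> * P" using q by (simp add: diff_divide_distrib)
  then show ?thesis unfolding Q_def[symmetric]
    using 1 2 3 4 5 small by (simp add: algebra_simps)
qed

section \<open>Degree moments from the tail bound\<close>

lemma powr_diff_le:
  fixes p :: real
  assumes "p \<ge> 1"
  shows "real (Suc k) powr p - real k powr p \<le> p * real (Suc k) powr (p - 1)"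
proof (cases "k = 0")
  case True
  then show ?thesis using assms by simp
next
  case False
  have "\<exists>z. real k < z \<and> z < real (Suc k) \<and>
     real (Suc k) powr p - real k powr p = (real (Suc k) - real k) * (p * z powr (p - 1))"
    using False by (intro MVT2) (auto intro!: derivative_eq_intros)
  then obtain z where z: "real k < z" "z < real (Suc k)"
    "real (Suc k) powr p - real k powr p = p * z powr (p - 1)" by auto
  have "z powr (p - 1) \<le> real (Suc k) powr (p - 1)"
    using z assms by (intro powr_mono2) auto
  then show ?thesis using z assms by simp
qed

text \<open>Summation by parts: D^p is at most the sum of p k^(p-1) over k up to D, and the number
  of degrees that are at least k is of order k^(1-\<gamma>). The resulting series converges since p
  < \<gamma> - 1.\<close>

lemma sum_powr_degrees:
  fixes p \<gamma> C :: real and D :: "'b \<Rightarrow> nat"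
  assumes fin: "finite V" and p: "p \<ge> 1" "p < \<gamma> - 1"
    and tail: "\<And>k. k \<ge> 1 \<Longrightarrow> card {i\<in>V. k \<le> D i} \<le> C * real k powr (1 - \<gamma>)" and C: "C \<ge> 0"
  shows "(\<Sum>i\<in>V. real (D i) powr p) \<le> C * (p * (\<Sum>k. real k powr (p - \<gamma>)))"
proof -
  have summ: "summable (\<lambda>k. real k powr (p - \<gamma>))" using p by (simp add: summable_real_powr_iff)
  define n where "n = Max (insert 0 (D ` V))"
  have Dn: "D i \<le> n" if "i \<in> V" for i unfolding n_def using that fin by (intro Max_ge) auto
  have tele: "real j powr p \<le> (\<Sum>k<j. p * real (Suc k) powr (p - 1))" for j
  proof (induction j)
    case (Suc j)
    then show ?case using powr_diff_le[OF p(1), of j] by simp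
  qed (use p in simp)
  have "(\<Sum>i\<in>V. real (D i) powr p) \<le> (\<Sum>i\<in>V. \<Sum>k<n. if k < D i then p * real (Suc k) powr (p - 1) else 0)"
  proof (rule sum_mono)
    fix i assume "i \<in> V"
    then have "{..<n} \<inter> {k. k < D i} = {..<D i}" using Dn[of i] by auto
    then show "real (D i) powr p \<le> (\<Sum>k<n. if k < D i then p * real (Suc k) powr (p - 1) else 0)"
      using tele[of "D i"] by (simp add: sum.If_cases)
  qed
  also have "\<dots> = (\<Sum>k<n. \<Sum>i\<in>V. if k < D i then p * real (Suc k) powr (p - 1) else 0)" by (rule sum.swap)
  also have "\<dots> = (\<Sum>k<n. real (card {i\<in>V. Suc k \<le> D i}) * (p * real (Suc k) powr (p - 1)))"
    using fin by (intro sum.cong refl) (simp add: sum.If_cases Int_def Suc_le_eq)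
  also have "\<dots> \<le> (\<Sum>k<n. C * real (Suc k) powr (1 - \<gamma>) * (p * real (Suc k) powr (p - 1)))"
  proof (intro sum_mono mult_right_mono)
    show "real (card {i \<in> V. Suc k \<le> D i}) \<le> C * real (Suc k) powr (1 - \<gamma>)" for k
      by (rule tail) simp
  qed (use p in auto)
  also have "\<dots> = C * (p * (\<Sum>k<n. real (Suc k) powr (p - \<gamma>)))"
    unfolding sum_distrib_left by (intro sum.cong refl) (simp add: powr_add[symmetric])
  \<comment> \<open>The added term at index 0 vanishes, because \<open>0 powr x\<close> is 0 for
    every exponent.\<close>
  also have "(\<Sum>k<n. real (Suc k) powr (p - \<gamma>)) \<le> (\<Sum>k<Suc n. real k powr (p - \<gamma>))"
    by (subst sum.lessThan_Suc_shift) simp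
  also have "\<dots> \<le> (\<Sum>k. real k powr (p - \<gamma>))"
    using summ by (intro sum_le_suminf) auto
  finally show ?thesis using C p by (simp add: mult_left_mono)
qed

lemma sum_cube_le:
  fixes \<sigma> B :: real and D :: "'b \<Rightarrow> nat"
  assumes "\<sigma> \<le> 1" "\<And>u. u \<in> X \<Longrightarrow> D u \<le> B"
  shows "(\<Sum>u\<in>X. real (D u) ^ 3) \<le> B powr (1 - \<sigma>) * (\<Sum>u\<in>X. real (D u) powr (2 + \<sigma>))"
  unfolding sum_distrib_left
proof (rule sum_mono)
  fix u assume u: "u \<in> X"
  show "real (D u) ^ 3 \<le> B powr (1 - \<sigma>) * real (D u) powr (2 + \<sigma>)"
  proof (cases "D u = 0")
    case False
    have "real (D u) ^ 3 = real (D u) powr (1 - \<sigma>) * real (D u) powr (2 + \<sigma>)"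
      using False by (simp add: powr_add[symmetric])
    also have "\<dots> \<le> B powr (1 - \<sigma>) * real (D u) powr (2 + \<sigma>)"
      using assms u by (intro mult_right_mono powr_mono2) auto
    finally show ?thesis .
  qed simp
qed

lemma sum_square_tail_le:
  fixes \<sigma> :: real and D :: "'b \<Rightarrow> nat"
  assumes "finite V" "\<sigma> \<ge> 0" "K \<ge> 1"
  shows "(\<Sum>u\<in>{u\<in>V. D u > K}. real (D u)^2) \<le> real K powr (- \<sigma>) * (\<Sum>u\<in>V. real (D u) powr (2 + \<sigma>))"
proof -
  have "(\<Sum>u\<in>{u\<in>V. D u > K}. real (D u)^2) \<le> (\<Sum>u\<in>{u\<in>V. D u > K}. real K powr (- \<sigma>) * real (D u) powr (2 + \<sigma>))"
  proof (rule sum_mono)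
    fix u assume u: "u \<in> {u\<in>V. D u > K}"
    have "real (D u)^2 = real (D u) powr (- \<sigma>) * real (D u) powr (2 + \<sigma>)"
      using u by (simp add: powr_add[symmetric])
    also have "\<dots> \<le> real K powr (- \<sigma>) * real (D u) powr (2 + \<sigma>)"
      using assms u by (intro mult_right_mono powr_mono2') auto
    finally show "real (D u)^2 \<le> real K powr (- \<sigma>) * real (D u) powr (2 + \<sigma>)" .
  qed
  also have "\<dots> \<le> (\<Sum>u\<in>V. real K powr (- \<sigma>) * real (D u) powr (2 + \<sigma>))"
    using assms by (intro sum_mono2) auto
  finally show ?thesis by (simp add: sum_distrib_left)
qed

text \<open>The vertex \<open>v\<close> is itself counted at k = D v, so the tail bound there is at
  least 1.\<close>

lemma max_degree_le:
  fixes \<gamma> C :: real and D :: "'b \<Rightarrow> nat"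
  assumes "finite V" "\<gamma> > 1" "v \<in> V" and C: "C \<ge> 0"
    and tail: "\<And>k. k \<ge> 1 \<Longrightarrow> card {i\<in>V. k \<le> D i} \<le> C * real k powr (1 - \<gamma>)"
  shows "real (D v) \<le> C powr (1 / (\<gamma> - 1))"
proof (cases "D v = 0")
  case False
  have "card {v} \<le> card {i\<in>V. D v \<le> D i}" using assms(1,3) by (intro card_mono) auto
  then have "1 \<le> C * real (D v) powr (1 - \<gamma>)" using tail[of "D v"] False by simp
  then have "real (D v) powr (\<gamma> - 1) \<le> C * (real (D v) powr (1 - \<gamma>) * real (D v) powr (\<gamma> - 1))"
    using mult_right_mono[of 1 "C * real (D v) powr (1 - \<gamma>)" "real (D v) powr (\<gamma> - 1)"] by (simp add: mult.assoc)
  then have "real (D v) powr (\<gamma> - 1) \<le> C" using False by (simp add: powr_add[symmetric])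
  then have "(real (D v) powr (\<gamma> - 1)) powr (1 / (\<gamma> - 1)) \<le> C powr (1 / (\<gamma> - 1))"
    using assms(2) by (intro powr_mono2) auto
  then show ?thesis using assms(2) False by (simp add: powr_powr)
qed simp

section \<open>Choice of constants and uniform asymptotics\<close>

lemma eventually_mult_neg_powr_le:
  fixes C t x :: real
  assumes "x < 0" "t > 0"
  shows "\<forall>\<^sub>F n in sequentially. C * real n powr x \<le> t"
proof -
  have "(\<lambda>n. C * real n powr x) \<longlonglongrightarrow> 0"
    using assms by (intro tendsto_mult_right_zero tendsto_neg_powr filterlim_real_sequentially)
  from order_tendstoD(2)[OF this assms(2)] show ?thesis by (rule eventually_mono) simp
qed

text \<open>The quantifier over \<open>D\<close> stands inside \<open>eventually\<close>: the
  threshold for n depends on the constants only. This uniformity is what allows a random degree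
  sequence later on.\<close>

lemma uniform_concentration:
  fixes \<gamma> \<delta> \<epsilon> \<eta> :: real
  assumes \<gamma>: "\<gamma> > 3" and \<delta>: "0 < \<delta>" "\<delta> \<le> 1" and \<epsilon>: "\<epsilon> > 0" and \<eta>: "\<eta> > 0"
  shows "\<forall>\<^sub>F n in sequentially. \<forall>D.
    (\<forall>k\<ge>1. card {i\<in>{1..n}. k \<le> D i} \<le> inverse \<delta> * real n * real k powr (1 - \<gamma>)) \<longrightarrow>
    \<delta> * real n \<le> (\<Sum>i=1..n. real (D i)) \<longrightarrow>
    (\<Sum>i=1..n. real (D i) * (real (D i) - 1)) \<le> (1 - \<delta>) * (\<Sum>i=1..n. real (D i)) \<longrightarrow>
    (let r = real (Max (D ` {1..n})) / (1 - (\<Sum>i=1..n. real (D i) * (real (D i) - 1)) / (\<Sum>i=1..n. real (D i)));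
         a = real n powr (1 / (\<gamma> - 1)) in
      card {E \<in> graphs {1..n} D. \<not> ((\<forall>v\<in>{1..n}. card (reach E {v}) \<le> r + \<eta> * a) \<and>
         (\<exists>v\<in>{1..n}. r - \<eta> * a \<le> card (reach E {v})))} \<le> \<epsilon> * card (graphs {1..n} D))"
proof -
  define \<beta> where "\<beta> = 1 / (\<gamma> - 1)"
  have \<beta>: "0 < \<beta>" "2 * \<beta> < 1" using \<gamma> by (auto simp: \<beta>_def field_simps)
  \<comment> \<open>The moment of order 2 + \<sigma> is still below \<gamma> - 1, hence
    O(n).\<close>
  define \<sigma> where "\<sigma> = min 1 ((\<gamma> - 3) / 2)"
  have \<sigma>: "0 < \<sigma>" "\<sigma> \<le> 1" "2 + \<sigma> < \<gamma> - 1" using \<gamma> by (auto simp: \<sigma>_def min_def field_simps)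
  \<comment> \<open>The first bound makes the third moment of the small degrees harmless in
    \<open>exp_supersolution\<close>; the second makes the expected number of hits between big
    vertices vanish.\<close>
  define \<tau> where "\<tau> = min (\<sigma> / 2) ((1 - 2 * \<beta>) / 4)"
  have \<tau>_le: "\<tau> \<le> \<sigma> / 2" "\<tau> \<le> (1 - 2 * \<beta>) / 4"
    unfolding \<tau>_def by (rule min.cobounded1, rule min.cobounded2)
  have \<tau>: "0 < \<tau>" "\<tau> < \<sigma>" "2 * \<tau> + 2 * \<beta> - 1 < 0" "\<tau> < 1"
  proof -
    show "0 < \<tau>" using \<sigma> \<beta> by (simp add: \<tau>_def)
    show "\<tau> < \<sigma>" "2 * \<tau> + 2 * \<beta> - 1 < 0" "\<tau> < 1" using \<tau>_le \<sigma> \<beta> by auto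
  qed
  define K\<^sub>0 where "K\<^sub>0 = inverse \<delta>"
  have K0: "K\<^sub>0 > 0" using \<delta> by (simp add: K\<^sub>0_def)
  define C\<^sub>1 where "C\<^sub>1 = K\<^sub>0 powr \<beta>"
  have C1: "C\<^sub>1 > 0" using K0 by (simp add: C\<^sub>1_def)
  define C\<^sub>2 where "C\<^sub>2 = K\<^sub>0 * ((2 + \<sigma>) * (\<Sum>k. real k powr (2 + \<sigma> - \<gamma>)))"
  have C2: "C\<^sub>2 \<ge> 0"
    unfolding C\<^sub>2_def using K0 \<sigma> by (intro mult_nonneg_nonneg suminf_nonneg) (auto simp: summable_real_powr_iff)
  define \<epsilon>' where "\<epsilon>' = min \<epsilon> 1"
  have \<epsilon>': "\<epsilon>' > 0" "\<epsilon>' \<le> \<epsilon>" "\<epsilon>' \<le> 1" using \<epsilon> by (auto simp: \<epsilon>'_def)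
  \<comment> \<open>\<open>e\<^sub>1\<close> is the slack in the two slopes and
    \<open>e\<^sub>2\<close> sets \<open>\<theta>\<close>. Each of
    \<open>(c\<^sub>1 - c) * \<Delta>\<close> and \<open>\<theta>\<close> is then at most
    \<open>\<eta> * \<epsilon>' / 4 * A\<close>, so Markov at level \<open>\<eta> * A\<close> loses
    \<open>\<epsilon>' / 2\<close>; the bad graphs get the other half.\<close>
  define e\<^sub>1 where "e\<^sub>1 = min 1 (\<eta> * \<epsilon>' * \<delta> / (8 * (C\<^sub>1 + 1)))"
  define e\<^sub>2 where "e\<^sub>2 = \<eta> * \<epsilon>' / 4"
  have e1: "e\<^sub>1 > 0" "e\<^sub>1 \<le> 1" using \<eta> \<epsilon>' \<delta> C1 by (auto simp: e\<^sub>1_def)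
  have e2: "e\<^sub>2 > 0" "e\<^sub>2 \<le> \<eta> / 4"
    using \<eta> \<epsilon>' mult_left_mono[OF \<epsilon>'(3), of \<eta>] by (auto simp: e\<^sub>2_def)
  have e1C: "e\<^sub>1 * C\<^sub>1 / \<delta> \<le> \<eta> * \<epsilon>' / 8"
  proof -
    have "e\<^sub>1 * C\<^sub>1 / \<delta> \<le> (\<eta> * \<epsilon>' * \<delta> / (8 * (C\<^sub>1 + 1))) * (C\<^sub>1 + 1) / \<delta>"
      using \<delta> C1 e1 by (intro divide_right_mono mult_mono) (auto simp: e\<^sub>1_def)
    also have "\<dots> = \<eta> * \<epsilon>' / 8"
    proof -
      have "(\<eta> * \<epsilon>' * \<delta> / (8 * y)) * y / \<delta> = \<eta> * \<epsilon>' / 8" if "y \<noteq> 0" for y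
        using that \<delta> by simp
      from this[of "C\<^sub>1 + 1"] show ?thesis using C1 by simp
    qed
    finally show ?thesis .
  qed
  \<comment> \<open>The square sum over degrees above \<open>K\<close> is at most a factor
    \<open>K powr (- \<sigma>)\<close> times the moment of order 2 + \<sigma>, so a truncation level
    independent of n suffices.\<close>
  obtain K :: nat where K: "K \<ge> 1" "2 / \<delta> * (C\<^sub>2 / \<delta>) * real K powr (- \<sigma>) \<le> e\<^sub>1 / 4"
  proof -
    have "\<forall>\<^sub>F n in sequentially. 2 / \<delta> * (C\<^sub>2 / \<delta>) * real n powr (- \<sigma>) \<le> e\<^sub>1 / 4"
      using \<sigma> e1 by (intro eventually_mult_neg_powr_le) auto
    then have "\<forall>\<^sub>F n in sequentially. n \<ge> 1 \<and> 2 / \<delta> * (C\<^sub>2 / \<delta>) * real n powr (- \<sigma>) \<le> e\<^sub>1 / 4"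
      using eventually_ge_at_top[of 1] by eventually_elim simp
    then show ?thesis using that by (auto simp: eventually_sequentially)
  qed
  define P\<^sub>1 where "P\<^sub>1 = 1 + real K / \<delta>"
  have P1: "P\<^sub>1 \<ge> 1" using \<delta> by (simp add: P\<^sub>1_def)
  define \<xi> where "\<xi> = min (e\<^sub>1 * \<delta> / 4) (e\<^sub>1 / (4 * P\<^sub>1))"
  have \<xi>: "\<xi> > 0" "\<xi> \<le> e\<^sub>1 * \<delta> / 4" "\<xi> \<le> e\<^sub>1 / (4 * P\<^sub>1)" using e1 \<delta> P1 by (auto simp: \<xi>_def)
  have "e\<^sub>1 * \<delta> \<le> 1 * \<delta>" using e1 \<delta> by (intro mult_right_mono) auto
  then have "\<xi> \<le> \<delta> / 4" using \<xi>(2) by simp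
  then have \<xi>': "\<xi> \<le> \<delta> / 2" "\<xi> \<le> 1" using \<delta> by auto
  \<comment> \<open>With A = a n, these constants bound the step number
    (\<open>C\<^sub>3 * A\<close>), the edges reserved for switchings and deletions
    (\<open>C\<^sub>4 * A^2\<close>) and the crude potential (\<open>C\<^sub>6 * A\<close>);
    \<open>C\<^sub>5\<close> scales the hitting parameter \<open>z\<close>.\<close>
  define C\<^sub>3 where "C\<^sub>3 = 2 / \<delta> * C\<^sub>1 + \<eta> + 2"
  have C3: "C\<^sub>3 > 0" using C1 \<delta> \<eta> by (simp add: C\<^sub>3_def add_pos_pos)
  define C\<^sub>4 where "C\<^sub>4 = 2 * C\<^sub>1^2 + 4 * C\<^sub>1 + 2 * C\<^sub>1 * C\<^sub>3"
  have C4: "C\<^sub>4 > 0" using C1 C3 by (simp add: C\<^sub>4_def add_pos_pos)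
  define C\<^sub>5 where "C\<^sub>5 = 8 * K\<^sub>0 * C\<^sub>1 / \<delta>^2"
  have C5: "C\<^sub>5 > 0" using K0 C1 \<delta> by (simp add: C\<^sub>5_def)
  define C\<^sub>6 where "C\<^sub>6 = C\<^sub>3 + (C\<^sub>3 + C\<^sub>1) * P\<^sub>1"
  have C6: "C\<^sub>6 > 0" using C1 C3 P1 by (simp add: C\<^sub>6_def add_pos_pos)
  define a where "a n = real n powr \<beta>" for n :: nat
  \<comment> \<open>The order of n^(2\<tau>) a^2 / n; it also dominates a^2 / n, the relative size
    of all switching errors.\<close>
  define X where "X n = real n powr (2 * \<tau> + 2 * \<beta> - 1)" for n :: nat
  define b where "b n = real n * exp (- e\<^sub>2 * (a n) powr \<tau>) + 4 * K\<^sub>0 * C\<^sub>5 * C\<^sub>1 * X n" for n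
  have ev_X: "\<forall>\<^sub>F n in sequentially. C * X n \<le> t" if "t > 0" for C t
    unfolding X_def using \<tau>(3) that by (rule eventually_mult_neg_powr_le)
  have ev_a: "\<forall>\<^sub>F n in sequentially. t \<le> a n" for t
  proof -
    have "filterlim a at_top sequentially"
      unfolding a_def using \<beta>(1) by real_asymp
    then show ?thesis by (simp add: filterlim_at_top)
  qed
  have ev_2: "\<forall>\<^sub>F n in sequentially. exp (2 / \<delta>) * (2 / \<delta>)^3 * C\<^sub>2 * (a n) powr (\<tau> - \<sigma>) \<le> e\<^sub>1 / 2"
    unfolding a_def powr_powr using \<beta> \<tau> e1 by (intro eventually_mult_neg_powr_le) (auto simp: mult_pos_neg)
  have ev_b: "\<forall>\<^sub>F n in sequentially. b n * (1 + C\<^sub>6 / \<eta>) \<le> \<epsilon>' / 2"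
  proof -
    have "(\<lambda>n. real n * exp (- e\<^sub>2 * real n powr y)) \<longlonglongrightarrow> 0" if "y > 0" for y
      using that e2(1) by real_asymp
    from this[of "\<beta> * \<tau>"] have "(\<lambda>n. real n * exp (- e\<^sub>2 * (a n) powr \<tau>)) \<longlonglongrightarrow> 0"
      using \<beta> \<tau> by (simp add: a_def powr_powr)
    moreover have "X \<longlonglongrightarrow> 0" unfolding X_def
      by (rule tendsto_neg_powr[OF \<tau>(3) filterlim_real_sequentially])
    ultimately have "(\<lambda>n. b n * (1 + C\<^sub>6 / \<eta>)) \<longlonglongrightarrow> (0 + 4 * K\<^sub>0 * C\<^sub>5 * C\<^sub>1 * 0) * (1 + C\<^sub>6 / \<eta>)"
      unfolding b_def by (intro tendsto_intros)
    then have lim: "(\<lambda>n. b n * (1 + C\<^sub>6 / \<eta>)) \<longlonglongrightarrow> 0" by simp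
    have "\<epsilon>' / 2 > 0" using \<epsilon>' by simp
    from order_tendstoD(2)[OF lim this] show ?thesis by (rule eventually_mono) simp
  qed
  have ev_4: "\<forall>\<^sub>F n in sequentially. 2 * C\<^sub>4 * X n \<le> \<xi> * \<delta>" using \<xi> \<delta> by (intro ev_X) simp
  have ev_5: "\<forall>\<^sub>F n in sequentially. C\<^sub>5 * C\<^sub>1 * X n \<le> 1" by (intro ev_X) simp
  have ev_6: "\<forall>\<^sub>F n in sequentially. 24 * C\<^sub>5 * (C\<^sub>1 + 1) * C\<^sub>2 * X n \<le> \<delta>^2" using \<delta> by (intro ev_X) simp
  have ev_7: "\<forall>\<^sub>F n in sequentially. C\<^sub>3 * C\<^sub>1 * 2 / \<delta> * (3 * P\<^sub>1 + 1 / \<delta>) * X n \<le> e\<^sub>1 / 4" using e1 by (intro ev_X) simp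
  show ?thesis
    using eventually_ge_at_top[of 1] ev_a[of 1] ev_a[of "2 / \<eta>"] ev_2 ev_b ev_4 ev_5 ev_6 ev_7
  proof eventually_elim
    case (elim n)
    define A where "A = a n"
    define x where "x = X n"
    define t where "t = real n powr \<tau>"
    have n1: "real n \<ge> 1" using elim(1) by simp
    have A1: "A \<ge> 1" using elim(2) by (simp add: A_def)
    have A\<eta>: "1 \<le> \<eta> / 2 * A" using elim(3) \<eta> by (simp add: A_def field_simps)
    have t1: "t \<ge> 1" unfolding t_def using n1 \<tau> by (intro ge_one_powr_ge_zero) auto
    have A2tt: "A^2 * t * t = x * n"
    proof -
      have "A^2 * t * t = real n powr (\<beta> + \<beta> + \<tau> + \<tau>)"
        by (simp only: A_def a_def t_def powr_add power2_eq_square)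
      also have "\<beta> + \<beta> + \<tau> + \<tau> = 2 * \<tau> + 2 * \<beta> - 1 + 1" by simp
      also have "real n powr (2 * \<tau> + 2 * \<beta> - 1 + 1) = x * n" using n1 by (simp only: powr_add x_def X_def) simp
      finally show ?thesis .
    qed
    have A2t: "A^2 * t \<le> x * n"
      using A2tt mult_left_mono[OF t1, of "A^2 * t"] t1 by simp
    have A2: "A^2 \<le> x * n"
      using A2t mult_left_mono[OF t1, of "A^2"] by simp
    show ?case
    proof (intro allI impI)
      fix D :: "nat \<Rightarrow> nat"
      define V where "V = {1..n}"
      define m where "m = (\<Sum>i\<in>V. real (D i))"
      define S where "S = (\<Sum>i\<in>V. real (D i) * (real (D i) - 1))"
      assume "\<forall>k\<ge>1. card {i\<in>{1..n}. k \<le> D i} \<le> inverse \<delta> * real n * real k powr (1 - \<gamma>)"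
        and "\<delta> * real n \<le> (\<Sum>i=1..n. real (D i))"
        and "(\<Sum>i=1..n. real (D i) * (real (D i) - 1)) \<le> (1 - \<delta>) * (\<Sum>i=1..n. real (D i))"
      then have tail: "\<And>k. k \<ge> 1 \<Longrightarrow> card {i\<in>V. k \<le> D i} \<le> K\<^sub>0 * real n * real k powr (1 - \<gamma>)"
        and mean: "\<delta> * n \<le> m" and crit: "S \<le> (1 - \<delta>) * m"
        by (auto simp: K\<^sub>0_def V_def m_def S_def)
      define \<nu> where "\<nu> = S / m"
      have finV: "finite V" and cV: "card V = n" by (auto simp: V_def)
      have m0: "m > 0" using mean \<delta> n1 by (smt (verit) mult_pos_pos)
      have S0: "S \<ge> 0"
        unfolding S_def
      proof (rule sum_nonneg)
        fix i assume "i \<in> V"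
        show "0 \<le> real (D i) * (real (D i) - 1)" by (cases "D i = 0") auto
      qed
      have \<nu>: "0 \<le> \<nu>" "\<nu> \<le> 1 - \<delta>" "S = \<nu> * m"
        using S0 m0 crit by (auto simp: \<nu>_def field_simps)
      obtain v\<^sub>0 where v0: "v\<^sub>0 \<in> V" "D v\<^sub>0 = Max (D ` V)"
      proof -
        have "Max (D ` V) \<in> D ` V" using finV elim(1) by (intro Max_in) (auto simp: V_def)
        then show ?thesis using that by (metis imageE)
      qed
      have max: "D u \<le> D v\<^sub>0" if "u \<in> V" for u using that finV unfolding v0 by simp
      define \<Delta> where "\<Delta> = real (D v\<^sub>0)"
      define r where "r = \<Delta> / (1 - \<nu>)"
      have K0n: "K\<^sub>0 * real n \<ge> 0" using K0 by simp
      have \<Delta>: "0 \<le> \<Delta>" "\<Delta> \<le> C\<^sub>1 * A"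
        using max_degree_le[OF finV _ v0(1) K0n tail] \<gamma> K0
        by (auto simp: \<Delta>_def C\<^sub>1_def A_def a_def \<beta>_def powr_mult)
      have D\<Delta>: "real (D u) \<le> \<Delta>" if "u \<in> V" for u using max[OF that] by (simp add: \<Delta>_def)
      have pow: "(\<Sum>i\<in>V. real (D i) powr (2 + \<sigma>)) \<le> C\<^sub>2 * n"
        using sum_powr_degrees[OF finV, of "2 + \<sigma>" \<gamma> D "K\<^sub>0 * real n", OF _ _ tail K0n] \<sigma>
        by (simp add: C\<^sub>2_def algebra_simps)
      have \<nu>\<delta>: "1 - \<nu> \<ge> \<delta>" using \<nu> by simp
      then have \<nu>1: "1 - \<nu> > 0" using \<delta> by simp
      have inv\<nu>: "1 / (1 - \<nu>) \<le> 1 / \<delta>" "1 \<le> 1 / (1 - \<nu>)"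
        using \<nu>\<delta> \<nu>1 \<delta> \<nu> by (auto simp: field_simps)
      define c\<^sub>1 where "c\<^sub>1 = (1 + e\<^sub>1) / (1 - \<nu>)"
      define c where "c = (1 - e\<^sub>1) / (1 - \<nu>)"
      have c1: "c\<^sub>1 * (1 - \<nu>) = 1 + e\<^sub>1" "1 \<le> c\<^sub>1" "c\<^sub>1 \<le> 2 / \<delta>"
      proof -
        show "c\<^sub>1 * (1 - \<nu>) = 1 + e\<^sub>1" using \<nu>1 by (simp add: c\<^sub>1_def)
        show "1 \<le> c\<^sub>1" using \<nu>1 \<nu> e1 by (simp add: c\<^sub>1_def field_simps)
        have "c\<^sub>1 \<le> 2 * (1 / (1 - \<nu>))" using \<nu>1 e1 by (simp add: c\<^sub>1_def divide_right_mono)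
        also have "\<dots> \<le> 2 / \<delta>" using inv\<nu>(1) by simp
        finally show "c\<^sub>1 \<le> 2 / \<delta>" .
      qed
      have c: "c * (1 - \<nu>) = 1 - e\<^sub>1" "0 \<le> c" "c \<le> 1 / \<delta>"
      proof -
        show "c * (1 - \<nu>) = 1 - e\<^sub>1" using \<nu>1 by (simp add: c_def)
        show "0 \<le> c" using \<nu>1 e1 by (simp add: c_def)
        have "c \<le> 1 / (1 - \<nu>)" using \<nu>1 e1 by (simp add: c_def divide_right_mono)
        then show "c \<le> 1 / \<delta>" using inv\<nu>(1) by simp
      qed
      have r: "0 \<le> r" "r \<le> C\<^sub>1 * A / \<delta>"
      proof -
        show "0 \<le> r" using \<Delta> \<nu>1 by (simp add: r_def)
        have "r \<le> \<Delta> / \<delta>" unfolding r_def using \<Delta> \<nu>\<delta> \<delta> by (intro divide_left_mono) auto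
        also have "\<dots> \<le> C\<^sub>1 * A / \<delta>" using \<Delta> \<delta> by (intro divide_right_mono) auto
        finally show "r \<le> C\<^sub>1 * A / \<delta>" .
      qed
      have c1\<Delta>: "c\<^sub>1 * \<Delta> = r + e\<^sub>1 * r" and c\<Delta>: "c * \<Delta> = r - e\<^sub>1 * r"
        by (simp_all add: c\<^sub>1_def c_def r_def add_divide_distrib diff_divide_distrib algebra_simps)
      have e1r: "e\<^sub>1 * r \<le> \<eta> * \<epsilon>' / 8 * A"
      proof -
        have "e\<^sub>1 * r \<le> e\<^sub>1 * (C\<^sub>1 * A / \<delta>)" using r e1 by (intro mult_left_mono) auto
        also have "\<dots> = e\<^sub>1 * C\<^sub>1 / \<delta> * A" by simp
        also have "\<dots> \<le> \<eta> * \<epsilon>' / 8 * A" using e1C A1 by (intro mult_right_mono) auto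
        finally show ?thesis .
      qed
      define \<theta> where "\<theta> = e\<^sub>2 * A"
      have \<theta>: "0 \<le> \<theta>" "\<theta> \<le> \<eta> / 4 * A" unfolding \<theta>_def using e2 A1 by (auto intro: mult_right_mono)
      \<comment> \<open>The three summands leave room for \<open>c\<^sub>1 * \<Delta>\<close>, for
        \<open>\<theta>\<close> and for the added 1 in the upper bound on the component.\<close>
      define N where "N = nat \<lceil>2 / \<delta> * C\<^sub>1 * A + \<eta> * A + A\<rceil>"
      have N_lower: "2 / \<delta> * C\<^sub>1 * A + \<eta> * A + A \<le> real N" unfolding N_def by linarith
      have N_upper: "real N \<le> C\<^sub>3 * A"
      proof -
        have "0 \<le> 2 / \<delta> * C\<^sub>1 * A + \<eta> * A + A" using \<delta> C1 A1 \<eta> by simp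
        then have "real N \<le> 2 / \<delta> * C\<^sub>1 * A + \<eta> * A + A + 1" unfolding N_def by linarith
        also have "\<dots> \<le> C\<^sub>3 * A" using A1 by (simp add: C\<^sub>3_def algebra_simps)
        finally show ?thesis .
      qed
      have N_ok: "c\<^sub>1 * D v\<^sub>0 + \<theta> + 1 \<le> real N"
      proof -
        have "c\<^sub>1 * \<Delta> \<le> 2 / \<delta> * (C\<^sub>1 * A)" using c1 \<Delta> \<delta> by (intro mult_mono) auto
        moreover have "\<theta> \<le> \<eta> * A"
        proof -
          have "\<eta> / 4 * A \<le> \<eta> * A" using \<eta> A1 by (intro mult_right_mono) auto
          then show ?thesis using \<theta> by linarith
        qed
        ultimately show ?thesis using N_lower A1 by (simp add: \<Delta>_def)
      qed
      \<comment> \<open>All allowances for switchings and deletions together, so that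
        \<open>M = m - R\<close> meets the edge condition with equality.\<close>
      define R where "R = 2 * \<Delta>^2 + 4 * \<Delta> + 2 * \<Delta> * real N"
      define M where "M = m - R"
      have N\<Delta>: "real N * \<Delta> \<le> C\<^sub>3 * C\<^sub>1 * A^2"
      proof -
        have "real N * \<Delta> \<le> (C\<^sub>3 * A) * (C\<^sub>1 * A)"
          using N_upper \<Delta> C3 A1 by (intro mult_mono) auto
        then show ?thesis by (simp add: power2_eq_square algebra_simps)
      qed
      have R: "0 \<le> R" "R \<le> C\<^sub>4 * A^2"
      proof -
        show "0 \<le> R" using \<Delta> by (simp add: R_def)
        have "\<Delta>^2 \<le> C\<^sub>1^2 * A^2" using power_mono[OF \<Delta>(2,1), of 2] by (simp add: power_mult_distrib)
        moreover have "\<Delta> \<le> C\<^sub>1 * A^2"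
        proof -
          have "C\<^sub>1 * A * 1 \<le> C\<^sub>1 * A * A" using C1 A1 by (intro mult_left_mono) auto
          then show ?thesis using \<Delta> by (simp add: power2_eq_square)
        qed
        ultimately show "R \<le> C\<^sub>4 * A^2" using N\<Delta> by (simp add: R_def C\<^sub>4_def algebra_simps)
      qed
      have R2: "2 * R \<le> \<xi> * m"
      proof -
        have "2 * R \<le> 2 * C\<^sub>4 * A^2" using R by simp
        also have "\<dots> \<le> 2 * C\<^sub>4 * (x * n)" using A2 C4 by (intro mult_left_mono) auto
        also have "\<dots> = (2 * C\<^sub>4 * x) * n" by simp
        also have "\<dots> \<le> \<xi> * \<delta> * n" using elim(6) unfolding x_def by (intro mult_right_mono) auto
        also have "\<dots> \<le> \<xi> * m" using mean \<xi> by (simp add: mult.assoc)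
        finally show ?thesis .
      qed
      have mM: "m \<le> (1 + \<xi>) * M"
      proof -
        have "\<xi> * R \<le> 1 * R" using \<xi>' R by (intro mult_right_mono) auto
        then show ?thesis using R2 by (simp add: M_def algebra_simps)
      qed
      have Mm: "M \<le> m" using R by (simp add: M_def)
      have M2: "\<delta> * n / 2 \<le> M"
      proof -
        have "\<xi> * m \<le> 1 * m" using \<xi>' m0 by (intro mult_right_mono) auto
        then have "m \<le> 2 * M" using R2 by (simp add: M_def)
        then show ?thesis using mean by simp
      qed
      have M0: "M > 0" using M2 \<delta> n1 by (smt (verit) divide_pos_pos mult_pos_pos)
      have nM: "n / M \<le> 2 / \<delta>" using M2 M0 \<delta> by (simp add: field_simps)
      define F where "F = {u\<in>V. A powr (1 - \<tau>) \<le> D u}"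
      have FV: "F \<subseteq> V" by (auto simp: F_def)
      have cF: "real (card F) \<le> K\<^sub>0 * t"
      proof -
        define k where "k = nat \<lceil>A powr (1 - \<tau>)\<rceil>"
        have Ap: "A powr (1 - \<tau>) \<ge> 1" using A1 \<tau> by (intro ge_one_powr_ge_zero) auto
        have Ak: "A powr (1 - \<tau>) \<le> real k" unfolding k_def by linarith
        have k1: "k \<ge> 1" using Ap Ak by linarith
        have "F = {u\<in>V. k \<le> D u}" unfolding F_def k_def by (simp add: nat_ceiling_le_eq)
        then have "real (card F) \<le> K\<^sub>0 * real n * real k powr (1 - \<gamma>)" using tail[OF k1] by simp
        also have "\<dots> \<le> K\<^sub>0 * real n * (A powr (1 - \<tau>)) powr (1 - \<gamma>)"
          using Ak Ap \<gamma> K0n by (intro mult_left_mono powr_mono2') auto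
        also have "(A powr (1 - \<tau>)) powr (1 - \<gamma>) = real n powr (\<tau> - 1)"
        proof -
          have "\<beta> * (1 - \<tau>) * (1 - \<gamma>) = \<tau> - 1" using \<gamma> by (simp add: \<beta>_def field_simps)
          then show ?thesis by (simp add: A_def a_def powr_powr)
        qed
        also have "K\<^sub>0 * real n * real n powr (\<tau> - 1) = K\<^sub>0 * t"
          using n1 by (simp add: t_def powr_diff)
        finally show ?thesis .
      qed
      \<comment> \<open>The largest order of \<open>s\<close> for which \<open>s * D u\<close> stays
        bounded off \<open>F\<close>; at the same time \<open>s * \<theta>\<close> is of order
        \<open>A powr \<tau>\<close>, which beats the factor n of the union bound.\<close>
      define s where "s = A powr (\<tau> - 1)"
      have s0: "s > 0" using A1 by (simp add: s_def)
      have fp1: "1 + (\<Sum>u\<in>V. D u * ((if u \<in> F then 1 else exp s) * (if u \<in> F then 1 else (1 + c\<^sub>1 * s) ^ (D u - 1)) - 1)) / M \<le> 1 + c\<^sub>1 * s"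
      proof (rule exp_supersolution[OF finV _ \<nu>(1) M0 _ less_imp_le[OF \<xi>(1)] s0 c1(2,1)])
        show "(\<Sum>u\<in>V. real (D u) * (real (D u) - 1)) = \<nu> * (\<Sum>u\<in>V. real (D u))"
          using \<nu>(3) by (simp add: S_def m_def)
        show "(\<Sum>u\<in>V. real (D u)) \<le> (1 + \<xi>) * M" using mM by (simp add: m_def)
        show "c\<^sub>1 * s * real (D u) \<le> 2 / \<delta>" if "u \<in> V - F" for u
        proof -
          have "c\<^sub>1 * s * real (D u) \<le> 2 / \<delta> * s * A powr (1 - \<tau>)"
            using that c1 s0 \<delta> by (intro mult_mono) (auto simp: F_def)
          also have "\<dots> = 2 / \<delta>" using A1 by (simp add: s_def powr_add[symmetric])
          finally show ?thesis .
        qed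
        have "(\<Sum>u\<in>V - F. real (D u) ^ 3) \<le> A powr (1 - \<sigma>) * (\<Sum>u\<in>V - F. real (D u) powr (2 + \<sigma>))"
        proof (rule sum_cube_le[OF \<sigma>(2)])
          fix u assume "u \<in> V - F"
          then have "real (D u) \<le> A powr (1 - \<tau>)" by (auto simp: F_def)
          also have "\<dots> \<le> A powr 1" using A1 \<tau> by (intro powr_mono) auto
          finally show "real (D u) \<le> A" using A1 by simp
        qed
        also have "\<dots> \<le> A powr (1 - \<sigma>) * (\<Sum>u\<in>V. real (D u) powr (2 + \<sigma>))"
          using finV by (intro mult_left_mono sum_mono2) auto
        also have "\<dots> \<le> A powr (1 - \<sigma>) * (C\<^sub>2 * n)" using pow by (intro mult_left_mono) auto
        finally show "(\<Sum>u\<in>V - F. real (D u) ^ 3) \<le> A powr (1 - \<sigma>) * (C\<^sub>2 * n)" .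
        have "exp (2 / \<delta>) * c\<^sub>1^2 * s^2 * (A powr (1 - \<sigma>) * (C\<^sub>2 * n)) / M
          = c\<^sub>1^2 * (n / M) * (exp (2 / \<delta>) * s^2 * A powr (1 - \<sigma>) * C\<^sub>2)" by simp
        also have "\<dots> \<le> (2 / \<delta>)^2 * (2 / \<delta>) * (exp (2 / \<delta>) * s^2 * A powr (1 - \<sigma>) * C\<^sub>2)"
          using c1 nM M0 C2 \<delta> by (intro mult_right_mono mult_mono power_mono) auto
        also have "\<dots> = s * (exp (2 / \<delta>) * (2 / \<delta>)^3 * C\<^sub>2 * A powr (\<tau> - \<sigma>))"
        proof -
          have "s * A powr (1 - \<sigma>) = A powr (\<tau> - \<sigma>)"
            by (simp add: s_def powr_add[symmetric])
          then show ?thesis by (simp only: flip: \<open>s * A powr (1 - \<sigma>) = A powr (\<tau> - \<sigma>)\<close>)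
            (simp add: power2_eq_square power3_eq_cube)
        qed
        also have "\<dots> \<le> s * (e\<^sub>1 / 2)" using elim(4) s0 unfolding A_def by (intro mult_left_mono) auto
        finally have 1: "exp (2 / \<delta>) * c\<^sub>1^2 * s^2 * (A powr (1 - \<sigma>) * (C\<^sub>2 * n)) / M \<le> s * (e\<^sub>1 / 2)" .
        have "\<xi> * c\<^sub>1 \<le> (e\<^sub>1 * \<delta> / 4) * (2 / \<delta>)" using \<xi> c1 e1 \<delta> by (intro mult_mono) auto
        then have "\<xi> * c\<^sub>1 \<le> e\<^sub>1 / 2" using \<delta> by simp
        then have "s * (\<xi> * c\<^sub>1) \<le> s * (e\<^sub>1 / 2)" using s0 by (intro mult_left_mono) auto
        with 1 have "exp (2 / \<delta>) * c\<^sub>1^2 * s^2 * (A powr (1 - \<sigma>) * (C\<^sub>2 * n)) / M + s * (\<xi> * c\<^sub>1)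
          \<le> s * (e\<^sub>1 / 2) + s * (e\<^sub>1 / 2)" by (rule add_mono)
        then show "exp (2 / \<delta>) * c\<^sub>1^2 * s^2 * (A powr (1 - \<sigma>) * (C\<^sub>2 * n)) / M + s * \<xi> * c\<^sub>1 \<le> s * e\<^sub>1"
          by (simp only: mult.assoc)
      qed (use e1 in auto)
      \<comment> \<open>\<open>C\<^sub>5\<close> is chosen so that the bound on the degree sum of
        \<open>F\<close> equals \<open>z * (\<delta> * n / 2) * \<delta> / 4\<close>, the share that
        \<open>hit_supersolution\<close> grants to \<open>B\<close> when \<open>M\<close> is at its
        lower bound.\<close>
      define z where "z = C\<^sub>5 * t * A / n"
      have z0: "z > 0" using C5 t1 A1 n1 by (simp add: z_def)
      have zD: "z * D u \<le> 1" if "u \<in> V" for u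
      proof -
        have "z * D u \<le> z * (C\<^sub>1 * A)" using D\<Delta>[OF that] \<Delta> z0 by (intro mult_left_mono) auto
        also have "\<dots> = C\<^sub>5 * C\<^sub>1 * (A^2 * t) / n" by (simp add: z_def power2_eq_square)
        also have "\<dots> \<le> C\<^sub>5 * C\<^sub>1 * (x * n) / n"
          using A2t C5 C1 by (intro divide_right_mono mult_left_mono) auto
        also have "\<dots> \<le> 1" using elim(7) n1 by (simp add: x_def)
        finally show ?thesis .
      qed
      have fp2: "1 + (\<Sum>u\<in>V. D u * ((if u \<in> F then 2 else 1) * (if u \<in> F then 1 else (1 + z) ^ (D u - 1)) - 1)) / M \<le> 1 + z"
      proof (rule hit_supersolution[OF finV FV _ M0 _ less_imp_le[OF \<xi>(1)] \<xi>'(1) \<delta> z0 zD])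
        show "(\<Sum>u\<in>V. real (D u) * (real (D u) - 1)) \<le> (1 - \<delta>) * (\<Sum>u\<in>V. real (D u))"
          using crit by (simp add: S_def m_def)
        show "(\<Sum>u\<in>V. real (D u)) \<le> (1 + \<xi>) * M" using mM by (simp add: m_def)
        have B1: "(C\<^sub>1 + 1) * A \<ge> 1" using mult_mono[of 1 "C\<^sub>1 + 1" 1 A] C1 A1 by simp
        have "(\<Sum>u\<in>V. real (D u) ^ 3) \<le> ((C\<^sub>1 + 1) * A) powr (1 - \<sigma>) * (\<Sum>u\<in>V. real (D u) powr (2 + \<sigma>))"
        proof (rule sum_cube_le[OF \<sigma>(2)])
          fix u assume "u \<in> V"
          then show "real (D u) \<le> (C\<^sub>1 + 1) * A" using D\<Delta>[of u] \<Delta> A1 by (simp add: algebra_simps)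
        qed
        also have "\<dots> \<le> ((C\<^sub>1 + 1) * A) powr 1 * (C\<^sub>2 * n)"
          using pow B1 \<sigma> by (intro mult_mono powr_mono sum_nonneg) auto
        also have "\<dots> = (C\<^sub>1 + 1) * A * (C\<^sub>2 * n)" using B1 by simp
        finally show "(\<Sum>u\<in>V. real (D u) ^ 3) \<le> (C\<^sub>1 + 1) * A * (C\<^sub>2 * n)" .
        have "3 * z * ((C\<^sub>1 + 1) * A * (C\<^sub>2 * n)) = 3 * C\<^sub>5 * (C\<^sub>1 + 1) * C\<^sub>2 * (A^2 * t)"
          using n1 by (simp add: z_def power2_eq_square)
        also have "\<dots> \<le> 3 * C\<^sub>5 * (C\<^sub>1 + 1) * C\<^sub>2 * (x * n)"
          using A2t C5 C1 C2 by (intro mult_left_mono) auto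
        also have "\<dots> = (24 * C\<^sub>5 * (C\<^sub>1 + 1) * C\<^sub>2 * x) * (n / 8)" by simp
        also have "\<dots> \<le> \<delta>^2 * (n / 8)" using elim(8) unfolding x_def by (intro mult_right_mono) auto
        also have "\<dots> = (\<delta> * n / 2) * \<delta> / 4" by (simp add: power2_eq_square)
        also have "\<dots> \<le> M * \<delta> / 4" using M2 \<delta> by (intro divide_right_mono mult_right_mono) auto
        finally show "3 * z * ((C\<^sub>1 + 1) * A * (C\<^sub>2 * n)) \<le> M * \<delta> / 4" .
        have "(\<Sum>u\<in>F. real (D u)) \<le> (\<Sum>u\<in>F. C\<^sub>1 * A)"
        proof (rule sum_mono)
          fix u assume "u \<in> F"
          then have "u \<in> V" using FV by auto
          then show "real (D u) \<le> C\<^sub>1 * A" using D\<Delta>[of u] \<Delta> by linarith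
        qed
        also have "\<dots> = card F * (C\<^sub>1 * A)" by simp
        also have "\<dots> \<le> K\<^sub>0 * t * (C\<^sub>1 * A)" using cF C1 A1 by (intro mult_right_mono) auto
        finally show "(\<Sum>u\<in>F. real (D u)) \<le> K\<^sub>0 * t * (C\<^sub>1 * A)" .
        have "K\<^sub>0 * t * (C\<^sub>1 * A) = z * (\<delta> * n / 2) * \<delta> / 4"
          using n1 \<delta> by (simp add: z_def C\<^sub>5_def field_simps power2_eq_square)
        also have "\<dots> \<le> z * M * \<delta> / 4"
          using M2 \<delta> z0 by (intro divide_right_mono mult_right_mono mult_left_mono) auto
        finally show "K\<^sub>0 * t * (C\<^sub>1 * A) \<le> z * M * \<delta> / 4" .
      qed
      have b_le: "card V * exp (- s * \<theta>) + (\<Sum>v\<in>F. (1 + z) ^ D v - 1) \<le> b n"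
      proof -
        have "s * \<theta> = e\<^sub>2 * (A powr (\<tau> - 1) * A powr 1)" using A1 by (simp add: s_def \<theta>_def)
        also have "\<dots> = e\<^sub>2 * A powr \<tau>" by (simp only: powr_add[symmetric]) simp
        finally have 1: "s * \<theta> = e\<^sub>2 * A powr \<tau>" .
        have "(\<Sum>v\<in>F. (1 + z) ^ D v - 1) \<le> (\<Sum>v\<in>F. 4 * z * (C\<^sub>1 * A))"
        proof (rule sum_mono)
          fix v assume "v \<in> F"
          then have v: "v \<in> V" using FV by auto
          define w where "w = z * D v"
          have w: "0 \<le> w" "w \<le> 1" using z0 zD[OF v] by (auto simp: w_def)
          have "(1 + z) ^ D v - 1 \<le> exp w - 1"
            unfolding w_def using z0 by (intro diff_right_mono one_plus_power_le_exp) auto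
          also have "\<dots> \<le> w + w^2 * exp w" using exp_le_quadratic[OF w(1)] .
          also have "w^2 * exp w \<le> w * 3"
          proof (intro mult_mono)
            have "exp w \<le> exp 1" using w by simp
            also have "\<dots> \<le> 3" by (rule exp_le)
            finally show "exp w \<le> 3" .
            show "w^2 \<le> w" using w by (simp add: power2_eq_square mult_left_le)
          qed (use w in auto)
          also have "w + w * 3 = 4 * z * D v" by (simp add: w_def)
          also have "\<dots> \<le> 4 * z * (C\<^sub>1 * A)" using D\<Delta>[OF v] \<Delta> z0 by (intro mult_left_mono) auto
          finally show "(1 + z) ^ D v - 1 \<le> 4 * z * (C\<^sub>1 * A)" by simp
        qed
        also have "\<dots> = card F * (4 * z * (C\<^sub>1 * A))" by simp
        also have "\<dots> \<le> K\<^sub>0 * t * (4 * z * (C\<^sub>1 * A))"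
          using cF z0 C1 A1 by (intro mult_right_mono) auto
        also have "\<dots> = 4 * K\<^sub>0 * C\<^sub>5 * C\<^sub>1 * (A^2 * t * t) / n" by (simp add: z_def power2_eq_square)
        also have "\<dots> = 4 * K\<^sub>0 * C\<^sub>5 * C\<^sub>1 * x" unfolding A2tt using n1 by simp
        finally show ?thesis using 1 cV by (simp add: b_def A_def x_def)
      qed
      have b0: "0 \<le> b n" unfolding b_def X_def using K0 C5 C1 by simp
      define P where "P = 1 + c * real K"
      have P: "1 \<le> P" "P \<le> P\<^sub>1" using c mult_right_mono[OF c(3), of "real K"] by (auto simp: P_def P\<^sub>1_def)
      define \<zeta> where "\<zeta> = real N * D v\<^sub>0 / M"
      have \<zeta>: "0 \<le> \<zeta>" "\<zeta> \<le> C\<^sub>3 * C\<^sub>1 * 2 / \<delta> * x"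
      proof -
        show "0 \<le> \<zeta>" using M0 by (simp add: \<zeta>_def)
        have "\<zeta> \<le> C\<^sub>3 * C\<^sub>1 * A^2 / M"
          unfolding \<zeta>_def using N\<Delta> M0 by (intro divide_right_mono) (auto simp: \<Delta>_def)
        also have "\<dots> \<le> C\<^sub>3 * C\<^sub>1 * (x * n) / M"
          using A2 C3 C1 M0 by (intro divide_right_mono mult_left_mono) auto
        also have "\<dots> = C\<^sub>3 * C\<^sub>1 * x * (n / M)" by simp
        also have "\<dots> \<le> C\<^sub>3 * C\<^sub>1 * x * (2 / \<delta>)"
          using nM C3 C1 by (intro mult_left_mono) (auto simp: x_def X_def)
        also have "\<dots> = C\<^sub>3 * C\<^sub>1 * 2 / \<delta> * x" by simp
        finally show "\<zeta> \<le> C\<^sub>3 * C\<^sub>1 * 2 / \<delta> * x" .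
      qed
      have cc: "c \<le> (1 - real N * D v\<^sub>0 / M - (\<Sum>u\<in>V. real (D u)) / M) * P
        + ((\<Sum>u\<in>V. D u * (1 + c * real (min (D u - 1) K))) - real (N + N) * D v\<^sub>0 * P) / M - c * (real N * D v\<^sub>0 / M)"
        unfolding \<zeta>_def[symmetric] P_def
      proof (rule potential_drift[OF finV _ M0 _ _ less_imp_le[OF \<xi>(1)] \<xi>'(2) \<nu>(1) c(2,1)])
        show "(\<Sum>u\<in>V. real (D u) * (real (D u) - 1)) = \<nu> * (\<Sum>u\<in>V. real (D u))"
          using \<nu>(3) by (simp add: S_def m_def)
        show "(\<Sum>u\<in>V. real (D u)) \<le> (1 + \<xi>) * M" "M \<le> (\<Sum>u\<in>V. real (D u))" using mM Mm by (simp_all add: m_def)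
        have "(\<Sum>u\<in>{u\<in>V. D u > K}. real (D u)^2) \<le> real K powr (- \<sigma>) * (\<Sum>u\<in>V. real (D u) powr (2 + \<sigma>))"
          using finV \<sigma> K by (intro sum_square_tail_le) auto
        also have "\<dots> \<le> real K powr (- \<sigma>) * (C\<^sub>2 * (m / \<delta>))"
          using mean \<delta> C2 by (intro mult_left_mono order.trans[OF pow]) (auto simp: field_simps)
        also have "\<dots> = real K powr (- \<sigma>) * C\<^sub>2 / \<delta> * m" by simp
        finally show "(\<Sum>u\<in>{u\<in>V. D u > K}. real (D u)^2) \<le> real K powr (- \<sigma>) * C\<^sub>2 / \<delta> * (\<Sum>u\<in>V. real (D u))"
          by (simp add: m_def)
        show "0 \<le> real K powr (- \<sigma>) * C\<^sub>2 / \<delta>" using C2 \<delta> by simp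
        show "real (N + N) * real (D v\<^sub>0) * (1 + c * real K) / M = 2 * \<zeta> * (1 + c * real K)"
          by (simp add: \<zeta>_def)
        have 1: "\<xi> * P \<le> e\<^sub>1 / 4"
        proof -
          have "\<xi> * P \<le> e\<^sub>1 / (4 * P\<^sub>1) * P\<^sub>1" using \<xi> P e1 P1 by (intro mult_mono) auto
          then show ?thesis using P1 by simp
        qed
        have 2: "2 * c * (real K powr (- \<sigma>) * C\<^sub>2 / \<delta>) \<le> e\<^sub>1 / 4"
        proof -
          have "2 * c * (real K powr (- \<sigma>) * C\<^sub>2 / \<delta>) \<le> 2 * (1 / \<delta>) * (real K powr (- \<sigma>) * C\<^sub>2 / \<delta>)"
            using c C2 \<delta> by (intro mult_right_mono mult_left_mono) auto
          also have "\<dots> = 2 / \<delta> * (C\<^sub>2 / \<delta>) * real K powr (- \<sigma>)" by simp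
          finally show ?thesis using K(2) by linarith
        qed
        have 3: "\<zeta> * (3 * P + c) \<le> e\<^sub>1 / 4"
        proof -
          have "\<zeta> * (3 * P + c) \<le> (C\<^sub>3 * C\<^sub>1 * 2 / \<delta> * x) * (3 * P\<^sub>1 + 1 / \<delta>)"
            using \<zeta> P c by (intro mult_mono add_mono mult_left_mono) auto
          also have "\<dots> = C\<^sub>3 * C\<^sub>1 * 2 / \<delta> * (3 * P\<^sub>1 + 1 / \<delta>) * x" by (simp only: mult_ac)
          finally show ?thesis using elim(9) by (simp add: x_def)
        qed
        show "\<xi> * (1 + c * real K) + 2 * c * (real K powr (- \<sigma>) * C\<^sub>2 / \<delta>) + \<zeta> * (3 * (1 + c * real K) + c) \<le> e\<^sub>1"
          using 1 2 3 e1 unfolding P_def by linarith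
      qed
      have \<kappa>: "\<eta> * A > 0" using \<eta> A1 by simp
      have conc: "card {E \<in> graphs V D. \<not> ((\<forall>v\<in>V. card (reach E {v}) < c\<^sub>1 * D v\<^sub>0 + \<theta> + 1) \<and>
             c\<^sub>1 * D v\<^sub>0 + \<theta> + 1 - \<eta> * A \<le> card (reach E {v\<^sub>0}))}
        \<le> card (graphs V D) * (b n + ((c\<^sub>1 - c) * D v\<^sub>0 + \<theta> + b n * (N + (N + D v\<^sub>0) * P)) / (\<eta> * A))"
        unfolding P_def
      proof (rule component_concentration[OF finV FV v0(1) max s0 _ _ _ _ M0 fp1 fp2 _ \<theta>(1) N_ok c(2) cc[unfolded P_def] b_le \<kappa>])
        show "0 \<le> c\<^sub>1" using c1 by simp
        show "1 \<le> 1 + c\<^sub>1 * s" using c1 s0 by simp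
        show "1 + c\<^sub>1 * s \<le> exp (s * c\<^sub>1)" using exp_ge_add_one_self[of "s * c\<^sub>1"] by (simp add: mult.commute)
        show "1 \<le> 1 + z" using z0 by simp
        show "M + (2 * (real (D v\<^sub>0))\<^sup>2 + 4 * real (D v\<^sub>0)) + 2 * real (D v\<^sub>0) * real N \<le> (\<Sum>u\<in>V. real (D u))"
          by (simp add: M_def R_def m_def \<Delta>_def)
      qed
      have prob: "b n + ((c\<^sub>1 - c) * D v\<^sub>0 + \<theta> + b n * (N + (N + D v\<^sub>0) * P)) / (\<eta> * A) \<le> \<epsilon>"
      proof -
        have 1: "(c\<^sub>1 - c) * D v\<^sub>0 = 2 * (e\<^sub>1 * r)"
          using c1\<Delta> c\<Delta> by (simp add: \<Delta>_def left_diff_distrib)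
        have 2: "N + (N + D v\<^sub>0) * P \<le> C\<^sub>6 * A"
        proof -
          have "(N + D v\<^sub>0) * P \<le> (C\<^sub>3 * A + C\<^sub>1 * A) * P\<^sub>1"
            using N_upper \<Delta> P by (intro mult_mono) (auto simp: \<Delta>_def)
          then show ?thesis using N_upper by (simp add: C\<^sub>6_def algebra_simps)
        qed
        have "(c\<^sub>1 - c) * D v\<^sub>0 + \<theta> + b n * (N + (N + D v\<^sub>0) * P)
          \<le> 2 * (\<eta> * \<epsilon>' / 8 * A) + \<eta> * \<epsilon>' / 4 * A + b n * (C\<^sub>6 * A)"
          unfolding 1 using e1r 2 b0 by (intro add_mono mult_left_mono) (auto simp: \<theta>_def e\<^sub>2_def)
        also have "\<dots> = (\<eta> * A) * (\<epsilon>' / 2 + b n * C\<^sub>6 / \<eta>)"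
          using \<eta> by (simp add: field_simps)
        finally have "((c\<^sub>1 - c) * D v\<^sub>0 + \<theta> + b n * (N + (N + D v\<^sub>0) * P)) / (\<eta> * A) \<le> \<epsilon>' / 2 + b n * C\<^sub>6 / \<eta>"
          using \<kappa> by (simp add: divide_le_eq mult.commute)
        moreover have "b n * (1 + C\<^sub>6 / \<eta>) = b n + b n * C\<^sub>6 / \<eta>" by (simp add: algebra_simps)
        ultimately show ?thesis using elim(5) \<epsilon>' by linarith
      qed
      have U: "r \<le> c\<^sub>1 * D v\<^sub>0 + \<theta> + 1" "c\<^sub>1 * D v\<^sub>0 + \<theta> + 1 \<le> r + \<eta> * A"
      proof -
        have eq: "c\<^sub>1 * D v\<^sub>0 = r + e\<^sub>1 * r" using c1\<Delta> by (simp add: \<Delta>_def)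
        show "r \<le> c\<^sub>1 * D v\<^sub>0 + \<theta> + 1" unfolding eq using e1 r \<theta> by simp
        have "\<eta> * \<epsilon>' / 8 * A \<le> \<eta> / 8 * A"
          using \<epsilon>' \<eta> A1 mult_left_mono[of \<epsilon>' 1 \<eta>] by (intro mult_right_mono) auto
        moreover have "\<eta> / 8 * A + \<eta> / 4 * A + \<eta> / 2 * A = 7 / 8 * (\<eta> * A)" by simp
        then have "\<eta> / 8 * A + \<eta> / 4 * A + \<eta> / 2 * A \<le> \<eta> * A" using \<kappa> by linarith
        ultimately show "c\<^sub>1 * D v\<^sub>0 + \<theta> + 1 \<le> r + \<eta> * A"
          unfolding eq using e1r \<theta> A\<eta> by linarith
      qed
      have sub: "{E \<in> graphs V D. \<not> ((\<forall>v\<in>V. card (reach E {v}) \<le> r + \<eta> * A) \<and> (\<exists>v\<in>V. r - \<eta> * A \<le> card (reach E {v})))}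
         \<subseteq> {E \<in> graphs V D. \<not> ((\<forall>v\<in>V. card (reach E {v}) < c\<^sub>1 * D v\<^sub>0 + \<theta> + 1) \<and>
             c\<^sub>1 * D v\<^sub>0 + \<theta> + 1 - \<eta> * A \<le> card (reach E {v\<^sub>0}))}"
      proof -
        have "\<not> ((\<forall>v\<in>V. card (reach E {v}) < c\<^sub>1 * D v\<^sub>0 + \<theta> + 1) \<and>
             c\<^sub>1 * D v\<^sub>0 + \<theta> + 1 - \<eta> * A \<le> card (reach E {v\<^sub>0}))"
          if *: "\<not> ((\<forall>v\<in>V. card (reach E {v}) \<le> r + \<eta> * A) \<and> (\<exists>v\<in>V. r - \<eta> * A \<le> card (reach E {v})))" for E
        proof (rule notI)
          assume h: "(\<forall>v\<in>V. card (reach E {v}) < c\<^sub>1 * D v\<^sub>0 + \<theta> + 1) \<and>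
             c\<^sub>1 * D v\<^sub>0 + \<theta> + 1 - \<eta> * A \<le> card (reach E {v\<^sub>0})"
          have "\<forall>v\<in>V. card (reach E {v}) \<le> r + \<eta> * A" using h U(2) by force
          moreover have "r - \<eta> * A \<le> card (reach E {v\<^sub>0})" using h U(1) by linarith
          ultimately show False using * v0(1) by blast
        qed
        then show ?thesis by blast
      qed
      have "real (card {E \<in> graphs V D. \<not> ((\<forall>v\<in>V. card (reach E {v}) \<le> r + \<eta> * A) \<and> (\<exists>v\<in>V. r - \<eta> * A \<le> card (reach E {v})))})
        \<le> real (card {E \<in> graphs V D. \<not> ((\<forall>v\<in>V. card (reach E {v}) < c\<^sub>1 * D v\<^sub>0 + \<theta> + 1) \<and>
             c\<^sub>1 * D v\<^sub>0 + \<theta> + 1 - \<eta> * A \<le> card (reach E {v\<^sub>0}))})"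
        using sub finite_graphs[OF finV] by (simp add: card_mono)
      also have "\<dots> \<le> card (graphs V D) * \<epsilon>"
        using prob by (intro order.trans[OF conc] mult_left_mono) auto
      finally show "let r = real (Max (D ` {1..n})) / (1 - (\<Sum>i=1..n. real (D i) * (real (D i) - 1)) / (\<Sum>i=1..n. real (D i)));
         a = real n powr (1 / (\<gamma> - 1)) in
        card {E \<in> graphs {1..n} D. \<not> ((\<forall>v\<in>{1..n}. card (reach E {v}) \<le> r + \<eta> * a) \<and>
         (\<exists>v\<in>{1..n}. r - \<eta> * a \<le> card (reach E {v})))} \<le> \<epsilon> * card (graphs {1..n} D)"
        unfolding Let_def r_def \<Delta>_def v0 \<nu>_def S_def m_def A_def a_def \<beta>_def V_def
        by (simp add: mult.commute)
    qed
  qed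
qed

section \<open>The random graph\<close>

lemma simple_graphs_same_degrees:
  "{H' \<in> simple_graphs n. deg_seq n H' = deg_seq n H} = graphs {1..n} (vdeg H)"
proof -
  have "deg_seq n H' = deg_seq n H \<longleftrightarrow> (\<forall>i\<in>{1..n}. vdeg H' i = vdeg H i)" for H'
    by (simp only: deg_seq_def map_eq_conv set_upt atLeastLessThanSuc_atLeastAtMost)
  then show ?thesis by (auto simp: simple_graphs_def graphs_def)
qed

lemma graph_components_eq_reach:
  assumes "E \<in> simple_graphs n"
  shows "graph_components n E = (\<lambda>v. reach E {v}) ` {1..n}"
proof -
  have E: "E \<subseteq> {e. e \<subseteq> {1..n} \<and> card e = 2}" using assms by (simp add: simple_graphs_def)
  have "connectedness n E `` {v} = reach E {v}" if "v \<in> {1..n}" for v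
    using that reach_subset[OF E, of "{v}"] by (auto simp: connectedness_def reach_def)
  then show ?thesis unfolding graph_components_def quotient_def by auto
qed

text \<open>Total probability over the degree sequences: graphs with equal degrees are equally
  likely, so a set that fills at most a fraction \<open>\<epsilon>\<close> of every class it meets
  has probability at most \<open>\<epsilon>\<close>.\<close>

lemma prob_uniform_given_degrees_le:
  fixes \<epsilon> :: real
  assumes M: "prob_space M" and G: "G \<in> measurable M (count_space (simple_graphs n))"
    and unif: "uniform_given_degrees n M G" and B: "B \<subseteq> simple_graphs n" and \<epsilon>: "\<epsilon> \<ge> 0"
    and le: "\<And>H. H \<in> B \<Longrightarrow> card {H' \<in> B. deg_seq n H' = deg_seq n H}
        \<le> \<epsilon> * card {H' \<in> simple_graphs n. deg_seq n H' = deg_seq n H}"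
  shows "measure M {\<omega> \<in> space M. G \<omega> \<in> B} \<le> \<epsilon>"
proof -
  define SG where "SG = simple_graphs n"
  define N where "N = distr M (count_space SG) G"
  define cls where "cls d = {H \<in> SG. deg_seq n H = d}" for d
  interpret M: prob_space M by fact
  have G': "G \<in> measurable M (count_space SG)" using G by (simp add: SG_def)
  interpret N: prob_space N unfolding N_def using G' by (rule M.prob_space_distr)
  have GS: "G \<omega> \<in> SG" if "\<omega> \<in> space M" for \<omega> using measurable_space[OF G' that] by simp
  have finSG: "finite SG" unfolding SG_def simple_graphs_def by (rule finite_subset[of _ "Pow (Pow {1..n})"]) auto
  have meas: "measure N X = measure M {\<omega> \<in> space M. G \<omega> \<in> X}" if "X \<subseteq> SG" for X
  proof -
    have "measure N X = measure M (G -` X \<inter> space M)"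
      unfolding N_def using that G' by (intro measure_distr) auto
    also have "G -` X \<inter> space M = {\<omega> \<in> space M. G \<omega> \<in> X}" by auto
    finally show ?thesis .
  qed
  have sums: "measure N X = (\<Sum>H\<in>X. measure N {H})" if "X \<subseteq> SG" for X
    using that finite_subset[OF that finSG]
    by (intro N.finite_measure_eq_sum_singleton) (auto simp: N_def)
  have finB: "finite B" using finite_subset[OF B] finSG by (simp add: SG_def)
  \<comment> \<open>Conditional uniformity speaks only about classes of positive probability; in a
    null class each single graph is null as well.\<close>
  have pH: "measure N {H} \<le> measure N (cls (deg_seq n H)) / card (cls (deg_seq n H))" if H: "H \<in> SG" for H
  proof (cases "measure N (cls (deg_seq n H)) > 0")
    case False
    have "measure N {H} \<le> measure N (cls (deg_seq n H))"
      using H by (intro N.finite_measure_mono) (auto simp: cls_def N_def)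
    then have "measure N {H} = 0" using False measure_nonneg[of N "{H}"] by linarith
    then show ?thesis by simp
  next
    case True
    define d where "d = deg_seq n H"
    have eq1: "{\<omega> \<in> space M. deg_seq n (G \<omega>) = d} = {\<omega> \<in> space M. G \<omega> \<in> cls d}"
      using GS by (auto simp: cls_def)
    have eq2: "{\<omega> \<in> space M. G \<omega> = H \<and> deg_seq n (G \<omega>) = d} = {\<omega> \<in> space M. G \<omega> \<in> {H}}"
      by (auto simp: d_def)
    have sub: "cls d \<subseteq> SG" by (auto simp: cls_def)
    have m1: "measure M {\<omega> \<in> space M. deg_seq n (G \<omega>) = d} = measure N (cls d)"
      unfolding eq1 meas[OF sub] ..
    have m2: "measure M {\<omega> \<in> space M. G \<omega> = H \<and> deg_seq n (G \<omega>) = d} = measure N {H}"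
      unfolding eq2 using H by (subst meas) auto
    have pos: "measure N (cls d) > 0" using True unfolding d_def .
    have "0 < \<P>(\<omega> in M. deg_seq n (G \<omega>) = d)" unfolding m1 by (rule pos)
    moreover have "H \<in> simple_graphs n" "deg_seq n H = d" using H by (simp_all add: SG_def d_def)
    ultimately have "\<P>(\<omega> in M. G \<omega> = H \<bar> deg_seq n (G \<omega>) = d) = 1 / real (card (cls d))"
      using unif unfolding uniform_given_degrees_def cls_def SG_def by blast
    then have "measure N {H} / measure N (cls d) = 1 / real (card (cls d))"
      unfolding cond_prob_def m1 m2 .
    then have "measure N {H} = measure N (cls d) / card (cls d)"
      using pos by (simp add: divide_eq_eq)
    then show ?thesis unfolding d_def by simp
  qed
  have "measure M {\<omega> \<in> space M. G \<omega> \<in> B} = (\<Sum>H\<in>B. measure N {H})"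
    using meas[of B] sums[of B] B by (simp add: SG_def)
  also have "\<dots> \<le> (\<Sum>H\<in>B. measure N (cls (deg_seq n H)) / card (cls (deg_seq n H)))"
    using B by (intro sum_mono pH) (auto simp: SG_def)
  also have "\<dots> = (\<Sum>d\<in>deg_seq n ` SG. \<Sum>H | H \<in> B \<and> deg_seq n H = d. measure N (cls (deg_seq n H)) / card (cls (deg_seq n H)))"
    using B finB finSG by (intro sum.group[symmetric]) (auto simp: SG_def)
  also have "\<dots> \<le> (\<Sum>d\<in>deg_seq n ` SG. \<epsilon> * measure N (cls d))"
  proof (rule sum_mono)
    fix d
    have "(\<Sum>H | H \<in> B \<and> deg_seq n H = d. measure N (cls (deg_seq n H)) / card (cls (deg_seq n H)))
      = (\<Sum>H | H \<in> B \<and> deg_seq n H = d. measure N (cls d) / card (cls d))"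
      by (intro sum.cong) auto
    also have "\<dots> = card {H \<in> B. deg_seq n H = d} / card (cls d) * measure N (cls d)" by simp
    also have "\<dots> \<le> \<epsilon> * measure N (cls d)"
    proof (rule mult_right_mono)
      show "card {H \<in> B. deg_seq n H = d} / card (cls d) \<le> \<epsilon>"
      proof (cases "{H \<in> B. deg_seq n H = d} = {}")
        case True
        then show ?thesis unfolding True using \<epsilon> by simp
      next
        case False
        then obtain H where H: "H \<in> B" "deg_seq n H = d" by auto
        then have "H \<in> cls d" using B by (auto simp: cls_def SG_def)
        moreover have "finite (cls d)" using finSG by (simp add: cls_def)
        ultimately have "card (cls d) > 0" by (auto simp: card_gt_0_iff)
        then show ?thesis using le[OF H(1)] H(2) by (simp add: cls_def SG_def field_simps)
      qed
    qed simp
    finally show "(\<Sum>H | H \<in> B \<and> deg_seq n H = d. measure N (cls (deg_seq n H)) / card (cls (deg_seq n H)))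
      \<le> \<epsilon> * measure N (cls d)" .
  qed
  also have "\<dots> = \<epsilon> * (\<Sum>d\<in>deg_seq n ` SG. \<Sum>H | H \<in> SG \<and> deg_seq n H = d. measure N {H})"
    unfolding sum_distrib_left[symmetric]
  proof (intro arg_cong[of _ _ "\<lambda>x. \<epsilon> * x"] sum.cong[OF refl])
    fix d
    show "measure N (cls d) = (\<Sum>H | H \<in> SG \<and> deg_seq n H = d. measure N {H})"
      using sums[of "cls d"] by (simp add: cls_def)
  qed
  also have "(\<Sum>d\<in>deg_seq n ` SG. \<Sum>H | H \<in> SG \<and> deg_seq n H = d. measure N {H}) = (\<Sum>H\<in>SG. measure N {H})"
    using finSG by (intro sum.group) auto
  also have "\<dots> = measure N SG" using sums[of SG] by simp
  also have "\<epsilon> * measure N SG \<le> \<epsilon> * 1" using \<epsilon> by (intro mult_left_mono) auto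
  finally show ?thesis by simp
qed

text \<open>No degree exceeds n, so the family is bounded above; only then is a member known to lie
  below the supremum in the reals.\<close>

lemma card_le_of_tail_sup_le:
  assumes H: "H \<in> simple_graphs n" and n: "n \<ge> 1" and \<gamma>: "\<gamma> > 1" and t: "tail_sup \<gamma> n H \<le> t" and k: "k \<ge> 1"
  shows "card {i\<in>{1..n}. k \<le> vdeg H i} \<le> t * real n * real k powr (1 - \<gamma>)"
proof -
  define f where "f k = real k powr (\<gamma> - 1) * real (card {i\<in>{1..n}. k \<le> vdeg H i}) / real n" for k :: nat
  have HG: "H \<in> graphs {1..n} (vdeg H)" using H by (auto simp: simple_graphs_def graphs_def)
  have vd: "vdeg H i \<le> n" if "i \<in> {1..n}" for i
  proof -
    have "card (nbrs H i) \<le> card {1..n}" using nbrs_subset[OF HG, of i] by (intro card_mono) auto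
    then show ?thesis by (simp add: vdeg_eq_card_nbrs)
  qed
  have "f k \<le> real n powr (\<gamma> - 1)" for k
  proof (cases "k \<le> n")
    case True
    have "card {i\<in>{1..n}. k \<le> vdeg H i} \<le> card {1..n}" by (intro card_mono) auto
    then have "f k \<le> real n powr (\<gamma> - 1) * real n / real n"
      unfolding f_def using True \<gamma> by (intro divide_right_mono mult_mono powr_mono2) auto
    then show ?thesis using n by simp
  next
    case False
    then have "{i\<in>{1..n}. k \<le> vdeg H i} = {}" using vd by fastforce
    then show ?thesis by (simp only: f_def card.empty) simp
  qed
  then have "bdd_above (f ` {1..})" by (intro bdd_aboveI[of _ "real n powr (\<gamma> - 1)"]) auto
  then have "f k \<le> (SUP k\<in>{1..}. f k)" using k by (intro cSUP_upper) auto
  also have "\<dots> \<le> t" using t by (simp add: tail_sup_def f_def)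
  finally have "f k * (real n * real k powr (1 - \<gamma>)) \<le> t * (real n * real k powr (1 - \<gamma>))"
    by (intro mult_right_mono) auto
  moreover have "f k * (real n * real k powr (1 - \<gamma>)) =
     real (card {i\<in>{1..n}. k \<le> vdeg H i}) * (real k powr (\<gamma> - 1) * real k powr (1 - \<gamma>))"
    using n by (simp add: f_def)
  moreover have "real k powr (\<gamma> - 1) * real k powr (1 - \<gamma>) = 1" using k by (simp add: powr_add[symmetric])
  ultimately show ?thesis by (simp add: mult.assoc)
qed

text \<open>\<open>B\<close> collects the good graphs on which the estimate fails. Being good
  depends on the degrees only, so a class of equal degrees either contributes nothing to
  \<open>B\<close> or is controlled by \<open>uniform_concentration\<close>. Ties and the value
  \<open>c\<close> do no harm: the upper estimate covers every component, and a good graph has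
  \<open>nu\<close> below 1.\<close>

lemma largest_component_close:
  fixes \<gamma> \<delta> \<epsilon> \<eta> :: real
  assumes \<gamma>: "\<gamma> > 3" and \<delta>: "0 < \<delta>" and \<epsilon>: "\<epsilon> > 0" and \<eta>: "\<eta> > 0"
  defines "good n H \<equiv> tail_sup \<gamma> n H \<le> inverse \<delta> \<and> \<delta> \<le> mean_deg n H \<and> nu n H \<le> 1 - \<delta>"
  shows "\<forall>\<^sub>F n in sequentially. \<exists>B \<subseteq> simple_graphs n.
    (\<forall>H\<in>B. card {H' \<in> B. deg_seq n H' = deg_seq n H} \<le> \<epsilon> * card {H' \<in> simple_graphs n. deg_seq n H' = deg_seq n H}) \<and>
    (\<forall>H\<in>simple_graphs n - B. good n H \<longrightarrow> (\<forall>C c. is_largest_component n H C \<longrightarrow>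
       \<bar>real (card C) - deg_ratio c n H\<bar> \<le> \<eta> * real n powr (1 / (\<gamma> - 1)) \<and>
       deg_ratio c n H \<le> inverse \<delta> powr (1 / (\<gamma> - 1)) / \<delta> * real n powr (1 / (\<gamma> - 1))))"
proof -
  \<comment> \<open>The concentration bound requires a parameter of at most 1; passing to a smaller
    one only weakens the three conditions on the degrees.\<close>
  define \<delta>' where "\<delta>' = min \<delta> 1"
  have \<delta>': "0 < \<delta>'" "\<delta>' \<le> 1" "\<delta>' \<le> \<delta>" using \<delta> by (auto simp: \<delta>'_def)
  show ?thesis
    using uniform_concentration[OF \<gamma> \<delta>'(1,2) \<epsilon> \<eta>] eventually_ge_at_top[of 1]
  proof eventually_elim
    case (elim n)
    note conc = elim(1) and n1 = elim(2)
    define a where "a = real n powr (1 / (\<gamma> - 1))"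
    define m where "m D = (\<Sum>i=1..n. real (D i))" for D :: "nat \<Rightarrow> nat"
    define S where "S D = (\<Sum>i=1..n. real (D i) * (real (D i) - 1))" for D :: "nat \<Rightarrow> nat"
    define r where "r D = real (Max (D ` {1..n})) / (1 - S D / m D)" for D
    define close where "close H D \<longleftrightarrow> (\<forall>v\<in>{1..n}. card (reach H {v}) \<le> r D + \<eta> * a) \<and>
         (\<exists>v\<in>{1..n}. r D - \<eta> * a \<le> card (reach H {v}))" for H D
    define B where "B = {H \<in> simple_graphs n. good n H \<and> \<not> close H (vdeg H)}"
    have good: "(\<forall>k\<ge>1. card {i\<in>{1..n}. k \<le> vdeg H i} \<le> inverse \<delta> * real n * real k powr (1 - \<gamma>)) \<and>
      \<delta> * real n \<le> m (vdeg H) \<and> nu n H = S (vdeg H) / m (vdeg H)"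
      if H: "H \<in> simple_graphs n" "good n H" for H
    proof (intro conjI allI impI)
      show "card {i\<in>{1..n}. k \<le> vdeg H i} \<le> inverse \<delta> * real n * real k powr (1 - \<gamma>)" if "k \<ge> 1" for k
        using H n1 \<gamma> that by (intro card_le_of_tail_sup_le) (auto simp: good_def)
      have mean: "mean_deg n H = m (vdeg H) / n" by (simp add: mean_deg_def m_def)
      have "\<delta> \<le> m (vdeg H) / n" using H mean by (simp add: good_def)
      then show "\<delta> * real n \<le> m (vdeg H)" using n1 by (simp add: pos_le_divide_eq)
      show "nu n H = S (vdeg H) / m (vdeg H)" using n1 by (simp add: nu_def mean S_def)
    qed
    have key: "card {E \<in> graphs {1..n} (vdeg H). \<not> close E (vdeg H)} \<le> \<epsilon> * card (graphs {1..n} (vdeg H))"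
      if H: "H \<in> simple_graphs n" "good n H" for H
    proof -
      have m_ge: "\<delta> * real n \<le> m (vdeg H)" and nu_eq: "nu n H = S (vdeg H) / m (vdeg H)"
        using good[OF H] by blast+
      have "0 < \<delta> * real n" using \<delta> n1 by simp
      then have m_pos: "m (vdeg H) > 0" using m_ge by (rule less_le_trans)
      have 1: "\<forall>k\<ge>1. card {i\<in>{1..n}. k \<le> vdeg H i} \<le> inverse \<delta>' * real n * real k powr (1 - \<gamma>)"
      proof (intro allI impI)
        fix k :: nat assume "k \<ge> 1"
        then have "card {i\<in>{1..n}. k \<le> vdeg H i} \<le> inverse \<delta> * real n * real k powr (1 - \<gamma>)"
          using good[OF H] by blast
        also have "\<dots> \<le> inverse \<delta>' * real n * real k powr (1 - \<gamma>)"
          using \<delta>' by (intro mult_right_mono le_imp_inverse_le) auto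
        finally show "card {i\<in>{1..n}. k \<le> vdeg H i} \<le> inverse \<delta>' * real n * real k powr (1 - \<gamma>)" .
      qed
      have 2: "\<delta>' * real n \<le> m (vdeg H)"
        using mult_right_mono[OF \<delta>'(3), of "real n"] m_ge by linarith
      have "S (vdeg H) / m (vdeg H) \<le> 1 - \<delta>" using H(2) unfolding good_def nu_eq by blast
      then have "S (vdeg H) \<le> (1 - \<delta>) * m (vdeg H)" using m_pos by (simp add: divide_le_eq)
      also have "\<dots> \<le> (1 - \<delta>') * m (vdeg H)" using m_pos \<delta>' by (intro mult_right_mono) auto
      finally have 3: "S (vdeg H) \<le> (1 - \<delta>') * m (vdeg H)" .
      show ?thesis
        using conc[THEN spec, of "vdeg H", THEN mp, THEN mp, THEN mp, OF 1 2[unfolded m_def] 3[unfolded S_def m_def]]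
        unfolding close_def r_def a_def S_def m_def by (simp only: Let_def)
    qed
    show ?case
    proof (intro exI[of _ B] conjI ballI impI allI)
      show "B \<subseteq> simple_graphs n" by (auto simp: B_def)
    next
      fix H assume H: "H \<in> B"
      have same: "close H' (vdeg H') = close H' (vdeg H)" if "H' \<in> graphs {1..n} (vdeg H)" for H'
      proof -
        have eq: "vdeg H' i = vdeg H i" if "i \<in> {1..n}" for i
          using that \<open>H' \<in> graphs {1..n} (vdeg H)\<close> by (simp add: graphs_def)
        then have "vdeg H' ` {1..n} = vdeg H ` {1..n}" by (intro image_cong) auto
        moreover have "S (vdeg H') = S (vdeg H)" "m (vdeg H') = m (vdeg H)"
          unfolding S_def m_def using eq by (auto intro!: sum.cong)
        ultimately show ?thesis by (simp add: close_def r_def)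
      qed
      have "{H' \<in> B. deg_seq n H' = deg_seq n H} \<subseteq> {E \<in> graphs {1..n} (vdeg H). \<not> close E (vdeg H)}"
        using simple_graphs_same_degrees[of n H] same by (auto simp: B_def)
      then have "card {H' \<in> B. deg_seq n H' = deg_seq n H} \<le> card {E \<in> graphs {1..n} (vdeg H). \<not> close E (vdeg H)}"
        by (intro card_mono) (auto simp: finite_graphs)
      also have "real \<dots> \<le> \<epsilon> * card (graphs {1..n} (vdeg H))" using H by (intro key) (auto simp: B_def)
      finally show "card {H' \<in> B. deg_seq n H' = deg_seq n H}
          \<le> \<epsilon> * card {H' \<in> simple_graphs n. deg_seq n H' = deg_seq n H}"
        unfolding simple_graphs_same_degrees by simp
    next
      fix H C c assume H: "H \<in> simple_graphs n - B" "good n H" and C: "is_largest_component n H C"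
      have HS: "H \<in> simple_graphs n" using H by simp
      have cl: "close H (vdeg H)" using H by (auto simp: B_def)
      have nu_eq: "nu n H = S (vdeg H) / m (vdeg H)" using good[OF HS H(2)] by blast
      have nu_le: "nu n H \<le> 1 - \<delta>" using H by (simp add: good_def)
      then have "nu n H \<noteq> 1" using \<delta> by linarith
      then have ratio: "deg_ratio c n H = r (vdeg H)"
        unfolding deg_ratio_def r_def max_deg_def nu_eq[symmetric] by simp
      obtain v where v: "v \<in> {1..n}" "C = reach H {v}"
        using C unfolding is_largest_component_def graph_components_eq_reach[OF HS] by auto
      obtain w where w: "w \<in> {1..n}" "r (vdeg H) - \<eta> * a \<le> card (reach H {w})"
        using cl by (auto simp: close_def)
      have "card (reach H {w}) \<le> card C"
        using C w(1) unfolding is_largest_component_def graph_components_eq_reach[OF HS] by auto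
      moreover have "card C \<le> r (vdeg H) + \<eta> * a" using cl v by (auto simp: close_def)
      ultimately show "\<bar>real (card C) - deg_ratio c n H\<bar> \<le> \<eta> * real n powr (1 / (\<gamma> - 1))"
        unfolding ratio a_def[symmetric] using w(2) by linarith
      have "real (Max (vdeg H ` {1..n})) \<le> (inverse \<delta> * real n) powr (1 / (\<gamma> - 1))"
      proof -
        have "Max (vdeg H ` {1..n}) \<in> vdeg H ` {1..n}" using n1 by (intro Max_in) auto
        then obtain u where u: "u \<in> {1..n}" "Max (vdeg H ` {1..n}) = vdeg H u" by (metis imageE)
        show ?thesis unfolding u(2)
          using good[OF HS H(2)] u(1) \<gamma> \<delta> by (intro max_degree_le[of "{1..n}"]) auto
      qed
      also have "\<dots> = inverse \<delta> powr (1 / (\<gamma> - 1)) * a" using \<delta> by (simp add: powr_mult a_def)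
      finally have "r (vdeg H) \<le> inverse \<delta> powr (1 / (\<gamma> - 1)) * a / \<delta>"
        unfolding r_def nu_eq[symmetric] using nu_le \<delta> by (intro frac_le) auto
      then show "deg_ratio c n H \<le> inverse \<delta> powr (1 / (\<gamma> - 1)) / \<delta> * real n powr (1 / (\<gamma> - 1))"
        unfolding ratio a_def by simp
    qed
  qed
qed

theorem theorem4p1:
  fixes \<gamma> :: real
    and M :: "nat \<Rightarrow> 'a measure"
    and G :: "nat \<Rightarrow> 'a \<Rightarrow> nat set set"
    and C1 :: "nat \<Rightarrow> 'a \<Rightarrow> nat set"
    and c :: "nat \<Rightarrow> nat set set \<Rightarrow> real"
  assumes "\<gamma> > 3"
    and "\<And>n. n \<ge> 1 \<Longrightarrow> prob_space (M n)"
    and "\<And>n. n \<ge> 1 \<Longrightarrow> G n \<in> measurable (M n) (count_space (simple_graphs n))"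
    and "\<And>n. n \<ge> 1 \<Longrightarrow> uniform_given_degrees n (M n) (G n)"
    and "\<And>\<epsilon>::real. \<epsilon> > 0 \<Longrightarrow> \<exists>\<delta>>0. \<forall>\<^sub>F n in sequentially.
           \<P>(\<omega> in M n. tail_sup \<gamma> n (G n \<omega>) > inverse \<delta>) < \<epsilon> \<and>
           \<P>(\<omega> in M n. mean_deg n (G n \<omega>) < \<delta>) < \<epsilon> \<and>
           \<P>(\<omega> in M n. nu n (G n \<omega>) > 1 - \<delta>) < \<epsilon>"
    and "\<And>n \<omega>. n \<ge> 1 \<Longrightarrow> \<omega> \<in> space (M n) \<Longrightarrow> is_largest_component n (G n \<omega>) (C1 n \<omega>)"
  shows "small_o_prob M (\<lambda>n \<omega>. real (card (C1 n \<omega>)) - deg_ratio (c n (G n \<omega>)) n (G n \<omega>))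
           (\<lambda>n. real n powr (1 / (\<gamma> - 1))) \<and>
         big_O_prob M (\<lambda>n \<omega>. real (card (C1 n \<omega>))) (\<lambda>n. real n powr (1 / (\<gamma> - 1)))"
proof -
  define a where "a n = real n powr (1 / (\<gamma> - 1))" for n :: nat
  define X where "X n \<omega> = real (card (C1 n \<omega>)) - deg_ratio (c n (G n \<omega>)) n (G n \<omega>)" for n \<omega>
  \<comment> \<open>\<open>C\<close> depends on \<open>\<epsilon>\<close> but not on
    \<open>\<eta>\<close>, so letting \<open>\<eta>\<close> vary gives the o_p statement and
    \<open>\<eta> = 1\<close> the O_p statement. The measurable exceptional event \<open>A\<close>
    is needed because \<open>C1\<close>, an arbitrary selection, may fail to be measurable: the
    events of interest are only shown to lie inside \<open>A\<close>.\<close>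
  have key: "\<exists>C. \<forall>\<eta>>0. \<forall>\<^sub>F n in sequentially. \<exists>A\<in>sets (M n). measure (M n) A < \<epsilon> \<and>
      (\<forall>\<omega>\<in>space (M n) - A. \<bar>X n \<omega>\<bar> \<le> \<eta> * a n \<and> real (card (C1 n \<omega>)) \<le> (C + \<eta>) * a n)"
    if \<epsilon>: "\<epsilon> > 0" for \<epsilon> :: real
  proof -
    \<comment> \<open>One quarter of \<open>\<epsilon>\<close> for each of the three degree
      conditions, and one for the exceptional set of graphs.\<close>
    obtain \<delta> where \<delta>: "\<delta> > 0" and ev: "\<forall>\<^sub>F n in sequentially.
           \<P>(\<omega> in M n. tail_sup \<gamma> n (G n \<omega>) > inverse \<delta>) < \<epsilon> / 4 \<and>
           \<P>(\<omega> in M n. mean_deg n (G n \<omega>) < \<delta>) < \<epsilon> / 4 \<and>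
           \<P>(\<omega> in M n. nu n (G n \<omega>) > 1 - \<delta>) < \<epsilon> / 4"
      using assms(5)[of "\<epsilon> / 4"] \<epsilon> by auto
    define C where "C = inverse \<delta> powr (1 / (\<gamma> - 1)) / \<delta>"
    have "\<forall>\<^sub>F n in sequentially. \<exists>A\<in>sets (M n). measure (M n) A < \<epsilon> \<and>
      (\<forall>\<omega>\<in>space (M n) - A. \<bar>X n \<omega>\<bar> \<le> \<eta> * a n \<and> real (card (C1 n \<omega>)) \<le> (C + \<eta>) * a n)"
      if \<eta>: "\<eta> > 0" for \<eta>
    proof -
      have \<epsilon>4: "\<epsilon> / 4 > 0" using \<epsilon> by simp
      show ?thesis
        using ev largest_component_close[OF assms(1) \<delta> \<epsilon>4 \<eta>] eventually_ge_at_top[of 1]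
      proof eventually_elim
        case (elim n)
        interpret prob_space "M n" using assms(2) elim(3) .
        obtain B where B: "B \<subseteq> simple_graphs n"
          "\<And>H. H \<in> B \<Longrightarrow> card {H' \<in> B. deg_seq n H' = deg_seq n H}
             \<le> \<epsilon> / 4 * card {H' \<in> simple_graphs n. deg_seq n H' = deg_seq n H}"
          "\<And>H C' c. H \<in> simple_graphs n - B \<Longrightarrow>
            tail_sup \<gamma> n H \<le> inverse \<delta> \<and> \<delta> \<le> mean_deg n H \<and> nu n H \<le> 1 - \<delta> \<Longrightarrow> is_largest_component n H C' \<Longrightarrow>
             \<bar>real (card C') - deg_ratio c n H\<bar> \<le> \<eta> * a n \<and> deg_ratio c n H \<le> C * a n"
          using elim(2) unfolding a_def C_def by blast
        note G = assms(3)[OF elim(3)]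
        have ms: "{\<omega> \<in> space (M n). Q (G n \<omega>)} \<in> sets (M n)" for Q
        proof -
          have "G n -` {H \<in> simple_graphs n. Q H} \<inter> space (M n) \<in> sets (M n)"
            by (rule measurable_sets[OF G]) auto
          also have "G n -` {H \<in> simple_graphs n. Q H} \<inter> space (M n) = {\<omega> \<in> space (M n). Q (G n \<omega>)}"
            using measurable_space[OF G] by auto
          finally show ?thesis .
        qed
        define A1 where "A1 = {\<omega> \<in> space (M n). tail_sup \<gamma> n (G n \<omega>) > inverse \<delta>}"
        define A2 where "A2 = {\<omega> \<in> space (M n). mean_deg n (G n \<omega>) < \<delta>}"
        define A3 where "A3 = {\<omega> \<in> space (M n). nu n (G n \<omega>) > 1 - \<delta>}"
        define A4 where "A4 = {\<omega> \<in> space (M n). G n \<omega> \<in> B}"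
        have A: "A1 \<in> events" "A2 \<in> events" "A3 \<in> events" "A4 \<in> events"
          unfolding A1_def A2_def A3_def A4_def by (rule ms)+
        have "prob A4 \<le> \<epsilon> / 4"
          unfolding A4_def using \<epsilon> B(1,2)
          by (intro prob_uniform_given_degrees_le[OF assms(2)[OF elim(3)] G assms(4)[OF elim(3)]]) auto
        moreover have "prob A1 < \<epsilon> / 4" "prob A2 < \<epsilon> / 4" "prob A3 < \<epsilon> / 4"
          using elim(1) by (simp_all add: A1_def A2_def A3_def)
        moreover have "prob (A1 \<union> A2 \<union> A3 \<union> A4) \<le> prob A1 + prob A2 + prob A3 + prob A4"
          using A by (intro order.trans[OF measure_Un_le] add_mono order.refl) auto
        ultimately have "prob (A1 \<union> A2 \<union> A3 \<union> A4) < \<epsilon>" by linarith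
        moreover have "\<bar>X n \<omega>\<bar> \<le> \<eta> * a n \<and> real (card (C1 n \<omega>)) \<le> (C + \<eta>) * a n"
          if \<omega>: "\<omega> \<in> space (M n) - (A1 \<union> A2 \<union> A3 \<union> A4)" for \<omega>
        proof -
          have "\<bar>real (card (C1 n \<omega>)) - deg_ratio (c n (G n \<omega>)) n (G n \<omega>)\<bar> \<le> \<eta> * a n \<and>
              deg_ratio (c n (G n \<omega>)) n (G n \<omega>) \<le> C * a n"
            using \<omega> measurable_space[OF G, of \<omega>] assms(6)[OF elim(3), of \<omega>]
            by (intro B(3)) (auto simp: A1_def A2_def A3_def A4_def)
          then show ?thesis unfolding X_def distrib_right by linarith
        qed
        ultimately show ?case using A by (intro bexI[of _ "A1 \<union> A2 \<union> A3 \<union> A4"]) auto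
      qed
    qed
    then show ?thesis by blast
  qed
  have "small_o_prob M X a"
    unfolding small_o_prob_def
  proof (intro allI impI tendstoI)
    fix \<eta> e :: real assume \<eta>: "\<eta> > 0" and e: "e > 0"
    obtain C where C: "\<forall>\<eta>>0. \<forall>\<^sub>F n in sequentially. \<exists>A\<in>sets (M n). measure (M n) A < e \<and>
      (\<forall>\<omega>\<in>space (M n) - A. \<bar>X n \<omega>\<bar> \<le> \<eta> * a n \<and> real (card (C1 n \<omega>)) \<le> (C + \<eta>) * a n)"
      using key[OF e] by blast
    show "\<forall>\<^sub>F n in sequentially. dist (\<P>(\<omega> in M n. \<eta> * a n < \<bar>X n \<omega>\<bar>)) 0 < e"
      using C[rule_format, OF \<eta>] eventually_ge_at_top[of 1]
    proof eventually_elim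
      case (elim n)
      interpret prob_space "M n" using assms(2) elim(2) .
      obtain A where A: "A \<in> events" "prob A < e"
        "\<forall>\<omega>\<in>space (M n) - A. \<bar>X n \<omega>\<bar> \<le> \<eta> * a n" using elim(1) by blast
      have "{\<omega> \<in> space (M n). \<eta> * a n < \<bar>X n \<omega>\<bar>} \<subseteq> A" using A(3) by force
      then have "prob {\<omega> \<in> space (M n). \<eta> * a n < \<bar>X n \<omega>\<bar>} \<le> prob A"
        using A(1) by (rule finite_measure_mono)
      then show ?case using A(2) by (simp add: dist_real_def)
    qed
  qed
  moreover have "big_O_prob M (\<lambda>n \<omega>. real (card (C1 n \<omega>))) a"
    unfolding big_O_prob_def
  proof (intro allI impI)
    fix e :: real assume e: "e > 0"
    obtain C where C: "\<forall>\<eta>>0. \<forall>\<^sub>F n in sequentially. \<exists>A\<in>sets (M n). measure (M n) A < e \<and>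
      (\<forall>\<omega>\<in>space (M n) - A. \<bar>X n \<omega>\<bar> \<le> \<eta> * a n \<and> real (card (C1 n \<omega>)) \<le> (C + \<eta>) * a n)"
      using key[OF e] by blast
    have "\<forall>\<^sub>F n in sequentially. \<P>(\<omega> in M n. (C + 1) * a n < \<bar>real (card (C1 n \<omega>))\<bar>) < e"
      using C[rule_format, OF zero_less_one] eventually_ge_at_top[of 1]
    proof eventually_elim
      case (elim n)
      interpret prob_space "M n" using assms(2) elim(2) .
      obtain A where A: "A \<in> events" "prob A < e"
        "\<forall>\<omega>\<in>space (M n) - A. real (card (C1 n \<omega>)) \<le> (C + 1) * a n" using elim(1) by blast
      have "{\<omega> \<in> space (M n). (C + 1) * a n < \<bar>real (card (C1 n \<omega>))\<bar>} \<subseteq> A" using A(3) by force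
      then have "prob {\<omega> \<in> space (M n). (C + 1) * a n < \<bar>real (card (C1 n \<omega>))\<bar>} \<le> prob A"
        using A(1) by (rule finite_measure_mono)
      then show ?case using A(2) by simp
    qed
    then show "\<exists>C. \<forall>\<^sub>F n in sequentially. \<P>(\<omega> in M n. C * a n < \<bar>real (card (C1 n \<omega>))\<bar>) < e" by blast
  qed
  ultimately show ?thesis unfolding X_def a_def by blast
qed

end
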